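(* Let $D$ be a domain in $\mathbb C$ bounded by a rectifiable Jordan curve, and let $\nu:\partial D\to\mathbb C$ with $|\nu(\zeta)|=1$ for all $\zeta\in\partial D$, and $\varphi:\partial D\to\mathbb R$ be measurable functions with respect to the natural parameter. Then there exist harmonic functions $u:D\to\mathbb R$ such that, for a.e. point $\zeta\in\partial D$ with respect to the natural parameter, $$\lim_{z\to\zeta}\frac{\partial u}{\partial\nu}(z)=\varphi(\zeta)$$ along every nontangential path in $D$ to $\zeta$.
   Context: A harmonic function is a twice continuously differentiable solution of the Laplace equation $u_{xx}+u_{yy}=0$. "Domain bounded by a rectifiable Jordan curve" means the bounded (interior) component of the complement of a Jordan curve of finite length. The natural parameter on $\partial D$ is arc length; measurability and "a.e." are with respect to it. No integrability or boundedness of $\varphi$ is assumed. For a fixed boundary point $\zeta$ and $z\in D$, $\frac{\partial u}{\partial\nu}(z)$ denotes the derivative of $u$ at $z$ in the fixed direction $\nu=\nu(\zeta)$, i.e. $\frac{\partial u}{\partial\nu}(z)=\lim_{t\to0}\frac{u(z+t\nu(\zeta))-u(z)}{t}=\mathrm{Re}\big(\overline{\nu(\zeta)}\,\nabla u(z)\big)$, where $\nabla u=u_x+iu_y$; this is the scalar product of $\nu(\zeta)$ and the gradient viewed as vectors in $\mathbb R^2$. A path in $D$ ending at $\zeta\in\partial D$ is nontangential if, near $\zeta$, it lies in a set $\{z\in D:|z-\zeta|\le M\,\mathrm{dist}(z,\partial D)\}$ for some finite $M$. (A rectifiable curve has a tangent at a.e. point with respect to arc length; at such points this means that the path lies, near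 $\zeta$, in an angle of opening less than $\pi$ with vertex $\zeta$, symmetric about the interior normal.) *)

theory Defs
  imports "HOL-Analysis.Analysis"
begin

definition polygonal_lengths :: "(real \<Rightarrow> complex) \<Rightarrow> real \<Rightarrow> real \<Rightarrow> real set" where
  "polygonal_lengths \<gamma> a b =
     {(\<Sum>i<n. dist (\<gamma> (t i)) (\<gamma> (t (Suc i)))) | (n::nat) (t::nat \<Rightarrow> real).
        t 0 = a \<and> t n = b \<and> (\<forall>i<n. t i \<le> t (Suc i))}"

definition rectifiable_path :: "(real \<Rightarrow> complex) \<Rightarrow> bool" where
  "rectifiable_path \<gamma> \<longleftrightarrow> path \<gamma> \<and> bdd_above (polygonal_lengths \<gamma> 0 1)"

definition arclength :: "(real \<Rightarrow> complex) \<Rightarrow> real \<Rightarrow> real \<Rightarrow> real" where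
  "arclength \<gamma> a b = Sup (polygonal_lengths \<gamma> a b)"

definition rectifiable_Jordan_curve :: "(real \<Rightarrow> complex) \<Rightarrow> bool" where
  "rectifiable_Jordan_curve \<gamma> \<longleftrightarrow>
     simple_path \<gamma> \<and> pathfinish \<gamma> = pathstart \<gamma> \<and> rectifiable_path \<gamma>"

text \<open>
  For a rectifiable Jordan curve, \<open>t \<mapsto> arclength \<gamma> 0 t\<close> is a continuous strictly increasing
  bijection from \<open>[0, 1]\<close> onto \<open>[0, L]\<close>, where \<open>L = arclength \<gamma> 0 1\<close>; composing \<open>\<gamma>\<close> with its
  inverse gives the parametrization by arc length.
\<close>

definition natural_param :: "(real \<Rightarrow> complex) \<Rightarrow> real \<Rightarrow> complex" where
  "natural_param \<gamma> s = \<gamma> (inv_into {0..1} (arclength \<gamma> 0) s)"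

definition natural_param_space :: "(real \<Rightarrow> complex) \<Rightarrow> real measure" where
  "natural_param_space \<gamma> = lebesgue_on {0..arclength \<gamma> 0 1}"

definition measurable_wrt_natural_param ::
    "(real \<Rightarrow> complex) \<Rightarrow> (complex \<Rightarrow> 'a::topological_space) \<Rightarrow> bool" where
  "measurable_wrt_natural_param \<gamma> f \<longleftrightarrow>
     (\<lambda>s. f (natural_param \<gamma> s)) \<in> borel_measurable (natural_param_space \<gamma>)"

definition ae_wrt_natural_param :: "(real \<Rightarrow> complex) \<Rightarrow> (complex \<Rightarrow> bool) \<Rightarrow> bool" where
  "ae_wrt_natural_param \<gamma> P \<longleftrightarrow> (AE s in natural_param_space \<gamma>. P (natural_param \<gamma> s))"

text \<open>
  Intended for open \<open>D\<close>. Here \<open>u'\<close> and \<open>u''\<close> are the first and second Frechet derivatives over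
  the reals, so \<open>u'' z 1 1\<close> and \<open>u'' z \<i> \<i>\<close> are \<open>u\<^sub>x\<^sub>x\<close> and \<open>u\<^sub>y\<^sub>y\<close>.
\<close>

definition harmonic_on :: "(complex \<Rightarrow> real) \<Rightarrow> complex set \<Rightarrow> bool" where
  "harmonic_on u D \<longleftrightarrow>
     (\<exists>(u' :: complex \<Rightarrow> complex \<Rightarrow>\<^sub>L real) (u'' :: complex \<Rightarrow> complex \<Rightarrow>\<^sub>L (complex \<Rightarrow>\<^sub>L real)).
        (\<forall>z\<in>D. (u has_derivative blinfun_apply (u' z)) (at z)) \<and>
        (\<forall>z\<in>D. (u' has_derivative blinfun_apply (u'' z)) (at z)) \<and>
        continuous_on D u'' \<and>
        (\<forall>z\<in>D. blinfun_apply (blinfun_apply (u'' z) 1) 1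
              + blinfun_apply (blinfun_apply (u'' z) \<i>) \<i> = 0))"

definition dir_deriv :: "complex \<Rightarrow> (complex \<Rightarrow> real) \<Rightarrow> complex \<Rightarrow> real" where
  "dir_deriv v u z = deriv (\<lambda>t::real. u (z + of_real t * v)) 0"

text \<open>The end point \<open>p 1 = \<zeta>\<close> is the only point of the path that may lie outside \<open>D\<close>.\<close>

definition nontangential_path :: "complex set \<Rightarrow> complex \<Rightarrow> (real \<Rightarrow> complex) \<Rightarrow> bool" where
  "nontangential_path D \<zeta> p \<longleftrightarrow>
     path p \<and> p ` {0..<1} \<subseteq> D \<and> pathfinish p = \<zeta> \<and>
     (\<exists>M. \<forall>\<^sub>F t in at_left 1. dist (p t) \<zeta> \<le> M * infdist (p t) (frontier D))"

end

theory Submission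
  imports Defs "HOL-Complex_Analysis.Complex_Analysis"
begin

text \<open>
  Let \<open>F\<close> be holomorphic in \<open>D\<close> with derivative \<open>g\<close>, and \<open>u = Re F\<close>. The derivative of \<open>u\<close> in
  the direction \<open>\<nu>\<close> is \<open>Re (\<nu> g)\<close>, and every holomorphic \<open>g\<close> has a primitive because \<open>D\<close> is
  simply connected. So the task is to find a holomorphic \<open>g\<close> such that \<open>Re (\<nu> g)\<close> has the
  nontangential limit \<open>\<phi>\<close> almost everywhere. Only one real quantity is prescribed at each boundary
  point, and this leaves enough freedom to work directly on the curve, without a conformal map.

  Cut the curve into short arcs of equal length. The arc from \<open>a\<close> to \<open>b\<close> gets the kernel
  \<open>(1 / (\<pi> \<i>)) (\<integral> dw / (w - z) + (b - a) / (z - a))\<close>, the integral being taken along the arc, for a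
  positively oriented curve. The real part of the first term is the change of the argument of
  \<open>w - z\<close> divided by \<open>\<pi>\<close>. It tends to 1 when \<open>z\<close> approaches an inner point of a straight arc from
  inside \<open>D\<close>, and to 0 at the other points of the line. The second term is imaginary along that
  line, and it cancels the leading term far away: the kernel is bounded by a multiple of the square
  of (length of the arc) / (distance to the arc). If \<open>c\<close> is a continuous complex function that is
  close to \<open>\<phi>\<close> times the conjugate of \<open>\<nu>\<close>, then the sum of the kernels with coefficients the values
  of \<open>c\<close> at the nodes has boundary values close to \<open>c (1 + \<i> y)\<close> with \<open>y\<close> real and bounded, hence
  \<open>Re (\<nu> g)\<close> is close to \<open>\<phi>\<close>. The quadratic decay also shows that this sum is bounded in a
  nontangential approach region at \<open>\<zeta>\<close> by a constant times \<open>\<bar>c \<zeta>\<bar>\<close>, up to an arbitrarily small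
  error. All of this holds off a set of small measure (\<open>approximate_boundary_data\<close>), and the
  constant depends on that measure and on the aperture, but not on \<open>c\<close> or on the precision.

  The full data are then reached by successive corrections. Each correction is applied to what is
  left of the data after the previous ones, with exceptional sets of summable measure and with a
  precision chosen so small that it compensates the constant of the next correction. By
  Borel-Cantelli almost every boundary point avoids all but finitely many exceptional sets; there
  the series converges uniformly in approach regions, and its limit is \<open>\<phi>\<close>
  (\<open>boundary_values_of_rotated_real_part\<close>).

  Two geometric facts about a rectifiable Jordan curve enter. First, the curve is nearly flat:
  inscribed polygons with equal arcs have almost the full length, so on most arcs the component of
  the curve along the chord grows with almost unit speed, and a covering argument shows that most
  points of such an arc see the whole arc inside a narrow double cone (\<open>flat_cells\<close>). Second, the
  argument jumps in the right direction: the winding numbers just to the left and just to the right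
  of a flat point differ by 1, and both belong to the two values that a Jordan curve allows, which
  determines the contribution of the rest of the curve exactly (\<open>complement_change\<close>).
\<close>

section \<open>Steep points of a Lipschitz function\<close>

text \<open>
  A weak type estimate. The function \<open>t - f t\<close> is nondecreasing and gains at most \<open>e\<close>. An interval
  on which \<open>f\<close> has a slope less than \<open>1 - lam\<close> is one on which \<open>t - f t\<close> gains more than \<open>lam\<close> times
  the length, so disjoint intervals of this kind have total length at most \<open>e / lam\<close>; Vitali's
  covering lemma turns this into a bound for the union of all these intervals.
\<close>

lemma steep_off_small_set:
  fixes f :: "real \<Rightarrow> real"
  assumes lip: "\<And>s t. s \<in> {u..v} \<Longrightarrow> t \<in> {u..v} \<Longrightarrow> \<bar>f s - f t\<bar> \<le> \<bar>s - t\<bar>"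
    and "u \<le> v" and gain: "f v - f u \<ge> v - u - e" and lam: "lam > 0"
  obtains F where "F \<in> lmeasurable" "measure lebesgue F \<le> 5 * e / lam"
    "\<And>s t. s \<in> {u..v} - F \<Longrightarrow> t \<in> {u..v} \<Longrightarrow> (1 - lam) * (t - s)\<^sup>2 \<le> (t - s) * (f t - f s)"
proof -
  define h where "h = (\<lambda>t. t - f t)"
  have h_mono: "h s \<le> h t" if "u \<le> s" "s \<le> t" "t \<le> v" for s t
    using lip[of s t] that by (auto simp: h_def abs_if split: if_splits)
  define K where "K = {(s, t). u \<le> s \<and> s < t \<and> t \<le> v \<and> lam * (t - s) < h t - h s}"
  define ctr :: "real \<times> real \<Rightarrow> real" where "ctr = (\<lambda>p. (fst p + snd p) / 2)"
  define rad :: "real \<times> real \<Rightarrow> real" where "rad = (\<lambda>p. (snd p - fst p) / 2)"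
  have cb: "cball (ctr p) (rad p) = {fst p..snd p}" for p
    by (auto simp: ctr_def rad_def cball_eq_atLeastAtMost field_simps)
  have rad: "0 < rad p \<and> rad p \<le> v - u" if "p \<in> K" for p
    using that by (auto simp: K_def rad_def)
  obtain C where C: "countable C" "C \<subseteq> K"
     "pairwise (\<lambda>i j. disjnt (cball (ctr i) (rad i)) (cball (ctr j) (rad j))) C"
     "(\<Union>p\<in>K. cball (ctr p) (rad p)) \<subseteq> (\<Union>p\<in>C. cball (ctr p) (5 * rad p))"
    by (rule Vitali_covering_lemma_cballs [OF subset_refl rad])
  define F where "F = (\<Union>p\<in>C. cball (ctr p) (5 * rad p))"
  have bound: "measure lebesgue (\<Union>p\<in>I. cball (ctr p) (5 * rad p)) \<le> 5 * e / lam"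
    if I: "finite I" "I \<subseteq> C" for I
  proof -
    have IK: "u \<le> fst p" "fst p < snd p" "snd p \<le> v" "lam * (snd p - fst p) < h (snd p) - h (fst p)"
      if "p \<in> I" for p
      using that I C(2) by (auto simp: K_def)
    have "measure lebesgue (\<Union>p\<in>I. cball (ctr p) (5 * rad p))
        \<le> (\<Sum>p\<in>I. measure lebesgue (cball (ctr p) (5 * rad p)))"
      by (rule measure_UNION_le) (use I in auto)
    also have "\<dots> = (\<Sum>p\<in>I. 5 * (snd p - fst p))"
    proof (intro sum.cong refl)
      fix p assume "p \<in> I"
      then show "measure lebesgue (cball (ctr p) (5 * rad p)) = 5 * (snd p - fst p)"
        using IK(2)[of p] by (simp add: cball_eq_atLeastAtMost rad_def field_simps)
    qed
    also have "\<dots> \<le> (\<Sum>p\<in>I. 5 * ((h (snd p) - h (fst p)) / lam))"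
    proof (intro sum_mono)
      fix p assume "p \<in> I"
      then have "snd p - fst p \<le> (h (snd p) - h (fst p)) / lam"
        using IK(4)[of p] lam by (simp add: pos_le_divide_eq mult.commute less_imp_le)
      then show "5 * (snd p - fst p) \<le> 5 * ((h (snd p) - h (fst p)) / lam)"
        by (intro mult_left_mono) auto
    qed
    also have "\<dots> = 5 / lam * (\<Sum>p\<in>I. measure lebesgue {h (fst p)<..<h (snd p)})"
    proof -
      have "measure lebesgue {h (fst p)<..<h (snd p)} = h (snd p) - h (fst p)" if "p \<in> I" for p
        using IK[OF that] by (simp add: h_mono)
      then show ?thesis by (simp add: sum_distrib_left)
    qed
    finally have cover: "measure lebesgue (\<Union>p\<in>I. cball (ctr p) (5 * rad p))
        \<le> 5 / lam * (\<Sum>p\<in>I. measure lebesgue {h (fst p)<..<h (snd p)})" .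
    \<comment> \<open>The images of disjoint intervals under the monotone \<open>h\<close> are again disjoint, so the gains of \<open>h\<close> add up to at most its total gain.\<close>
    have "(\<Sum>p\<in>I. measure lebesgue {h (fst p)<..<h (snd p)})
        = measure lebesgue (\<Union>p\<in>I. {h (fst p)<..<h (snd p)})"
    proof (rule measure_UNION'[symmetric])
      show "pairwise (\<lambda>p q. disjnt {h (fst p)<..<h (snd p)} {h (fst q)<..<h (snd q)}) I"
      proof (rule pairwiseI)
        fix p q assume pq: "p \<in> I" "q \<in> I" "p \<noteq> q"
        then have "disjnt {fst p..snd p} {fst q..snd q}"
          using pairwiseD[OF C(3), of p q] subsetD[OF I(2)] by (simp add: cb)
        then have "max (fst p) (fst q) \<notin> {fst p..snd p} \<inter> {fst q..snd q}"
          by (simp add: disjnt_def)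
        then have "snd p < fst q \<or> snd q < fst p"
          using IK(2)[OF pq(1)] IK(2)[OF pq(2)] by (simp add: max_def split: if_splits)
        then show "disjnt {h (fst p)<..<h (snd p)} {h (fst q)<..<h (snd q)}"
        proof
          assume "snd p < fst q"
          then have "h (snd p) \<le> h (fst q)"
            using IK[OF pq(1)] IK[OF pq(2)] by (intro h_mono) auto
          then show ?thesis by (auto simp: disjnt_iff)
        next
          assume "snd q < fst p"
          then have "h (snd q) \<le> h (fst p)"
            using IK[OF pq(1)] IK[OF pq(2)] by (intro h_mono) auto
          then show ?thesis by (auto simp: disjnt_iff)
        qed
      qed
    qed (use I in auto)
    also have "\<dots> \<le> measure lebesgue {h u..h v}"
    proof (rule measure_mono_fmeasurable)
      show "(\<Union>p\<in>I. {h (fst p)<..<h (snd p)}) \<subseteq> {h u..h v}"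
      proof clarsimp
        fix a b x assume "(a, b) \<in> I" "h a < x" "x < h b"
        then show "h u \<le> x \<and> x \<le> h v"
          using IK[of "(a,b)"] h_mono[of u a] h_mono[of b v] by auto
      qed
    qed (use I in auto)
    also have "\<dots> \<le> e"
      using h_mono[of u v] \<open>u \<le> v\<close> gain by (simp add: h_def)
    finally have "5 / lam * (\<Sum>p\<in>I. measure lebesgue {h (fst p)<..<h (snd p)}) \<le> 5 / lam * e"
      using lam by (intro mult_left_mono) auto
    then show ?thesis
      using cover by simp
  qed
  show thesis
  proof
    show "F \<in> lmeasurable"
      unfolding F_def by (rule fmeasurable_UN_bound[OF C(1) _ bound]) auto
    show "measure lebesgue F \<le> 5 * e / lam"
      unfolding F_def by (rule measure_UN_bound[OF C(1) _ bound]) auto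
  next
    fix s t assume s: "s \<in> {u..v} - F" and t: "t \<in> {u..v}"
    have notK: "p \<notin> K" if "s \<in> {fst p..snd p}" for p
    proof
      assume "p \<in> K"
      then have "s \<in> (\<Union>p\<in>K. cball (ctr p) (rad p))"
        using that by (intro UN_I[of p]) (simp_all add: cb)
      then have "s \<in> F"
        using C(4) unfolding F_def by blast
      then show False
        using s by auto
    qed
    have "(s, t) \<notin> K" "(t, s) \<notin> K" if "s \<noteq> t"
      using notK[of "(s,t)"] notK[of "(t,s)"] by (auto simp: K_def)
    then have "s = t \<or> (s < t \<and> h t - h s \<le> lam * (t - s)) \<or> (t < s \<and> h s - h t \<le> lam * (s - t))"
      using s t by (simp add: K_def not_less) linarith
    then consider "s = t" | "s < t" "h t - h s \<le> lam * (t - s)" | "t < s" "h s - h t \<le> lam * (s - t)"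
      by blast
    then show "(1 - lam) * (t - s)\<^sup>2 \<le> (t - s) * (f t - f s)"
    proof cases
      case 2
      then have "(1 - lam) * (t - s) \<le> f t - f s" by (simp add: h_def algebra_simps)
      then have "(t - s) * ((1 - lam) * (t - s)) \<le> (t - s) * (f t - f s)"
        using 2 by (intro mult_left_mono) auto
      then show ?thesis by (simp add: power2_eq_square algebra_simps)
    next
      case 3
      then have "(1 - lam) * (s - t) \<le> f s - f t" by (simp add: h_def algebra_simps)
      then have "(s - t) * ((1 - lam) * (s - t)) \<le> (s - t) * (f s - f t)"
        using 3 by (intro mult_left_mono) auto
      then show ?thesis by (simp add: power2_eq_square algebra_simps)
    qed auto
  qed
qed

section \<open>Change of the logarithm along an arc\<close>

text \<open>
  The increment along \<open>[s, t]\<close> of a continuous logarithm of \<open>f - z\<close>, that is \<open>\<integral> dw / (w - z)\<close> along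
  the arc. The logarithm may be any continuous lift, so that the definition makes sense for arcs
  that are merely continuous; two lifts differ by a constant.
\<close>

definition log_change :: "(real \<Rightarrow> complex) \<Rightarrow> real \<Rightarrow> real \<Rightarrow> complex \<Rightarrow> complex" where
  "log_change f s t z = (SOME w. \<exists>q. continuous_on {s..t} q \<and>
     (\<forall>x\<in>{s..t}. f x - z = exp (q x)) \<and> w = q t - q s)"

lemma log_change_eqI:
  assumes "s \<le> t" "continuous_on {s..t} q" "\<And>x. x \<in> {s..t} \<Longrightarrow> f x - z = exp (q x)"
  shows "log_change f s t z = q t - q s"
proof -
  have "\<exists>w q. continuous_on {s..t} q \<and> (\<forall>x\<in>{s..t}. f x - z = exp (q x)) \<and> w = q t - q s"
    using assms by blast
  from someI_ex[OF this] obtain q' where q': "continuous_on {s..t} q'"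
      "\<forall>x\<in>{s..t}. f x - z = exp (q' x)" "log_change f s t z = q' t - q' s"
    unfolding log_change_def by blast
  define r where "r = (\<lambda>x. q' x - q x)"
  have r1: "exp (r x) = 1" if "x \<in> {s..t}" for x
    using q'(2) assms(3)[OF that] that unfolding r_def exp_diff by (metis div_self exp_not_eq_zero)
  have "r constant_on {s..t}"
  proof (rule continuous_discrete_range_constant)
    show "continuous_on {s..t} r"
      unfolding r_def by (intro continuous_intros q' assms)
    fix x assume x: "x \<in> {s..t}"
    have "2 * pi \<le> norm (r y - r x)" if "y \<in> {s..t}" "r y \<noteq> r x" for y
    proof -
      from r1[OF x] obtain m :: int where m: "Re (r x) = 0" "Im (r x) = of_int (2 * m) * pi"
        unfolding exp_eq_1 by blast
      from r1[OF that(1)] obtain n :: int where n: "Re (r y) = 0" "Im (r y) = of_int (2 * n) * pi"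
        unfolding exp_eq_1 by blast
      have "m \<noteq> n" using m n that(2) by (auto simp: complex_eq_iff)
      then have "1 \<le> \<bar>real_of_int (n - m)\<bar>" by linarith
      then have "2 * pi * 1 \<le> 2 * pi * \<bar>real_of_int (n - m)\<bar>"
        by (intro mult_left_mono) auto
      also have "\<dots> = \<bar>2 * pi * real_of_int (n - m)\<bar>"
        by (simp add: abs_mult)
      also have "2 * pi * real_of_int (n - m) = Im (r y - r x)"
        using m n by (simp add: algebra_simps)
      also have "\<bar>Im (r y - r x)\<bar> \<le> norm (r y - r x)" by (rule abs_Im_le_cmod)
      finally show ?thesis by simp
    qed
    then show "\<exists>e>0. \<forall>y. y \<in> {s..t} \<and> r y \<noteq> r x \<longrightarrow> e \<le> norm (r y - r x)"
      by (intro exI[of _ "2 * pi"]) auto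
  qed (simp add: connected_Icc)
  then have "r s = r t"
    using \<open>s \<le> t\<close> unfolding constant_on_def by auto
  moreover have "(q' t - q' s) - (q t - q s) = r t - r s"
    by (simp add: r_def)
  ultimately have "(q' t - q' s) - (q t - q s) = 0" by simp
  then show ?thesis
    by (simp only: q'(3) right_minus_eq)
qed

lemma log_change_lift:
  fixes f :: "real \<Rightarrow> complex"
  assumes "continuous_on {s..t} f" "z \<notin> f ` {s..t}"
  obtains q where "continuous_on {s..t} q" "\<And>x. x \<in> {s..t} \<Longrightarrow> f x - z = exp (q x)"
proof (rule continuous_logarithm_on_contractible[of "{s..t}" "\<lambda>x. f x - z"])
  show "continuous_on {s..t} (\<lambda>x. f x - z)" by (intro continuous_intros assms)
  show "contractible {s..t}" by (simp add: convex_imp_contractible)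
qed (use assms in auto)

lemma log_change_add:
  assumes "s \<le> t" "t \<le> u" "continuous_on {s..u} f" "z \<notin> f ` {s..u}"
  shows "log_change f s u z = log_change f s t z + log_change f t u z"
proof -
  obtain q where q: "continuous_on {s..u} q" "\<And>x. x \<in> {s..u} \<Longrightarrow> f x - z = exp (q x)"
    using log_change_lift[OF assms(3,4)] by blast
  have "log_change f s u z = q u - q s" "log_change f s t z = q t - q s" "log_change f t u z = q u - q t"
    by (rule log_change_eqI; use assms q in \<open>auto intro: continuous_on_subset\<close>)+
  then show ?thesis by simp
qed

text \<open>
  If the arc does not meet a half-line issuing from \<open>z\<close>, a rotated principal branch is a lift.
\<close>

lemma log_change_halfline:
  assumes "s \<le> t" "continuous_on {s..t} f" "c \<noteq> 0"
    and "\<And>x. x \<in> {s..t} \<Longrightarrow> (f x - z) * c \<notin> \<real>\<^sub>\<le>\<^sub>0"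
  shows "log_change f s t z = Ln ((f t - z) * c) - Ln ((f s - z) * c)"
proof -
  define q where "q = (\<lambda>x. Ln ((f x - z) * c) - Ln c)"
  have "log_change f s t z = q t - q s"
  proof (rule log_change_eqI)
    show "continuous_on {s..t} q"
      unfolding q_def using assms by (intro continuous_intros) auto
    fix x assume "x \<in> {s..t}"
    then have "(f x - z) * c \<noteq> 0" using assms(4)[of x] by force
    then show "f x - z = exp (q x)" using assms by (simp add: q_def exp_diff)
  qed fact
  then show ?thesis by (simp add: q_def)
qed

lemma one_plus_notin_nonpos:
  assumes "norm (w::complex) < 1"
  shows "1 + w \<notin> \<real>\<^sub>\<le>\<^sub>0" "1 + w \<noteq> 0"
proof -
  have "Re w > -1" using abs_Re_le_cmod[of w] assms by linarith
  then show "1 + w \<notin> \<real>\<^sub>\<le>\<^sub>0" "1 + w \<noteq> 0"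
    by (auto simp: complex_nonpos_Reals_iff complex_eq_iff)
qed

lemma log_change_short:
  assumes "s \<le> t" "continuous_on {s..t} f"
    and "\<And>x. x \<in> {s..t} \<Longrightarrow> norm (f x - f s) < norm (f s - z)"
  shows "log_change f s t z = Ln (1 + (f t - f s) / (f s - z))"
proof -
  have nz: "f s - z \<noteq> 0" using assms(3)[of s] assms(1) by auto
  have small: "norm ((f x - f s) / (f s - z)) < 1" if "x \<in> {s..t}" for x
    using assms(3)[OF that] nz by (simp add: norm_divide)
  have "log_change f s t z = Ln ((f t - z) * inverse (f s - z)) - Ln ((f s - z) * inverse (f s - z))"
  proof (rule log_change_halfline[OF assms(1,2)])
    fix x assume "x \<in> {s..t}"
    moreover have "(f x - z) * inverse (f s - z) = 1 + (f x - f s) / (f s - z)"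
      using nz by (simp add: field_simps)
    ultimately show "(f x - z) * inverse (f s - z) \<notin> \<real>\<^sub>\<le>\<^sub>0"
      using one_plus_notin_nonpos(1)[OF small] by simp
  qed (use nz in auto)
  also have "(f t - z) * inverse (f s - z) = 1 + (f t - f s) / (f s - z)"
    using nz by (simp add: field_simps)
  also have "(f s - z) * inverse (f s - z) = 1" using nz by simp
  finally show ?thesis by simp
qed

text \<open>
  For \<open>z'\<close> closer to \<open>z\<close> than the arc is, \<open>f - z'\<close> is \<open>f - z\<close> times a factor in the disc of radius 1
  about 1, where the principal logarithm is continuous. This gives holomorphy in \<open>z\<close>, and later
  the boundedness near points of the curve that lie off the arc.
\<close>

lemma log_change_perturb:
  assumes "s \<le> t" "continuous_on {s..t} f"
    and "\<And>x. x \<in> {s..t} \<Longrightarrow> norm (z' - z) < norm (f x - z)"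
  shows "log_change f s t z' = log_change f s t z
           + Ln (1 + (z - z') / (f t - z)) - Ln (1 + (z - z') / (f s - z))"
proof -
  have nz: "f x - z \<noteq> 0" if "x \<in> {s..t}" for x using assms(3)[OF that] by auto
  have small: "norm ((z - z') / (f x - z)) < 1" if "x \<in> {s..t}" for x
    using assms(3)[OF that] nz[OF that] by (simp add: norm_divide norm_minus_commute)
  obtain q where q: "continuous_on {s..t} q" "\<And>x. x \<in> {s..t} \<Longrightarrow> f x - z = exp (q x)"
  proof (rule log_change_lift[OF assms(2)])
    show "z \<notin> f ` {s..t}" using nz by (metis eq_iff_diff_eq_0 imageE)
  qed blast
  define r where "r = (\<lambda>x. q x + Ln (1 + (z - z') / (f x - z)))"
  have "log_change f s t z' = r t - r s"
  proof (rule log_change_eqI)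
    show "continuous_on {s..t} r"
      unfolding r_def using nz one_plus_notin_nonpos[OF small]
      by (intro continuous_intros q assms) auto
    fix x assume x: "x \<in> {s..t}"
    have "exp (r x) = (f x - z) * (1 + (z - z') / (f x - z))"
      using one_plus_notin_nonpos(2)[OF small[OF x]] q(2)[OF x] by (simp add: r_def exp_add)
    also have "\<dots> = f x - z'"
      using nz[OF x] by (simp add: distrib_left)
    finally show "f x - z' = exp (r x)" by simp
  qed fact
  then show ?thesis
    using log_change_eqI[OF assms(1) q] by (simp add: r_def)
qed

lemma separated_from_arc:
  fixes f :: "real \<Rightarrow> complex"
  assumes "continuous_on {s..t} f" "z \<notin> f ` {s..t}"
  obtains r where "r > 0" "\<And>x. x \<in> {s..t} \<Longrightarrow> r \<le> norm (f x - z)"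
proof -
  have "closed (f ` {s..t})"
    using assms(1) compact_continuous_image compact_imp_closed by blast
  from separate_point_closed[OF this assms(2)] show thesis
    using that by (auto simp: dist_norm norm_minus_commute)
qed

lemma log_change_holomorphic:
  assumes "s \<le> t" "continuous_on {s..t} f"
  shows "log_change f s t holomorphic_on - f ` {s..t}"
proof (unfold holomorphic_on_def, rule ballI, rule field_differentiable_at_within)
  fix z assume z: "z \<in> - f ` {s..t}"
  then obtain r where r: "r > 0" "\<And>x. x \<in> {s..t} \<Longrightarrow> r \<le> norm (f x - z)"
    using separated_from_arc[OF assms(2)] by blast
  have nz: "f x - z \<noteq> 0" if "x \<in> {s..t}" for x using r that by force
  define h where "h = (\<lambda>z'. log_change f s t z
           + Ln (1 + (z - z') / (f t - z)) - Ln (1 + (z - z') / (f s - z)))"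
  have reg: "1 + (z - z') / (f x - z) \<notin> \<real>\<^sub>\<le>\<^sub>0" if "x \<in> {s..t}" "z' \<in> ball z r" for x z'
    using that r(2)[OF that(1)] nz[OF that(1)]
    by (intro one_plus_notin_nonpos(1)) (auto simp: norm_divide dist_norm divide_simps)
  have 1: "h field_differentiable at z"
    unfolding h_def
    by (rule holomorphic_on_imp_differentiable_at[where s = "ball z r"], intro holomorphic_intros)
       (use r(1) reg assms(1) nz in auto)
  then obtain h' where h': "(h has_field_derivative h') (at z)"
    by (auto simp: field_differentiable_def)
  have "(log_change f s t has_field_derivative h') (at z)"
  proof (rule has_field_derivative_transform_within_open[OF h'])
    fix z' assume "z' \<in> ball z r"
    then have "norm (z' - z) < norm (f x - z)" if "x \<in> {s..t}" for x
      using r(2)[OF that] by (simp add: dist_norm norm_minus_commute)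
    from log_change_perturb[OF assms this] show "h z' = log_change f s t z'"
      by (simp add: h_def)
  qed (use r in auto)
  then show "log_change f s t field_differentiable at z"
    by (auto simp: field_differentiable_def)
qed

text \<open>
  The arc is divided into pieces of length at most \<open>d / 3\<close>; seen from \<open>z\<close> each of them is short, and
  contributes at most 1.
\<close>

lemma norm_log_change_le:
  assumes "s \<le> t" "\<And>x y. x \<in> {s..t} \<Longrightarrow> y \<in> {s..t} \<Longrightarrow> norm (f x - f y) \<le> \<bar>x - y\<bar>"
    and "d > 0" "\<And>x. x \<in> {s..t} \<Longrightarrow> d \<le> norm (f x - z)"
    and "t - s \<le> real n * (d / 3)"
  shows "norm (log_change f s t z) \<le> real n"
  using assms
proof (induction n arbitrary: t)
  case 0
  then have "s = t" by simp
  have "log_change f s s z = 0"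
  proof -
    have "f t - z \<noteq> 0" using 0(3) 0(4)[of t] \<open>s = t\<close> by auto
    then show ?thesis
      using exp_Ln[of "f t - z"] \<open>s = t\<close>
      by (subst log_change_eqI[where q = "\<lambda>_. Ln (f t - z)"]) (auto simp del: exp_Ln)
  qed
  then show ?case using \<open>s = t\<close> by simp
next
  case (Suc n)
  have cont: "continuous_on {s..t} f"
    using Suc.prems(2) by (intro lipschitz_on_continuous_on[of 1]) (auto simp: lipschitz_on_def dist_norm)
  have zn: "z \<notin> f ` {s..t}" using Suc.prems(3,4) by force
  define m where "m = max s (t - d / 3)"
  have m: "s \<le> m" "m \<le> t" "t - m \<le> d / 3" using Suc.prems(1,3) by (auto simp: m_def max_def)
  have "m - s \<le> real n * (d / 3)"
  proof (cases "m = s")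
    case False
    then have "m = t - d / 3" by (auto simp: m_def)
    then show ?thesis using Suc.prems(5) by (simp add: algebra_simps)
  qed (use Suc.prems(3) in auto)
  then have IH: "norm (log_change f s m z) \<le> real n"
    using m Suc.prems by (intro Suc.IH) auto
  have "log_change f m t z = Ln (1 + (f t - f m) / (f m - z))"
  proof (rule log_change_short)
    fix x assume x: "x \<in> {m..t}"
    then have "norm (f x - f m) \<le> \<bar>x - m\<bar>" using m by (intro Suc.prems) auto
    also have "\<dots> \<le> d / 3" using x m by auto
    also have "\<dots> < norm (f m - z)" using Suc.prems(3) Suc.prems(4)[of m] m by auto
    finally show "norm (f x - f m) < norm (f m - z)" .
  qed (use m in \<open>auto intro: continuous_on_subset[OF cont]\<close>)
  moreover have "norm ((f t - f m) / (f m - z)) \<le> (d / 3) / d"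
  proof -
    have "norm (f t - f m) \<le> d / 3"
      using Suc.prems(2)[of t m] m by auto
    then show ?thesis
      unfolding norm_divide using Suc.prems(3) Suc.prems(4)[of m] m
      by (intro frac_le) auto
  qed
  ultimately have "norm (log_change f m t z) \<le> 2 * (1 / 3)"
    using norm_Ln_le[of "(f t - f m) / (f m - z)"] Suc.prems(3) by simp
  moreover have "log_change f s t z = log_change f s m z + log_change f m t z"
    by (rule log_change_add[OF m(1,2) cont zn])
  ultimately have "norm (log_change f s t z) \<le> real n + 2 * (1 / 3)"
    using IH norm_triangle_ineq[of "log_change f s m z" "log_change f m t z"] by simp
  then show ?case by simp
qed

text \<open>
  \<open>\<integral> (1 / (w - z) - 1 / (f s - z)) dw\<close> along the arc: the density \<open>1\<close> on the arc is compensated by a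
  point mass at its starting point.
\<close>

definition cell_kernel :: "(real \<Rightarrow> complex) \<Rightarrow> real \<Rightarrow> real \<Rightarrow> complex \<Rightarrow> complex" where
  "cell_kernel f s t z = log_change f s t z + (f t - f s) / (z - f s)"

text \<open>
  If the arc is short compared with the distance, the kernel is \<open>Ln (1 + w) - w\<close> for the small number
  \<open>w = (f t - f s) / (f s - z)\<close>, hence quadratic in \<open>w\<close>. Otherwise the ratio \<open>(t - s) / d\<close> is bounded
  below and the linear bound \<open>norm_log_change_le\<close> is already quadratic in it.
\<close>

lemma norm_cell_kernel_le:
  assumes "s \<le> t" and lip: "\<And>x y. x \<in> {s..t} \<Longrightarrow> y \<in> {s..t} \<Longrightarrow> norm (f x - f y) \<le> \<bar>x - y\<bar>"
    and "d > 0" and far: "\<And>x. x \<in> {s..t} \<Longrightarrow> d \<le> norm (f x - z)"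
  shows "norm (cell_kernel f s t z) \<le> 21 * ((t - s) / d)\<^sup>2"
proof -
  define w where "w = (f t - f s) / (f s - z)"
  have ck: "cell_kernel f s t z = log_change f s t z - w"
  proof -
    have "(f t - f s) / (z - f s) = - w"
      unfolding w_def by (metis minus_diff_eq minus_divide_right)
    then show ?thesis by (simp add: cell_kernel_def)
  qed
  have cont: "continuous_on {s..t} f"
    using lip by (intro lipschitz_on_continuous_on[of 1]) (auto simp: lipschitz_on_def dist_norm)
  have nw: "norm w \<le> (t - s) / d"
    unfolding w_def norm_divide using lip[of t s] far[of s] \<open>d > 0\<close> \<open>s \<le> t\<close>
    by (intro frac_le) auto
  show ?thesis
  proof (cases "t - s \<le> d / 3")
    case True
    have "log_change f s t z = Ln (1 + w)"
      unfolding w_def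
    proof (rule log_change_short[OF assms(1) cont])
      fix x assume x: "x \<in> {s..t}"
      then have "norm (f x - f s) \<le> \<bar>x - s\<bar>" using assms(1) by (intro lip) auto
      also have "\<dots> \<le> d / 3" using x True by auto
      also have "\<dots> < norm (f s - z)" using \<open>d > 0\<close> far[of s] \<open>s \<le> t\<close> by auto
      finally show "norm (f x - f s) < norm (f s - z)" .
    qed
    moreover have w3: "norm w \<le> 1 / 3"
    proof -
      have "(t - s) / d \<le> 1 / 3" using True \<open>d > 0\<close> by (simp add: divide_le_eq)
      then show ?thesis using nw by linarith
    qed
    ultimately have "norm (cell_kernel f s t z) \<le> (norm w)\<^sup>2 / (1 - norm w)"
      using ck Ln_approx_linear[of w] by simp
    also have "\<dots> \<le> (norm w)\<^sup>2 / (1/3)"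
      using w3 by (intro divide_left_mono) auto
    also have "\<dots> \<le> 21 * (norm w)\<^sup>2" by simp
    also have "\<dots> \<le> 21 * ((t - s) / d)\<^sup>2"
      using nw by (intro mult_left_mono power_mono) auto
    finally show ?thesis .
  next
    case False
    define x where "x = (t - s) / d"
    have x: "x > 1 / 3" using False \<open>d > 0\<close> by (simp add: x_def field_simps)
    define n where "n = nat \<lceil>3 * x\<rceil>"
    have n: "3 * x \<le> real n" "real n \<le> 3 * x + 1" using x unfolding n_def by linarith+
    have "norm (log_change f s t z) \<le> real n"
    proof (rule norm_log_change_le[OF assms])
      have "t - s = x * d" using \<open>d > 0\<close> by (simp add: x_def)
      also have "\<dots> \<le> real n / 3 * d" using n \<open>d > 0\<close> by (intro mult_right_mono) auto
      finally show "t - s \<le> real n * (d / 3)" by simp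
    qed auto
    then have "norm (cell_kernel f s t z) \<le> real n + x"
      using ck nw norm_triangle_ineq4[of "log_change f s t z" w] by (simp add: x_def)
    also have "\<dots> \<le> 7 * x" using n x by simp
    also have "\<dots> \<le> 7 * x * (3 * x)" using x by (simp add: mult_left_mono)
    also have "\<dots> = 21 * x\<^sup>2" by (simp add: power2_eq_square)
    finally show ?thesis by (simp add: x_def)
  qed
qed

lemma cell_kernel_holomorphic:
  assumes "s \<le> t" "continuous_on {s..t} f"
  shows "cell_kernel f s t holomorphic_on - f ` {s..t}"
  unfolding cell_kernel_def
  by (intro holomorphic_intros log_change_holomorphic[OF assms]) (use assms in auto)

section \<open>Flatness of a curve parametrized by arc length\<close>

lemma grid_neighbourhood_small:
  fixes a :: "nat \<Rightarrow> real"
  assumes "\<rho> \<ge> 0"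
  shows "(\<Union>i\<le>n. cball (a i) \<rho>) \<in> lmeasurable"
    and "measure lebesgue (\<Union>i\<le>n. cball (a i) \<rho>) \<le> real (n + 1) * (2 * \<rho>)"
proof -
  show "(\<Union>i\<le>n. cball (a i) \<rho>) \<in> lmeasurable"
    by (intro fmeasurable_UN_bound fmeasurable.finite_UN) auto
  have "measure lebesgue (\<Union>i\<in>{..n}. cball (a i) \<rho>) \<le> (\<Sum>i\<le>n. measure lebesgue (cball (a i) \<rho>))"
    by (rule measure_UNION_le) auto
  also have "\<dots> = (\<Sum>i\<le>n. 2 * \<rho>)"
    using assms by (intro sum.cong) (auto simp: cball_eq_atLeastAtMost)
  finally show "measure lebesgue (\<Union>i\<le>n. cball (a i) \<rho>) \<le> real (n + 1) * (2 * \<rho>)" by simp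
qed

text \<open>
  The properties of a simple closed curve parametrized by arc length that are used below. The last
  one says that \<open>L\<close> is the length: together with the Lipschitz condition it makes inscribed
  polygons almost as long as the parameter interval.
\<close>

locale arclength_curve =
  fixes G :: "real \<Rightarrow> complex" and L :: real
  assumes L_pos: "0 < L"
    and lipschitz: "\<And>s t. s \<in> {0..L} \<Longrightarrow> t \<in> {0..L} \<Longrightarrow> norm (G s - G t) \<le> \<bar>s - t\<bar>"
    and injective: "\<And>s t. s \<in> {0..L} \<Longrightarrow> t \<in> {0..L} \<Longrightarrow> G s = G t \<Longrightarrow>
          s = t \<or> s = 0 \<and> t = L \<or> s = L \<and> t = 0"
    and long_chords: "\<And>e. e > 0 \<Longrightarrow> \<exists>n t. t 0 = 0 \<and> t n = L \<and> (\<forall>i<n. t i \<le> t (Suc i)) \<and>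
          L - e \<le> (\<Sum>i<n. norm (G (t (Suc i)) - G (t i)))"
begin

definition node :: "nat \<Rightarrow> nat \<Rightarrow> real" where
  "node n i = L * real i / real n"

lemma node_0 [simp]: "node n 0 = 0"
  by (simp add: node_def)

lemma node_last [simp]: "n > 0 \<Longrightarrow> node n n = L"
  by (simp add: node_def)

lemma node_mono: "i \<le> j \<Longrightarrow> node n i \<le> node n j"
  using L_pos by (simp add: node_def divide_right_mono)

lemma node_nonneg [simp]: "0 \<le> node n i"
  using L_pos by (simp add: node_def)

lemma node_le_L: "n > 0 \<Longrightarrow> i \<le> n \<Longrightarrow> node n i \<le> L"
  using node_mono[of i n n] by simp

lemma node_Suc: "node n (Suc i) = node n i + L / real n"
  by (simp add: node_def distrib_left add_divide_distrib)

lemma continuous: "continuous_on {0..L} G"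
  using lipschitz by (intro lipschitz_on_continuous_on[of 1]) (auto simp: lipschitz_on_def dist_norm)

lemma cell_of:
  assumes "n > 0" "0 \<le> s" "s < L"
  obtains i where "i < n" "node n i \<le> s" "s < node n (Suc i)"
proof -
  define i where "i = nat \<lfloor>s * n / L\<rfloor>"
  have i: "real i \<le> s * n / L" "s * n / L < real i + 1"
    using assms L_pos unfolding i_def by (simp_all add: of_nat_nat)
  have "s * n / L < n" using assms L_pos by (simp add: field_simps)
  then have "i < n" using i by linarith
  moreover have "node n i \<le> s" "s < node n (Suc i)"
    using i assms L_pos by (simp_all add: node_def field_simps)
  ultimately show thesis using that by blast
qed

text \<open>
  A fixed polygon of almost full length is compared with the polygons of equal arcs. Rounding both
  ends of one of its \<open>m\<close> edges down to nodes costs at most \<open>2 d\<close>, where \<open>d\<close> is the length of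
  an arc, and so at most \<open>2 m d\<close> in total.
\<close>

lemma uniform_chords:
  assumes "e > 0"
  obtains n0 where "n0 > 0"
    "\<And>n. n \<ge> n0 \<Longrightarrow> L - e \<le> (\<Sum>i<n. norm (G (node n (Suc i)) - G (node n i)))"
proof -
  obtain m t where t: "t 0 = 0" "t m = L" "\<forall>i<m. t i \<le> t (Suc i)"
      "L - e / 2 \<le> (\<Sum>i<m. norm (G (t (Suc i)) - G (t i)))"
    using long_chords[of "e / 2"] assms by auto
  have t_nonneg: "0 \<le> t i" if "i \<le> m" for i
    using that
  proof (induction i)
    case (Suc i)
    then have "t i \<le> t (Suc i)" using t(3) by auto
    then show ?case using Suc by auto
  qed (use t in auto)
  have t_le: "t i \<le> L" if "i \<le> m" for i
    using that
  proof (induction i rule: inc_induct)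
    case (step i)
    then show ?case using t(3) by force
  qed (use t in auto)
  obtain n0 :: nat where n0: "4 * real m * L / e < real n0"
    using reals_Archimedean2 by blast
  show thesis
  proof (rule that[of "Suc n0"])
    fix n assume n: "n \<ge> Suc n0"
    then have "n > 0" by simp
    define d where "d = L / real n"
    have "d > 0" using L_pos n by (simp add: d_def)
    have "2 * real m * d \<le> e / 2"
    proof -
      have "4 * real m * L / e \<le> real n" using n0 n by linarith
      then show ?thesis using assms \<open>n > 0\<close> by (simp add: d_def field_simps)
    qed
    define c where "c = (\<lambda>i. norm (G (node n (Suc i)) - G (node n i)))"
    define idx where "idx = (\<lambda>x. nat \<lfloor>x / d\<rfloor>)"
    define S where "S = (\<lambda>x. \<Sum>i<idx x. c i)"
    have idx: "node n (idx x) \<le> x" "x \<le> node n (idx x) + d" "idx x \<le> n" if "0 \<le> x" "x \<le> L" for x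
    proof -
      have i: "real (idx x) \<le> x / d" "x / d < real (idx x) + 1"
        using that \<open>d > 0\<close> unfolding idx_def by (simp_all add: of_nat_nat)
      have nd: "node n (idx x) = d * idx x" by (simp add: node_def d_def)
      show "node n (idx x) \<le> x" "x \<le> node n (idx x) + d"
        using i \<open>d > 0\<close> unfolding nd by (simp_all add: field_simps)
      have "x / d \<le> n" using that \<open>n > 0\<close> L_pos by (simp add: d_def field_simps)
      then show "idx x \<le> n" using i(1) by linarith
    qed
    have step: "norm (G q - G p) \<le> S q - S p + 2 * d" if pq: "0 \<le> p" "p \<le> q" "q \<le> L" for p q
    proof -
      have ab: "idx p \<le> idx q"
        unfolding idx_def using pq \<open>d > 0\<close> by (intro nat_mono floor_mono divide_right_mono) auto
      have "G (node n (idx q)) - G (node n (idx p))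
          = (\<Sum>i=idx p..<idx q. G (node n (Suc i)) - G (node n i))"
        using sum_Suc_diff'[OF ab, of "\<lambda>i. G (node n i)"] by simp
      then have "norm (G (node n (idx q)) - G (node n (idx p))) \<le> (\<Sum>i=idx p..<idx q. c i)"
        unfolding c_def by (metis norm_sum)
      also have "\<dots> = S q - S p"
      proof -
        have "{..<idx q} = {..<idx p} \<union> {idx p..<idx q}" using ab by auto
        then have "S q = S p + (\<Sum>i=idx p..<idx q. c i)"
          unfolding S_def by (simp add: sum.union_disjoint ivl_disj_int)
        then show ?thesis by simp
      qed
      finally have 1: "norm (G (node n (idx q)) - G (node n (idx p))) \<le> S q - S p" .
      have 2: "norm (G x - G (node n (idx x))) \<le> d" if "0 \<le> x" "x \<le> L" for x
        using lipschitz[of x "node n (idx x)"] idx[OF that] that node_le_L[OF \<open>n > 0\<close>] by auto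
      have "norm (G q - G p) \<le> norm (G (node n (idx q)) - G (node n (idx p)))
          + norm (G q - G (node n (idx q))) + norm (G p - G (node n (idx p)))"
        by norm
      then show ?thesis using 1 2[of p] 2[of q] pq by auto
    qed
    have "L - e / 2 \<le> (\<Sum>i<m. norm (G (t (Suc i)) - G (t i)))" by (rule t)
    also have "\<dots> \<le> (\<Sum>i<m. (S (t (Suc i)) - S (t i)) + 2 * d)"
      by (intro sum_mono step) (use t t_nonneg t_le in auto)
    also have "\<dots> = S L - S 0 + real m * (2 * d)"
      using t by (simp add: sum.distrib sum_lessThan_telescope[of "\<lambda>i. S (t i)"])
    also have "S 0 = 0" by (simp add: S_def idx_def)
    also have "S L \<le> (\<Sum>i<n. c i)"
      unfolding S_def using idx(3)[of L] L_pos by (intro sum_mono2) (auto simp: c_def)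
    finally show "L - e \<le> (\<Sum>i<n. norm (G (node n (Suc i)) - G (node n i)))"
      using \<open>2 * real m * d \<le> e / 2\<close> by (simp add: c_def)
  qed simp
qed

text \<open>
  On the \<open>i\<close>-th cell let \<open>f i\<close> be the coordinate of the curve along the chord. It is 1-Lipschitz and
  its defect is the difference of arc and chord, so \<open>steep_off_small_set\<close> applies, and the defects
  have a small sum by \<open>uniform_chords\<close>. A point that moves at most with unit speed and whose
  coordinate in the direction \<open>\<tau>\<close> changes by at least \<open>(1 - lam) \<bar>t - s\<bar>\<close> deviates from uniform
  motion by at most \<open>sqrt (2 lam) \<bar>t - s\<bar>\<close>.
\<close>

lemma flat_cells:
  assumes "e > 0" "\<sigma> > 0"
  obtains n0 where "n0 > 0"
    "\<And>n. n \<ge> n0 \<Longrightarrow> \<exists>F\<in>lmeasurable. measure lebesgue F \<le> e \<and>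
       (\<forall>i<n. \<forall>s\<in>{node n i..node n (Suc i)} - F. \<exists>\<tau>. norm \<tau> = 1 \<and>
          (\<forall>t\<in>{node n i..node n (Suc i)}. norm (G t - G s - of_real (t - s) * \<tau>) \<le> \<sigma> * \<bar>t - s\<bar>))"
proof -
  define lam where "lam = min (\<sigma>\<^sup>2 / 2) (1 / 2)"
  have lam: "0 < lam" "lam \<le> 1 / 2" "2 * lam \<le> \<sigma>\<^sup>2"
    using assms by (auto simp: lam_def)
  obtain n0 where n0: "n0 > 0"
     "\<And>n. n \<ge> n0 \<Longrightarrow> L - e * lam / 5 \<le> (\<Sum>i<n. norm (G (node n (Suc i)) - G (node n i)))"
    using uniform_chords[of "e * lam / 5"] assms lam by auto
  show thesis
  proof (rule that[OF n0(1)])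
    fix n assume n: "n \<ge> n0"
    then have "n > 0" using n0 by simp
    define d where "d = L / real n"
    have "d > 0" using L_pos \<open>n > 0\<close> by (simp add: d_def)
    define tau where "tau = (\<lambda>i. sgn (G (node n (Suc i)) - G (node n i)))"
    define f where "f = (\<lambda>i t. Re (G t * cnj (tau i)))"
    define ee where "ee = (\<lambda>i. d - norm (G (node n (Suc i)) - G (node n i)))"
    have tau_le: "norm (tau i) \<le> 1" for i by (simp add: tau_def norm_sgn)
    have cell: "{node n i..node n (Suc i)} \<subseteq> {0..L}" if "i < n" for i
      using that node_le_L[OF \<open>n > 0\<close>, of "Suc i"] by (auto intro: order_trans[OF node_nonneg])
    have fdiff: "f i t - f i s = Re ((G t - G s) * cnj (tau i))" for i s t
      by (simp add: f_def algebra_simps)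
    have "\<exists>F. F \<in> lmeasurable \<and> measure lebesgue F \<le> 5 * ee i / lam \<and>
        (\<forall>s\<in>{node n i..node n (Suc i)} - F. \<forall>t\<in>{node n i..node n (Suc i)}.
           (1 - lam) * (t - s)\<^sup>2 \<le> (t - s) * (f i t - f i s))" if i: "i < n" for i
    proof (rule steep_off_small_set[of "node n i" "node n (Suc i)" "f i" "ee i" lam])
      fix s t assume st: "s \<in> {node n i..node n (Suc i)}" "t \<in> {node n i..node n (Suc i)}"
      have "\<bar>f i s - f i t\<bar> \<le> norm ((G s - G t) * cnj (tau i))"
        unfolding fdiff by (rule abs_Re_le_cmod)
      also have "\<dots> \<le> norm (G s - G t) * 1"
        unfolding norm_mult using tau_le[of i] by (intro mult_left_mono) auto
      also have "\<dots> \<le> \<bar>s - t\<bar>" using lipschitz[OF subsetD[OF cell[OF i] st(1)] subsetD[OF cell[OF i] st(2)]] by simp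
      finally show "\<bar>f i s - f i t\<bar> \<le> \<bar>s - t\<bar>" .
    next
      show "node n (Suc i) - node n i - ee i \<le> f i (node n (Suc i)) - f i (node n i)"
      proof -
        define w where "w = G (node n (Suc i)) - G (node n i)"
        have "w * cnj (sgn w) = of_real (norm w)"
        proof (cases "w = 0")
          case False
          have "w * cnj (sgn w) = (w * cnj w) / of_real (norm w)"
            by (simp add: sgn_eq)
          also have "\<dots> = of_real (norm w)"
            using False by (simp add: complex_norm_square[symmetric] power2_eq_square)
          finally show ?thesis .
        qed simp
        then have "f i (node n (Suc i)) - f i (node n i) = norm w"
          unfolding fdiff tau_def w_def by simp
        then show ?thesis by (simp add: ee_def w_def node_Suc d_def)
      qed
    qed (use lam node_mono in auto)
    then obtain F where F: "\<And>i. i < n \<Longrightarrow> F i \<in> lmeasurable"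
        "\<And>i. i < n \<Longrightarrow> measure lebesgue (F i) \<le> 5 * ee i / lam"
        "\<And>i s t. i < n \<Longrightarrow> s \<in> {node n i..node n (Suc i)} - F i \<Longrightarrow> t \<in> {node n i..node n (Suc i)} \<Longrightarrow>
           (1 - lam) * (t - s)\<^sup>2 \<le> (t - s) * (f i t - f i s)"
      by metis
    show "\<exists>F\<in>lmeasurable. measure lebesgue F \<le> e \<and>
       (\<forall>i<n. \<forall>s\<in>{node n i..node n (Suc i)} - F. \<exists>\<tau>. norm \<tau> = 1 \<and>
          (\<forall>t\<in>{node n i..node n (Suc i)}. norm (G t - G s - of_real (t - s) * \<tau>) \<le> \<sigma> * \<bar>t - s\<bar>))"
    proof (intro bexI conjI allI impI ballI)
      have "measure lebesgue (\<Union>i<n. F i) \<le> (\<Sum>i<n. measure lebesgue (F i))"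
        by (rule measure_UNION_le) (use F in auto)
      also have "\<dots> \<le> (\<Sum>i<n. 5 / lam * ee i)"
        using F(2) by (intro sum_mono) auto
      also have "\<dots> = 5 / lam * (\<Sum>i<n. ee i)"
        by (rule sum_distrib_left[symmetric])
      also have "(\<Sum>i<n. ee i) = L - (\<Sum>i<n. norm (G (node n (Suc i)) - G (node n i)))"
        using \<open>n > 0\<close> by (simp add: ee_def sum_subtractf d_def)
      also have "5 / lam * (L - (\<Sum>i<n. norm (G (node n (Suc i)) - G (node n i)))) \<le> 5 / lam * (e * lam / 5)"
        using n0(2)[OF n] lam by (intro mult_left_mono) auto
      also have "\<dots> = e" using lam by simp
      finally show "measure lebesgue (\<Union>i<n. F i) \<le> e" .
      show "(\<Union>i<n. F i) \<in> lmeasurable" using F(1) by (intro fmeasurable.finite_UN) auto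
    next
      fix i s assume i: "i < n" and s: "s \<in> {node n i..node n (Suc i)} - (\<Union>i<n. F i)"
      have est: "(1 - lam) * (t - s)\<^sup>2 \<le> (t - s) * (f i t - f i s)" if "t \<in> {node n i..node n (Suc i)}" for t
        using F(3)[OF i _ that, of s] s i by auto
      have tau1: "norm (tau i) = 1"
      proof (rule ccontr)
        assume "norm (tau i) \<noteq> 1"
        then have "tau i = 0" by (auto simp: tau_def norm_sgn split: if_splits)
        then have f0: "f i t - f i s = 0" for t by (simp add: f_def)
        have le: "(1 - lam) * (t - s)\<^sup>2 \<le> 0" if "t \<in> {node n i..node n (Suc i)}" for t
          using est[OF that] f0[of t] by simp
        have "t = s" if "t \<in> {node n i..node n (Suc i)}" for t
          using le[OF that] lam by (simp add: mult_le_0_iff)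
        from this[of "node n i"] this[of "node n (Suc i)"] show False
          using \<open>n > 0\<close> L_pos by (simp add: node_Suc)
      qed
      show "\<exists>\<tau>. norm \<tau> = 1 \<and>
          (\<forall>t\<in>{node n i..node n (Suc i)}. norm (G t - G s - of_real (t - s) * \<tau>) \<le> \<sigma> * \<bar>t - s\<bar>)"
      proof (intro exI[of _ "tau i"] conjI tau1 ballI)
        fix t assume t: "t \<in> {node n i..node n (Suc i)}"
        define w x where "w = G t - G s" and "x = t - s"
        have w: "norm w \<le> \<bar>x\<bar>"
          using lipschitz[of t s] cell[OF i] t s unfolding w_def x_def by blast
        have "(norm (w - of_real x * tau i))\<^sup>2
            = (norm w)\<^sup>2 - 2 * x * Re (w * cnj (tau i)) + x\<^sup>2 * (norm (tau i))\<^sup>2"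
          unfolding cmod_power2 by (simp add: power2_eq_square algebra_simps)
        also have "\<dots> \<le> x\<^sup>2 - 2 * ((1 - lam) * x\<^sup>2) + x\<^sup>2"
        proof -
          have "(1 - lam) * x\<^sup>2 \<le> x * Re (w * cnj (tau i))"
            using est[OF t] unfolding x_def w_def fdiff .
          moreover have "(norm w)\<^sup>2 \<le> x\<^sup>2"
            using w power_mono[of "norm w" "\<bar>x\<bar>" 2] by simp
          ultimately show ?thesis using tau1 by simp
        qed
        also have "\<dots> = 2 * lam * x\<^sup>2" by (simp add: algebra_simps)
        also have "\<dots> \<le> \<sigma>\<^sup>2 * x\<^sup>2" using lam by (intro mult_right_mono) auto
        also have "\<dots> = (\<sigma> * \<bar>x\<bar>)\<^sup>2" by (simp add: power_mult_distrib)
        finally show "norm (G t - G s - of_real (t - s) * tau i) \<le> \<sigma> * \<bar>t - s\<bar>"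
          using assms by (auto simp: w_def x_def intro: power2_le_imp_le)
      qed
    qed
  qed
qed

text \<open>
  Inside the cell of \<open>s\<close> this is flatness. For \<open>t\<close> in the other cells, and \<open>s\<close> at a positive distance
  from the nodes, it follows from injectivity and compactness; staying away from the nodes also
  separates \<open>s\<close> from the two parameters \<open>0\<close> and \<open>L\<close> of the same point.
\<close>

lemma chord_arc_off_small_set:
  assumes "e > 0"
  obtains c F where "0 < c" "c \<le> 1" "F \<in> lmeasurable" "measure lebesgue F \<le> e"
    "\<And>s t. s \<in> {0..L} - F \<Longrightarrow> t \<in> {0..L} \<Longrightarrow> c * \<bar>t - s\<bar> \<le> norm (G t - G s)"
proof -
  obtain n where n: "n > 0" and "\<exists>F\<in>lmeasurable. measure lebesgue F \<le> e / 2 \<and>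
       (\<forall>i<n. \<forall>s\<in>{node n i..node n (Suc i)} - F. \<exists>\<tau>. norm \<tau> = 1 \<and>
          (\<forall>t\<in>{node n i..node n (Suc i)}. norm (G t - G s - of_real (t - s) * \<tau>) \<le> 1 / 2 * \<bar>t - s\<bar>))"
    using flat_cells[of "e / 2" "1 / 2"] assms by (metis half_gt_zero_iff less_numeral_extra(1) order_refl)
  then obtain F where F: "F \<in> lmeasurable" "measure lebesgue F \<le> e / 2"
     "\<And>i s. i < n \<Longrightarrow> s \<in> {node n i..node n (Suc i)} - F \<Longrightarrow> \<exists>\<tau>. norm \<tau> = 1 \<and>
          (\<forall>t\<in>{node n i..node n (Suc i)}. norm (G t - G s - of_real (t - s) * \<tau>) \<le> 1 / 2 * \<bar>t - s\<bar>)"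
    by blast
  define \<rho> where "\<rho> = e / (4 * real (n + 1))"
  have \<rho>: "\<rho> > 0" using assms by (simp add: \<rho>_def)
  define N where "N = (\<Union>i\<le>n. cball (node n i) \<rho>)"
  have N: "N \<in> lmeasurable" "measure lebesgue N \<le> e / 2"
  proof -
    show "N \<in> lmeasurable" unfolding N_def using \<rho> by (intro grid_neighbourhood_small) auto
    have "measure lebesgue N \<le> real (n + 1) * (2 * \<rho>)"
      unfolding N_def using \<rho> by (intro grid_neighbourhood_small) auto
    also have "\<dots> = e / 2" by (simp add: \<rho>_def field_simps)
    finally show "measure lebesgue N \<le> e / 2" .
  qed
  define Q where "Q = {p \<in> {0..L} \<times> {0..L}. \<rho> \<le> \<bar>snd p - fst p\<bar> \<and> \<rho> \<le> fst p \<and> fst p \<le> L - \<rho>}"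
  have "compact Q"
  proof -
    have "closed {p :: real \<times> real. \<rho> \<le> \<bar>snd p - fst p\<bar> \<and> \<rho> \<le> fst p \<and> fst p \<le> L - \<rho>}"
      by (intro closed_Collect_conj closed_Collect_le continuous_intros)
    then have "compact (({0..L} \<times> {0..L}) \<inter> {p :: real \<times> real. \<rho> \<le> \<bar>snd p - fst p\<bar> \<and> \<rho> \<le> fst p \<and> fst p \<le> L - \<rho>})"
      by (intro compact_Int_closed compact_Times) auto
    moreover have "({0..L} \<times> {0..L}) \<inter> {p :: real \<times> real. \<rho> \<le> \<bar>snd p - fst p\<bar> \<and> \<rho> \<le> fst p \<and> fst p \<le> L - \<rho>} = Q"
      by (auto simp: Q_def)
    ultimately show ?thesis by simp
  qed
  moreover have "continuous_on Q (\<lambda>p. G (snd p) - G (fst p))"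
    by (intro continuous_intros continuous_on_compose2[OF continuous]) (auto simp: Q_def)
  ultimately have "closed ((\<lambda>p. G (snd p) - G (fst p)) ` Q)"
    by (intro compact_imp_closed compact_continuous_image)
  moreover have "0 \<notin> (\<lambda>p. G (snd p) - G (fst p)) ` Q"
  proof clarify
    fix a b assume ab: "(a, b) \<in> Q" "0 = G (snd (a, b)) - G (fst (a, b))"
    then have "G b = G a" "a \<in> {0..L}" "b \<in> {0..L}" by (auto simp: Q_def)
    from injective[OF this(3,2,1)] show False
      using ab \<rho> by (auto simp: Q_def)
  qed
  ultimately obtain m where m: "m > 0" and m_le: "\<forall>w\<in>(\<lambda>p. G (snd p) - G (fst p)) ` Q. m \<le> dist 0 w"
    using separate_point_closed[of "(\<lambda>p. G (snd p) - G (fst p)) ` Q" 0] by blast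
  define c where "c = min (1 / 2) (m / L)"
  show thesis
  proof
    show "0 < c" "c \<le> 1" using m L_pos by (auto simp: c_def)
    show "F \<union> N \<in> lmeasurable" using F N by auto
    show "measure lebesgue (F \<union> N) \<le> e"
      using measure_Un_le[of F lebesgue N] F N by (auto simp: fmeasurableD)
  next
    fix s t assume s: "s \<in> {0..L} - (F \<union> N)" and t: "t \<in> {0..L}"
    have far: "\<rho> < \<bar>node n i - s\<bar>" if "i \<le> n" for i
      using s that by (auto simp: N_def dist_real_def not_le)
    have sL: "\<rho> < s" "s < L - \<rho>"
      using far[of 0] far[of n] s n by auto
    then obtain i where i: "i < n" "node n i \<le> s" "s < node n (Suc i)"
      using cell_of[OF n, of s] s \<rho> by auto
    show "c * \<bar>t - s\<bar> \<le> norm (G t - G s)"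
    proof (cases "t \<in> {node n i..node n (Suc i)}")
      case True
      obtain \<tau> where \<tau>: "norm \<tau> = 1" "norm (G t - G s - of_real (t - s) * \<tau>) \<le> 1 / 2 * \<bar>t - s\<bar>"
        using F(3)[OF i(1), of s] i s True by auto
      define v where "v = of_real (t - s) * \<tau>"
      have "norm v = \<bar>t - s\<bar>"
        unfolding v_def using \<tau> by (simp only: norm_mult norm_of_real mult_1_right)
      moreover have "norm (G t - G s - v) \<le> 1 / 2 * \<bar>t - s\<bar>"
        using \<tau>(2) by (simp only: v_def)
      moreover have "norm v \<le> norm (G t - G s) + norm (G t - G s - v)"
        by (metis norm_triangle_sub norm_minus_commute)
      moreover have "\<And>A B C x :: real. A = x \<Longrightarrow> B \<le> 1 / 2 * x \<Longrightarrow> A \<le> C + B \<Longrightarrow> 1 / 2 * x \<le> C"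
        by linarith
      ultimately have "1 / 2 * \<bar>t - s\<bar> \<le> norm (G t - G s)"
        by blast
      moreover have "c * \<bar>t - s\<bar> \<le> 1 / 2 * \<bar>t - s\<bar>"
        unfolding c_def by (intro mult_right_mono min.cobounded1) simp
      ultimately show ?thesis by (rule order_trans[rotated])
    next
      case False
      then have "\<rho> \<le> \<bar>t - s\<bar>"
        using far[of i] far[of "Suc i"] i by auto
      then have "(s, t) \<in> Q" using s t sL by (auto simp: Q_def)
      have "c * \<bar>t - s\<bar> \<le> m / L * L"
        using s t L_pos m by (intro mult_mono) (auto simp: c_def)
      also have "\<dots> = m" using L_pos by simp
      also have "\<dots> \<le> norm (G t - G s)" using m_le \<open>(s, t) \<in> Q\<close> by force
      finally show ?thesis .
    qed
  qed
qed

end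

section \<open>The jump of the logarithm across a Jordan curve\<close>

text \<open>
  A quarter turn of the right half-plane does not cross the cut of the logarithm.
\<close>

lemma Ln_rotate:
  assumes "Re w > 0" "r = 1 \<or> r = (-1::real)"
  shows "Ln (\<i> * of_real r * w) = Ln w + \<i> * of_real (r * pi / 2)"
proof (rule Ln_unique)
  have "w \<noteq> 0" using assms by auto
  have "exp (\<i> * of_real (r * pi / 2)) = \<i> * of_real r"
    using assms(2) by (auto simp: exp_Euler cos_of_real sin_of_real simp flip: of_real_divide)
  then show "exp (Ln w + \<i> * of_real (r * pi / 2)) = \<i> * of_real r * w"
    using \<open>w \<noteq> 0\<close> by (simp add: exp_add)
  have "\<bar>Im (Ln w)\<bar> < pi / 2" by (rule Re_Ln_pos_lt_imp[OF assms(1)])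
  then show "- pi < Im (Ln w + \<i> * of_real (r * pi / 2))" "Im (Ln w + \<i> * of_real (r * pi / 2)) \<le> pi"
    using assms(2) by auto
qed

lemma norm_Ln_minus_ln_le:
  assumes "x > 0" "norm (w - of_real x) \<le> \<sigma> * x" "\<sigma> \<le> 1 / 4"
  shows "norm (Ln w - of_real (ln x)) \<le> 2 * \<sigma>"
proof -
  define q where "q = (w - of_real x) / of_real x"
  have "norm q \<le> \<sigma>" using assms by (simp add: q_def norm_divide divide_le_eq)
  then have q: "norm q < 1 / 2" using assms(3) by linarith
  have w: "w = of_real x * (1 + q)" using assms(1) by (simp add: q_def field_simps)
  have "Ln w = of_real (ln x) + Ln (1 + q)"
    unfolding w using assms(1) q one_plus_notin_nonpos(2)[of q] by (subst Ln_times_of_real) (auto simp: Ln_of_real)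
  then show ?thesis using norm_Ln_le[OF q] \<open>norm q \<le> \<sigma>\<close> by simp
qed

lemma sum_inverse_square_distance:
  fixes n j m :: nat
  assumes "m > 0"
  shows "(\<Sum>k | k < n \<and> real m \<le> \<bar>real k - real j\<bar>. 1 / (real k - real j)\<^sup>2) \<le> 4 / real m"
proof -
  have tail: "(\<Sum>i=m..<p. 1 / (real i)\<^sup>2) \<le> 2 / real m - 2 / real p" if "p \<ge> m" for p
    using that
  proof (induction p rule: dec_induct)
    case (step p)
    have "p > 0" using step assms by simp
    have "1 / (real p)\<^sup>2 = 2 / (2 * (real p)\<^sup>2)" by simp
    also have "\<dots> \<le> 2 / (real p * (real p + 1))"
      using \<open>p > 0\<close> by (intro frac_le) (auto simp: power2_eq_square algebra_simps intro!: add_pos_pos mult_pos_pos)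
    also have "\<dots> = 2 / real p - 2 / real (Suc p)"
      using \<open>p > 0\<close> by (simp add: field_simps)
    finally have "1 / (real p)\<^sup>2 \<le> 2 / real p - 2 / real (Suc p)" .
    then show ?case using step by simp
  qed simp
  have tail': "(\<Sum>i=m..<p. 1 / (real i)\<^sup>2) \<le> 2 / real m" for p
  proof (cases "p \<ge> m")
    case True
    have "0 \<le> 2 / real p" by simp
    then show ?thesis using tail[OF True] by linarith
  qed simp
  define A where "A = {k. k < n \<and> real m \<le> \<bar>real k - real j\<bar>}"
  have A: "A \<subseteq> (\<lambda>i. j + i) ` {m..<n + m} \<union> (\<lambda>i. j - i) ` {m..<Suc j}"
  proof
    fix k assume "k \<in> A"
    then have k: "k < n" "real m \<le> \<bar>real k - real j\<bar>" by (auto simp: A_def)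
    show "k \<in> (\<lambda>i. j + i) ` {m..<n + m} \<union> (\<lambda>i. j - i) ` {m..<Suc j}"
    proof (cases "k \<ge> j")
      case True
      then have "m \<le> k - j" "k - j < n + m" using k by linarith+
      then show ?thesis using True by (intro UnI1 image_eqI[of _ _ "k - j"]) auto
    next
      case False
      then have "m \<le> j - k" using k by linarith
      then show ?thesis using False by (intro UnI2 image_eqI[of _ _ "j - k"]) auto
    qed
  qed
  have "(\<Sum>k\<in>A. 1 / (real k - real j)\<^sup>2)
      \<le> (\<Sum>k\<in>(\<lambda>i. j + i) ` {m..<n + m} \<union> (\<lambda>i. j - i) ` {m..<Suc j}. 1 / (real k - real j)\<^sup>2)"
    by (intro sum_mono2 A) auto
  also have "\<dots> \<le> (\<Sum>k\<in>(\<lambda>i. j + i) ` {m..<n + m}. 1 / (real k - real j)\<^sup>2)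
      + (\<Sum>k\<in>(\<lambda>i. j - i) ` {m..<Suc j}. 1 / (real k - real j)\<^sup>2)"
    by (subst sum.union_inter[symmetric]) (auto intro!: sum_nonneg)
  also have "(\<Sum>k\<in>(\<lambda>i. j + i) ` {m..<n + m}. 1 / (real k - real j)\<^sup>2) = (\<Sum>i=m..<n + m. 1 / (real i)\<^sup>2)"
    by (subst sum.reindex) (auto simp: inj_on_def)
  also have "(\<Sum>k\<in>(\<lambda>i. j - i) ` {m..<Suc j}. 1 / (real k - real j)\<^sup>2) = (\<Sum>i=m..<Suc j. 1 / (real i)\<^sup>2)"
    by (subst sum.reindex) (auto simp: inj_on_def of_nat_diff intro!: sum.cong)
  finally show ?thesis
    using tail'[of "n + m"] tail'[of "Suc j"] by (simp add: A_def)
qed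

text \<open>
  The Jordan curve theorem enters through the frontier of \<open>D\<close> and the values of the winding number:
  one sign inside, and zero or that sign everywhere off the curve.
\<close>

locale arclength_Jordan_curve = arclength_curve +
  fixes D :: "complex set" and orient :: real
  assumes D_open: "open D"
    and frontier_D: "frontier D = G ` {0..L}"
    and orient: "orient = 1 \<or> orient = -1"
    and total_D: "\<And>z. z \<in> D \<Longrightarrow> log_change G 0 L z = \<i> * of_real (2 * pi * orient)"
    and total: "\<And>z. z \<notin> G ` {0..L} \<Longrightarrow> log_change G 0 L z \<in> {0, \<i> * of_real (2 * pi * orient)}"
begin

lemma D_disjoint: "z \<in> D \<Longrightarrow> z \<notin> G ` {0..L}"
  using D_open frontier_D frontier_disjoint_eq[of D] by auto

lemma infdist_frontier_le: "t \<in> {0..L} \<Longrightarrow> infdist z (frontier D) \<le> norm (G t - z)"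
  unfolding frontier_D dist_norm[symmetric] dist_commute[of "G t"] by (intro infdist_le imageI)

lemma arc_separated:
  assumes "0 < s" "s < L" "0 \<le> p" "q \<le> L" "s < p \<or> q < s"
  shows "G s \<notin> G ` {p..q}"
proof
  assume "G s \<in> G ` {p..q}"
  then obtain t where t: "t \<in> {p..q}" "G s = G t" by auto
  then show False using injective[of s t] assms by auto
qed

lemma cont_sub: "0 \<le> p \<Longrightarrow> q \<le> L \<Longrightarrow> continuous_on {p..q} G"
  by (rule continuous_on_subset[OF continuous]) auto

lemma log_change_isCont:
  assumes "0 \<le> p" "p \<le> q" "q \<le> L" "z \<notin> G ` {p..q}"
  shows "isCont (log_change G p q) z"
proof -
  have cont: "continuous_on {p..q} G" using assms by (intro cont_sub)
  have "open (- G ` {p..q})"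
    using compact_imp_closed[OF compact_continuous_image[OF cont]] by auto
  moreover have "continuous_on (- G ` {p..q}) (log_change G p q)"
    using log_change_holomorphic[OF assms(2) cont] by (rule holomorphic_on_imp_continuous_on)
  ultimately show ?thesis
    using assms(4) by (auto simp: continuous_on_eq_continuous_at)
qed

lemma log_change_split3:
  assumes "0 \<le> u" "u \<le> v" "v \<le> L" "z \<notin> G ` {0..L}"
  shows "log_change G 0 L z = log_change G 0 u z + log_change G u v z + log_change G v L z"
proof -
  have "log_change G 0 L z = log_change G 0 u z + log_change G u L z"
    using assms by (intro log_change_add cont_sub) auto
  also have "log_change G u L z = log_change G u v z + log_change G v L z"
    using assms by (intro log_change_add cont_sub) auto
  finally show ?thesis by simp
qed

text \<open>
  Seen from \<open>G s\<close>, the arc over \<open>[u, v]\<close> stays close to uniform motion in the direction \<open>\<tau>\<close>; in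
  particular it lies in a narrow double cone.
\<close>

definition flat_at :: "real \<Rightarrow> complex \<Rightarrow> real \<Rightarrow> real \<Rightarrow> real \<Rightarrow> bool" where
  "flat_at \<sigma> \<tau> u s v \<longleftrightarrow> norm \<tau> = 1 \<and>
     (\<forall>t\<in>{u..v}. norm (G t - G s - of_real (t - s) * \<tau>) \<le> \<sigma> * \<bar>t - s\<bar>)"

lemma flat_at_rotated:
  assumes "flat_at \<sigma> \<tau> u s v" "t \<in> {u..v}"
  shows "norm ((G t - G s) * cnj \<tau> - of_real (t - s)) \<le> \<sigma> * \<bar>t - s\<bar>"
proof -
  have \<tau>: "\<tau> * cnj \<tau> = 1" "norm \<tau> = 1"
    using assms(1) by (auto simp: flat_at_def complex_norm_square[symmetric])
  have "(G t - G s) * cnj \<tau> - of_real (t - s) = (G t - G s) * cnj \<tau> - of_real (t - s) * (\<tau> * cnj \<tau>)"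
    using \<tau> by simp
  also have "\<dots> = (G t - G s - of_real (t - s) * \<tau>) * cnj \<tau>"
    by (simp only: left_diff_distrib mult.assoc)
  finally show ?thesis
    using assms \<tau>(2) by (simp add: flat_at_def norm_mult)
qed

lemma flat_at_Re:
  assumes "flat_at \<sigma> \<tau> u s v" "t \<in> {u..v}"
  shows "\<bar>Re ((G t - G s) * cnj \<tau>) - (t - s)\<bar> \<le> \<sigma> * \<bar>t - s\<bar>"
  using flat_at_rotated[OF assms] abs_Re_le_cmod[of "(G t - G s) * cnj \<tau> - of_real (t - s)"]
  by (simp only: minus_complex.simps Re_complex_of_real)

text \<open>
  Move a point \<open>Z\<close> from \<open>G s\<close> a small distance along the normal, to the left (\<open>r = 1\<close>) or to the right
  (\<open>r = -1\<close>). The rest of this half of the normal does not meet the flat arc, so the change along the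
  arc is given by a principal branch; in the limit its two values differ by \<open>2 \<pi> \<i>\<close>. The change along
  the rest of the curve is continuous at \<open>G s\<close>. Both totals lie in \<open>{0, 2 \<pi> \<i> orient}\<close>, and this
  leaves a single possibility.
\<close>

lemma complement_change:
  assumes "0 \<le> u" "u < s" "s < v" "v \<le> L" "\<sigma> < 1" and flat: "flat_at \<sigma> \<tau> u s v"
  defines "\<alpha> \<equiv> (G s - G u) * cnj \<tau>" and "\<beta> \<equiv> (G v - G s) * cnj \<tau>"
  shows "log_change G 0 u (G s) + log_change G v L (G s) = \<i> * of_real (pi * orient) + Ln \<alpha> - Ln \<beta>"
proof -
  have s: "0 < s" "s < L" using assms by auto
  have \<tau>: "\<tau> * cnj \<tau> = 1" "norm \<tau> = 1"
    using flat by (auto simp: flat_at_def complex_norm_square[symmetric])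
  have pos: "0 < (1 - \<sigma>) * x" if "x > 0" for x using that \<open>\<sigma> < 1\<close> by simp
  have Re\<alpha>: "Re \<alpha> > 0"
    using flat_at_Re[OF flat, of u] assms(2,3) pos[of "s - u"] by (simp add: \<alpha>_def algebra_simps)
  have Re\<beta>: "Re \<beta> > 0"
    using flat_at_Re[OF flat, of v] assms(2,3) pos[of "v - s"] by (simp add: \<beta>_def algebra_simps)
  define R where "R = log_change G 0 u (G s) + log_change G v L (G s)"
  have sep: "G s \<notin> G ` {0..u}" "G s \<notin> G ` {v..L}"
    using arc_separated[of s 0 u] arc_separated[of s v L] assms(1-4) by linarith+
  have key: "R + Ln \<beta> - Ln \<alpha> + \<i> * of_real (r * pi) \<in> {0, \<i> * of_real (2 * pi * orient)}"
    if r: "r = 1 \<or> r = (-1::real)" for r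
  proof -
    have r2: "r * r = 1" using r by auto
    define c where "c = \<i> * of_real r * cnj \<tau>"
    define Z where "Z = (\<lambda>y. G s + \<i> * of_real (r * y) * \<tau>)"
    have c0: "c \<noteq> 0" using r \<tau> by (auto simp: c_def)
    have Zc: "(G t - Z y) * c = \<i> * of_real r * ((G t - G s) * cnj \<tau>) + of_real y" for t y
    proof -
      have "(G t - Z y) * c = \<i> * of_real r * ((G t - G s) * cnj \<tau>)
          - (\<i> * \<i>) * of_real (r * r * y) * (\<tau> * cnj \<tau>)"
        by (simp add: Z_def c_def algebra_simps)
      then show ?thesis using \<tau> r2 by simp
    qed
    have ray: "(G t - Z y) * c \<notin> \<real>\<^sub>\<le>\<^sub>0" if "t \<in> {u..v}" "y > 0" for t y
    proof
      assume "(G t - Z y) * c \<in> \<real>\<^sub>\<le>\<^sub>0"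
      then have *: "Im ((G t - Z y) * c) = 0" "Re ((G t - Z y) * c) \<le> 0"
        by (auto simp: complex_nonpos_Reals_iff)
      from *(1) have "r * Re ((G t - G s) * cnj \<tau>) = 0" unfolding Zc by simp
      then have Re0: "Re ((G t - G s) * cnj \<tau>) = 0" using r by auto
      have "t = s"
      proof (rule ccontr)
        assume "t \<noteq> s"
        then have "0 < (1 - \<sigma>) * \<bar>t - s\<bar>" by (intro pos) simp
        moreover have "\<bar>t - s\<bar> \<le> \<sigma> * \<bar>t - s\<bar>"
          using flat_at_Re[OF flat that(1)] Re0 by (simp add: abs_minus_commute)
        ultimately show False by (simp add: left_diff_distrib)
      qed
      then show False using *(2) \<open>y > 0\<close> unfolding Zc by simp
    qed
    have Zlim: "(Z \<longlongrightarrow> G s) (at_right 0)"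
    proof -
      have "(Z \<longlongrightarrow> Z 0) (at_right 0)" unfolding Z_def by (intro tendsto_intros)
      then show ?thesis by (simp add: Z_def)
    qed
    have A: "((\<lambda>y. log_change G 0 u (Z y)) \<longlongrightarrow> log_change G 0 u (G s)) (at_right 0)"
      using assms sep by (intro isCont_tendsto_compose[OF _ Zlim] log_change_isCont) auto
    have B: "((\<lambda>y. log_change G v L (Z y)) \<longlongrightarrow> log_change G v L (G s)) (at_right 0)"
      using assms sep by (intro isCont_tendsto_compose[OF _ Zlim] log_change_isCont) auto
    have lim_end: "((\<lambda>y. Ln ((G t - Z y) * c)) \<longlongrightarrow> Ln (\<i> * of_real r * ((G t - G s) * cnj \<tau>))) (at_right 0)"
      if "Re ((G t - G s) * cnj \<tau>) \<noteq> 0" for t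
    proof (rule tendsto_Ln)
      show "\<i> * of_real r * ((G t - G s) * cnj \<tau>) \<notin> \<real>\<^sub>\<le>\<^sub>0"
        using that r by (auto simp: complex_nonpos_Reals_iff simp del: complex_cnj_diff)
      have "((\<lambda>y. (G t - Z y) * c) \<longlongrightarrow> (G t - G s) * c) (at_right 0)"
        by (intro tendsto_intros Zlim)
      then show "((\<lambda>y. (G t - Z y) * c) \<longlongrightarrow> \<i> * of_real r * ((G t - G s) * cnj \<tau>)) (at_right 0)"
        by (simp add: c_def mult_ac)
    qed
    have gu: "(G u - G s) * cnj \<tau> = - \<alpha>" by (simp add: \<alpha>_def algebra_simps)
    have M: "((\<lambda>y. Ln ((G v - Z y) * c) - Ln ((G u - Z y) * c)) \<longlongrightarrow>
        Ln (\<i> * of_real r * \<beta>) - Ln (\<i> * of_real r * (- \<alpha>))) (at_right 0)"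
      using lim_end[of v] lim_end[of u] Re\<alpha> Re\<beta> unfolding \<beta>_def[symmetric] gu
      by (intro tendsto_diff) auto
    have ev: "\<forall>\<^sub>F y in at_right 0. log_change G 0 u (Z y) + (Ln ((G v - Z y) * c) - Ln ((G u - Z y) * c))
        + log_change G v L (Z y) \<in> {0, \<i> * of_real (2 * pi * orient)}"
    proof -
      have op: "open (- (G ` {0..u} \<union> G ` {v..L}))"
        using assms by (intro open_Compl closed_Un compact_imp_closed compact_continuous_image cont_sub) auto
      have "\<forall>\<^sub>F y in at_right 0. Z y \<in> - (G ` {0..u} \<union> G ` {v..L})"
        by (rule topological_tendstoD[OF Zlim op]) (use sep in auto)
      moreover have "\<forall>\<^sub>F y in at_right (0::real). y > 0"
        by (rule eventually_at_right_less)
      ultimately show ?thesis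
      proof eventually_elim
        case (elim y)
        have "Z y \<notin> G ` {u..v}"
        proof
          assume "Z y \<in> G ` {u..v}"
          then obtain t where "t \<in> {u..v}" "G t = Z y" by auto
          then show False using ray[of t y] elim by simp
        qed
        moreover have "{0..L} = {0..u} \<union> {u..v} \<union> {v..L}"
          using assms(1-4) by auto
        ultimately have out: "Z y \<notin> G ` {0..L}"
          using elim(1) by (simp only: image_Un Un_iff Compl_iff) blast
        have "log_change G u v (Z y) = Ln ((G v - Z y) * c) - Ln ((G u - Z y) * c)"
          using assms ray elim c0 by (intro log_change_halfline cont_sub) auto
        then show ?case
          using log_change_split3[OF _ _ _ out, of u v] total[OF out] assms by simp
      qed
    qed
    have "log_change G 0 u (G s) + (Ln (\<i> * of_real r * \<beta>) - Ln (\<i> * of_real r * (- \<alpha>)))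
        + log_change G v L (G s) \<in> {0, \<i> * of_real (2 * pi * orient)}"
      by (rule Lim_in_closed_set[OF _ ev _ tendsto_add[OF tendsto_add[OF A M] B]]) auto
    moreover have "Ln (\<i> * of_real r * \<beta>) = Ln \<beta> + \<i> * of_real (r * pi / 2)"
      by (rule Ln_rotate[OF Re\<beta> r])
    moreover have "Ln (\<i> * of_real r * (- \<alpha>)) = Ln \<alpha> - \<i> * of_real (r * pi / 2)"
    proof -
      have "- r = 1 \<or> - r = -1" using r by auto
      from Ln_rotate[OF Re\<alpha> this] show ?thesis by simp
    qed
    ultimately have "log_change G 0 u (G s) + (Ln \<beta> + \<i> * of_real (r * pi / 2) - (Ln \<alpha> - \<i> * of_real (r * pi / 2)))
        + log_change G v L (G s) \<in> {0, \<i> * of_real (2 * pi * orient)}"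
      by (simp only:)
    moreover have "\<i> * of_real (r * pi / 2) + \<i> * of_real (r * pi / 2) = (\<i> * of_real (r * pi) :: complex)"
      by (simp add: field_simps)
    then have "log_change G 0 u (G s) + (Ln \<beta> + \<i> * of_real (r * pi / 2) - (Ln \<alpha> - \<i> * of_real (r * pi / 2)))
        + log_change G v L (G s) = R + Ln \<beta> - Ln \<alpha> + \<i> * of_real (r * pi)"
      by (simp add: R_def algebra_simps)
    ultimately show ?thesis by (simp only:)
  qed
  define X where "X = R + Ln \<beta> - Ln \<alpha>"
  have "X + \<i> * of_real (1 * pi) \<in> {0, \<i> * of_real (2 * pi * orient)}"
       "X + \<i> * of_real (- 1 * pi) \<in> {0, \<i> * of_real (2 * pi * orient)}"
    unfolding X_def by (intro key; simp)+
  then have "Re X = 0" "Im X = pi * orient"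
    using orient pi_gt_zero by (auto simp: complex_eq_iff)
  then have "X = \<i> * of_real (pi * orient)" by (simp add: complex_eq_iff)
  then have "R = \<i> * of_real (pi * orient) + Ln \<alpha> - Ln \<beta>"
    by (simp add: X_def algebra_simps)
  then show ?thesis by (simp add: R_def)
qed

end

section \<open>Kernels of the cells of a Jordan curve\<close>

text \<open>
  The coefficients \<open>cv k\<close> are samples of a function whose modulus of continuity is at most
  \<open>\<eta> + A x\<^sup>2\<close>. The weights decay quadratically with the distance \<open>\<bar>k - j\<bar>\<close>, which exactly
  compensates the growth of \<open>A x\<^sup>2\<close>: each of the \<open>n\<close> terms contributes \<open>O(A \<delta>\<^sup>2)\<close>, hence \<open>O(A L \<delta>)\<close>
  in total.
\<close>

lemma weighted_sum_bounds:
  fixes w cv :: "nat \<Rightarrow> complex"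
  assumes "j < n" "real n * \<delta> = L" "0 \<le> \<delta>" "0 \<le> Ks" "0 \<le> Kf" "0 \<le> A" "0 \<le> \<eta>"
    and wj: "norm (w j) \<le> Ks"
    and wk: "\<And>k. k < n \<Longrightarrow> k \<noteq> j \<Longrightarrow> norm (w k) \<le> Kf / (real k - real j)\<^sup>2"
  shows "(\<Sum>k<n. norm (w k)) \<le> Ks + 4 * Kf"
    and "(\<And>k. k < n \<Longrightarrow> norm (cv k - c0) \<le> \<eta> + A * ((\<bar>real k - real j\<bar> + 1) * \<delta>)\<^sup>2) \<Longrightarrow>
      norm ((\<Sum>k<n. cv k * w k) - c0 * (\<Sum>k<n. w k)) \<le> (\<eta> + 4 * A * L * \<delta>) * (Ks + 4 * Kf)"
proof -
  define B where "B = {k. k < n \<and> real 1 \<le> \<bar>real k - real j\<bar>}"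
  have B: "{..<n} = insert j B" "j \<notin> B" "finite B"
    using \<open>j < n\<close> by (auto simp: B_def)
  have Bk: "k < n" "k \<noteq> j" "1 \<le> \<bar>real k - real j\<bar>" if "k \<in> B" for k
    using that by (auto simp: B_def)
  have S: "(\<Sum>k\<in>B. 1 / (real k - real j)\<^sup>2) \<le> 4"
    unfolding B_def using sum_inverse_square_distance[where m = 1 and n = n and j = j] by simp
  have "(\<Sum>k<n. norm (w k)) = norm (w j) + (\<Sum>k\<in>B. norm (w k))"
    using B by simp
  also have "\<dots> \<le> Ks + (\<Sum>k\<in>B. Kf * (1 / (real k - real j)\<^sup>2))"
    using wj wk Bk by (intro add_mono sum_mono) auto
  also have "\<dots> = Ks + Kf * (\<Sum>k\<in>B. 1 / (real k - real j)\<^sup>2)"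
    by (simp only: sum_distrib_left)
  also have "\<dots> \<le> Ks + Kf * 4"
    using S \<open>0 \<le> Kf\<close> by (intro add_left_mono mult_left_mono)
  finally show "(\<Sum>k<n. norm (w k)) \<le> Ks + 4 * Kf" by simp
  assume cv: "\<And>k. k < n \<Longrightarrow> norm (cv k - c0) \<le> \<eta> + A * ((\<bar>real k - real j\<bar> + 1) * \<delta>)\<^sup>2"
  have "n > 0" using \<open>j < n\<close> by simp
  have L: "\<delta> \<le> L" "0 \<le> L"
  proof -
    have "1 * \<delta> \<le> real n * \<delta>" using \<open>n > 0\<close> \<open>0 \<le> \<delta>\<close> by (intro mult_right_mono) auto
    then show "\<delta> \<le> L" using assms(2) by simp
    then show "0 \<le> L" using \<open>0 \<le> \<delta>\<close> by simp
  qed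
  have "(\<Sum>k<n. cv k * w k) - c0 * (\<Sum>k<n. w k) = (\<Sum>k<n. (cv k - c0) * w k)"
    by (simp add: sum_distrib_left sum_subtractf left_diff_distrib)
  then have "norm ((\<Sum>k<n. cv k * w k) - c0 * (\<Sum>k<n. w k)) \<le> (\<Sum>k<n. norm ((cv k - c0) * w k))"
    by (simp only: norm_sum)
  also have "\<dots> = norm (cv j - c0) * norm (w j) + (\<Sum>k\<in>B. norm (cv k - c0) * norm (w k))"
    using B by (simp add: norm_mult)
  also have "norm (cv j - c0) * norm (w j) \<le> (\<eta> + A * \<delta>\<^sup>2) * Ks"
    using cv[OF \<open>j < n\<close>] wj \<open>0 \<le> A\<close> \<open>0 \<le> \<eta>\<close> by (intro mult_mono) auto
  also have "(\<Sum>k\<in>B. norm (cv k - c0) * norm (w k)) \<le> (\<Sum>k\<in>B. \<eta> * Kf * (1 / (real k - real j)\<^sup>2) + 4 * A * \<delta>\<^sup>2 * Kf)"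
  proof (intro sum_mono)
    fix k assume k: "k \<in> B"
    define x where "x = \<bar>real k - real j\<bar>"
    have x: "x \<ge> 1" "(real k - real j)\<^sup>2 = x\<^sup>2" using Bk[OF k] by (auto simp: x_def)
    have "norm (cv k - c0) * norm (w k) \<le> (\<eta> + A * ((x + 1) * \<delta>)\<^sup>2) * (Kf / x\<^sup>2)"
    proof (rule mult_mono)
      show "norm (cv k - c0) \<le> \<eta> + A * ((x + 1) * \<delta>)\<^sup>2"
        unfolding x_def by (rule cv[OF Bk(1)[OF k]])
      show "norm (w k) \<le> Kf / x\<^sup>2"
        using wk[OF Bk(1,2)[OF k]] by (simp only: x(2))
      show "0 \<le> \<eta> + A * ((x + 1) * \<delta>)\<^sup>2"
        using \<open>0 \<le> A\<close> \<open>0 \<le> \<eta>\<close> by simp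
    qed simp
    also have "\<dots> \<le> (\<eta> + A * ((2 * x) * \<delta>)\<^sup>2) * (Kf / x\<^sup>2)"
      using x \<open>0 \<le> A\<close> \<open>0 \<le> \<eta>\<close> \<open>0 \<le> \<delta>\<close> \<open>0 \<le> Kf\<close>
      by (intro mult_right_mono add_left_mono mult_left_mono power_mono) auto
    also have "\<dots> = \<eta> * Kf * (1 / (real k - real j)\<^sup>2) + 4 * A * \<delta>\<^sup>2 * Kf"
      using x by (simp add: field_simps power2_eq_square)
    finally show "norm (cv k - c0) * norm (w k) \<le> \<eta> * Kf * (1 / (real k - real j)\<^sup>2) + 4 * A * \<delta>\<^sup>2 * Kf" .
  qed
  also have "\<dots> = \<eta> * Kf * (\<Sum>k\<in>B. 1 / (real k - real j)\<^sup>2) + real (card B) * (4 * A * \<delta>\<^sup>2 * Kf)"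
    by (simp add: sum.distrib sum_distrib_left)
  also have "\<dots> \<le> \<eta> * Kf * 4 + real n * (4 * A * \<delta>\<^sup>2 * Kf)"
  proof -
    have "B \<subseteq> {..<n}" by (auto simp: B_def)
    then have "card B \<le> n" using card_mono[of "{..<n}" B] by simp
    then show ?thesis
      using S \<open>0 \<le> A\<close> \<open>0 \<le> \<eta>\<close> \<open>0 \<le> Kf\<close> by (intro add_mono mult_left_mono mult_right_mono) auto
  qed
  also have "real n * (4 * A * \<delta>\<^sup>2 * Kf) = 4 * A * L * \<delta> * Kf"
  proof -
    have "real n * (4 * A * \<delta>\<^sup>2 * Kf) = 4 * A * (real n * \<delta>) * \<delta> * Kf"
      by (simp add: power2_eq_square)
    then show ?thesis by (simp only: assms(2))
  qed
  also have "(\<eta> + A * \<delta>\<^sup>2) * Ks + (\<eta> * Kf * 4 + 4 * A * L * \<delta> * Kf) \<le> (\<eta> + 4 * A * L * \<delta>) * (Ks + 4 * Kf)"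
  proof -
    have "A * \<delta>\<^sup>2 * Ks \<le> A * (L * \<delta>) * Ks"
      unfolding power2_eq_square using L \<open>0 \<le> A\<close> \<open>0 \<le> \<delta>\<close> \<open>0 \<le> Ks\<close>
      by (intro mult_right_mono mult_left_mono) auto
    moreover have "0 \<le> A * (L * \<delta>) * Ks" "0 \<le> A * (L * \<delta>) * Kf"
      using L \<open>0 \<le> A\<close> \<open>0 \<le> \<delta>\<close> \<open>0 \<le> Ks\<close> \<open>0 \<le> Kf\<close> by auto
    ultimately show ?thesis by (simp add: algebra_simps)
  qed
  finally show "norm ((\<Sum>k<n. cv k * w k) - c0 * (\<Sum>k<n. w k)) \<le> (\<eta> + 4 * A * L * \<delta>) * (Ks + 4 * Kf)"
    by simp
qed

context arclength_Jordan_curve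
begin

lemma node_less_iff: "n > 0 \<Longrightarrow> node n a < node n b \<longleftrightarrow> a < b"
  using L_pos by (simp add: node_def divide_less_cancel)

definition kern :: "nat \<Rightarrow> nat \<Rightarrow> complex \<Rightarrow> complex" where
  "kern n k z = cell_kernel G (node n k) (node n (Suc k)) z"

text \<open>
  The boundary values from inside \<open>D\<close> of the kernels. In \<open>D\<close> the change along a cell is the total
  change minus the change along the rest of the curve, and the latter makes sense at the inner
  points of the cell too.
\<close>

definition boundary_kern :: "nat \<Rightarrow> nat \<Rightarrow> real \<Rightarrow> complex" where
  "boundary_kern n k s =
    (if node n k < s \<and> s < node n (Suc k)
     then \<i> * of_real (2 * pi * orient) - log_change G 0 (node n k) (G s)
            - log_change G (node n (Suc k)) L (G s)
            + (G (node n (Suc k)) - G (node n k)) / (G s - G (node n k))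
     else kern n k (G s))"

lemma cell_subset: "k < n \<Longrightarrow> {node n k..node n (Suc k)} \<subseteq> {0..L}"
  using node_le_L[of n "Suc k"] by (auto intro: order_trans[OF node_nonneg])

lemma cell_continuous: "k < n \<Longrightarrow> continuous_on {node n k..node n (Suc k)} G"
  by (rule continuous_on_subset[OF continuous cell_subset])

lemma kern_holomorphic:
  assumes "k < n"
  shows "kern n k holomorphic_on D"
  unfolding kern_def[abs_def]
proof (rule holomorphic_on_subset[OF cell_kernel_holomorphic])
  show "D \<subseteq> - G ` {node n k..node n (Suc k)}"
    using D_disjoint image_mono[OF cell_subset[OF assms], of G] by blast
qed (use assms in \<open>auto intro: node_mono cell_continuous\<close>)

lemma kern_tendsto:
  assumes "k < n" "0 < s" "s < L" "\<And>k. k \<le> n \<Longrightarrow> s \<noteq> node n k"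
  shows "(kern n k \<longlongrightarrow> boundary_kern n k s) (at (G s) within D)"
proof (cases "node n k < s \<and> s < node n (Suc k)")
  case True
  define u v where "u = node n k" and "v = node n (Suc k)"
  have uv: "0 \<le> u" "u < s" "s < v" "v \<le> L"
    using True assms(1) node_le_L[of n "Suc k"] by (auto simp: u_def v_def)
  have id: "((\<lambda>z. z) \<longlongrightarrow> G s) (at (G s) within D)" by (rule tendsto_ident_at)
  have sep: "G s \<notin> G ` {0..u}" "G s \<notin> G ` {v..L}"
    using arc_separated[of s 0 u] arc_separated[of s v L] assms(2,3) uv by linarith+
  have "G s \<noteq> G u" using injective[of s u] uv by auto
  have A: "(log_change G 0 u \<longlongrightarrow> log_change G 0 u (G s)) (at (G s) within D)"
    using isCont_tendsto_compose[OF log_change_isCont id, of 0 u] uv sep by auto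
  have B: "(log_change G v L \<longlongrightarrow> log_change G v L (G s)) (at (G s) within D)"
    using isCont_tendsto_compose[OF log_change_isCont id, of v L] uv sep by auto
  have "((\<lambda>z. \<i> * of_real (2 * pi * orient) - log_change G 0 u z - log_change G v L z
            + (G v - G u) / (z - G u)) \<longlongrightarrow> boundary_kern n k s) (at (G s) within D)"
    using True \<open>G s \<noteq> G u\<close> unfolding boundary_kern_def u_def[symmetric] v_def[symmetric]
    by (simp, intro tendsto_intros A B) auto
  moreover have "\<forall>\<^sub>F z in at (G s) within D. \<i> * of_real (2 * pi * orient) - log_change G 0 u z - log_change G v L z
            + (G v - G u) / (z - G u) = kern n k z"
    unfolding eventually_at_filter
  proof (intro always_eventually allI impI)
    fix z assume "z \<in> D"
    then show "\<i> * of_real (2 * pi * orient) - log_change G 0 u z - log_change G v L z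
            + (G v - G u) / (z - G u) = kern n k z"
      using log_change_split3[of u v z] total_D[of z] D_disjoint[of z] uv
      by (simp add: kern_def cell_kernel_def u_def v_def)
  qed
  ultimately show ?thesis by (rule Lim_transform_eventually)
next
  case False
  then have "s < node n k \<or> node n (Suc k) < s"
    using assms(1) assms(4)[of k] assms(4)[of "Suc k"] by auto
  then have sep: "G s \<notin> G ` {node n k..node n (Suc k)}"
    using arc_separated[of s "node n k" "node n (Suc k)"] assms node_le_L[of n "Suc k"] by auto
  have cont: "continuous_on {node n k..node n (Suc k)} G"
    by (rule cell_continuous[OF assms(1)])
  have "open (- G ` {node n k..node n (Suc k)})"
    using compact_imp_closed[OF compact_continuous_image[OF cont]] by auto
  moreover have "continuous_on (- G ` {node n k..node n (Suc k)}) (kern n k)"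
    unfolding kern_def[abs_def]
    by (intro holomorphic_on_imp_continuous_on cell_kernel_holomorphic cont node_mono) auto
  ultimately have "isCont (kern n k) (G s)"
    using sep by (auto simp: continuous_on_eq_continuous_at)
  then have "(kern n k \<longlongrightarrow> kern n k (G s)) (at (G s) within D)"
    using isCont_tendsto_compose[of "G s" "kern n k" "\<lambda>z. z"] tendsto_ident_at by blast
  then show ?thesis using False by (simp only: boundary_kern_def if_False)
qed

text \<open>
  The parameter \<open>s\<close> lies in the \<open>j\<close>-th of \<open>n\<close> cells, at a distance of at least \<open>\<kappa>\<close> times the length of
  a cell from its ends, where the kernels are singular.
\<close>

definition well_inside :: "real \<Rightarrow> nat \<Rightarrow> nat \<Rightarrow> real \<Rightarrow> bool" where
  "well_inside \<kappa> n j s \<longleftrightarrow> j < n \<and> node n j + \<kappa> * (L / real n) \<le> s \<and> s + \<kappa> * (L / real n) \<le> node n (Suc j)"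

lemma well_inside_strict:
  assumes "well_inside \<kappa> n j s" "\<kappa> > 0"
  shows "j < n" "node n j < s" "s < node n (Suc j)" "0 < s" "s < L"
proof -
  have n: "j < n" using assms by (simp add: well_inside_def)
  have "0 < \<kappa> * (L / real n)" using n L_pos assms by simp
  then show "j < n" "node n j < s" "s < node n (Suc j)" using assms n by (auto simp: well_inside_def)
  then show "0 < s" "s < L" using node_le_L[of n "Suc j"] node_nonneg[of n j] by linarith+
qed

lemma boundary_kern_outer:
  assumes "well_inside \<kappa> n j s" "\<kappa> > 0" "k \<noteq> j"
  shows "boundary_kern n k s = kern n k (G s)"
proof -
  note st = well_inside_strict[OF assms(1,2)]
  have "\<not> (node n k < s \<and> s < node n (Suc k))"
  proof
    assume "node n k < s \<and> s < node n (Suc k)"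
    then have "node n k < node n (Suc j)" "node n j < node n (Suc k)" using st by linarith+
    then show False using assms(3) st(1) by (simp add: node_less_iff)
  qed
  then show ?thesis by (simp only: boundary_kern_def if_False)
qed

lemma node_refine: "N > 0 \<Longrightarrow> node n b = node (n * N) (b * N)"
  by (simp add: node_def)

lemma nested_cells:
  assumes "N > 0" "well_inside \<kappa> n i s" "well_inside \<kappa> (n * N) j s" "\<kappa> > 0"
  shows "i * N \<le> j" "j < Suc i * N"
proof -
  note st = well_inside_strict[OF assms(2,4)] well_inside_strict[OF assms(3,4)]
  have pos: "n * N > 0" using assms(1) st(1) by simp
  have "node (n * N) (i * N) < node (n * N) (Suc j)" using st unfolding node_refine[OF assms(1), of n] by linarith
  then show "i * N \<le> j" by (simp add: node_less_iff[OF pos])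
  have "node (n * N) j < node (n * N) (Suc i * N)" using st unfolding node_refine[OF assms(1), of n] by linarith
  then show "j < Suc i * N" by (simp only: node_less_iff[OF pos])
qed

lemma well_inside_distance:
  assumes s: "well_inside \<kappa> n j s" and "0 < \<kappa>" "\<kappa> \<le> 1"
    and "k \<noteq> j" and t: "t \<in> {node n k..node n (Suc k)}"
  shows "\<kappa> * \<bar>real k - real j\<bar> * (L / real n) \<le> \<bar>t - s\<bar>"
proof -
  define \<delta> where "\<delta> = L / real n"
  have "\<delta> \<ge> 0" using L_pos by (simp add: \<delta>_def)
  have nd: "node n i = real i * \<delta>" for i by (simp add: node_def \<delta>_def)
  have s': "real j * \<delta> + \<kappa> * \<delta> \<le> s" "s + \<kappa> * \<delta> \<le> (real j + 1) * \<delta>"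
    using s by (auto simp: well_inside_def nd \<delta>_def[symmetric] algebra_simps)
  have t': "real k * \<delta> \<le> t" "t \<le> (real k + 1) * \<delta>"
    using t by (auto simp: nd algebra_simps)
  show ?thesis
  proof (cases "k > j")
    case True
    define x where "x = real k - real j - 1"
    have x: "x \<ge> 0" using True by (simp add: x_def)
    have "\<kappa> * (x + 1) * \<delta> = \<kappa> * (x * \<delta>) + \<kappa> * \<delta>" by (simp add: algebra_simps)
    also have "\<dots> \<le> 1 * (x * \<delta>) + \<kappa> * \<delta>"
      using x \<open>\<delta> \<ge> 0\<close> assms(3) by (intro add_right_mono mult_right_mono) auto
    also have "\<dots> \<le> t - s" using s'(2) t'(1) by (simp add: x_def algebra_simps)
    finally show ?thesis using True by (simp add: x_def \<delta>_def)
  next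
    case False
    define x where "x = real j - real k - 1"
    have x: "x \<ge> 0" using False assms(4) by (simp add: x_def)
    have "\<kappa> * (x + 1) * \<delta> = \<kappa> * (x * \<delta>) + \<kappa> * \<delta>" by (simp add: algebra_simps)
    also have "\<dots> \<le> 1 * (x * \<delta>) + \<kappa> * \<delta>"
      using x \<open>\<delta> \<ge> 0\<close> assms(3) by (intro add_right_mono mult_right_mono) auto
    also have "\<dots> \<le> s - t" using s'(1) t'(2) by (simp add: x_def algebra_simps)
    finally show ?thesis using False assms(4) by (simp add: x_def \<delta>_def)
  qed
qed

lemma norm_kern_le:
  assumes "k < n" "d > 0" "\<And>t. t \<in> {node n k..node n (Suc k)} \<Longrightarrow> d \<le> norm (G t - z)"
  shows "norm (kern n k z) \<le> 21 * (L / real n / d)\<^sup>2"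
proof -
  have "norm (kern n k z) \<le> 21 * ((node n (Suc k) - node n k) / d)\<^sup>2"
    unfolding kern_def
  proof (rule norm_cell_kernel_le)
    fix a b assume "a \<in> {node n k..node n (Suc k)}" "b \<in> {node n k..node n (Suc k)}"
    then show "norm (G a - G b) \<le> \<bar>a - b\<bar>"
      using cell_subset[OF \<open>k < n\<close>] by (intro lipschitz) blast+
  qed (use assms in \<open>auto intro!: node_mono\<close>)
  then show ?thesis by (simp add: node_Suc)
qed

text \<open>
  The assumption on \<open>z\<close> holds, with suitable constants, both for \<open>z = G s\<close> and for \<open>z\<close> in a nontangential
  approach region at \<open>G s\<close>.
\<close>

lemma norm_kern_far:
  assumes s: "well_inside \<kappa> n j s" and "0 < \<kappa>" "\<kappa> \<le> 1" "k < n" "k \<noteq> j" "0 < c"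
    and far: "\<And>t. t \<in> {0..L} \<Longrightarrow> c * \<bar>t - s\<bar> \<le> norm (G t - z)"
  shows "norm (kern n k z) \<le> 21 / (c * \<kappa>)\<^sup>2 / (real k - real j)\<^sup>2"
proof -
  define \<delta> where "\<delta> = L / real n"
  have "\<delta> > 0" using L_pos assms(4) by (simp add: \<delta>_def)
  define x where "x = \<bar>real k - real j\<bar>"
  have x: "x > 0" "(real k - real j)\<^sup>2 = x\<^sup>2" using \<open>k \<noteq> j\<close> by (auto simp: x_def)
  have "norm (kern n k z) \<le> 21 * (\<delta> / (c * (\<kappa> * x * \<delta>)))\<^sup>2"
    unfolding \<delta>_def
  proof (rule norm_kern_le[OF \<open>k < n\<close>], unfold \<delta>_def[symmetric])
    fix t assume t: "t \<in> {node n k..node n (Suc k)}"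
    have "c * (\<kappa> * x * \<delta>) \<le> c * \<bar>t - s\<bar>"
      using well_inside_distance[OF assms(1-3,5) t] \<open>0 < c\<close>
      by (intro mult_left_mono) (auto simp: x_def \<delta>_def)
    also have "\<dots> \<le> norm (G t - z)" using far t cell_subset[OF \<open>k < n\<close>] by blast
    finally show "c * (\<kappa> * x * \<delta>) \<le> norm (G t - z)" .
  qed (use assms x \<open>\<delta> > 0\<close> in simp)
  also have "21 * (\<delta> / (c * (\<kappa> * x * \<delta>)))\<^sup>2 = 21 / (c * \<kappa>)\<^sup>2 / (real k - real j)\<^sup>2"
    using \<open>\<delta> > 0\<close> x by (simp add: power_divide power_mult_distrib x(2)) 
  finally show ?thesis .
qed

lemma flat_at_subinterval: "flat_at \<sigma> \<tau> u s v \<Longrightarrow> u \<le> u' \<Longrightarrow> v' \<le> v \<Longrightarrow> flat_at \<sigma> \<tau> u' s v'"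
  by (auto simp: flat_at_def)

lemma flat_ends:
  assumes "u < s" "s < v" and flat: "flat_at \<sigma> \<tau> u s v"
  shows "norm ((G s - G u) * cnj \<tau> - of_real (s - u)) \<le> \<sigma> * (s - u)"
    and "norm ((G v - G s) * cnj \<tau> - of_real (v - s)) \<le> \<sigma> * (v - s)"
proof -
  have "(G s - G u) * cnj \<tau> - of_real (s - u) = - ((G u - G s) * cnj \<tau> - of_real (u - s))"
    by (simp add: algebra_simps)
  then show "norm ((G s - G u) * cnj \<tau> - of_real (s - u)) \<le> \<sigma> * (s - u)"
    using flat_at_rotated[OF flat, of u] assms(1,2) by (simp only: norm_minus_cancel) auto
  show "norm ((G v - G s) * cnj \<tau> - of_real (v - s)) \<le> \<sigma> * (v - s)"
    using flat_at_rotated[OF flat, of v] assms(1,2) by auto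
qed

text \<open>
  The boundary value from inside of the change along \<open>[u, v]\<close>: its imaginary part is nearly \<open>\<plusminus>\<pi>\<close>, as
  for a straight arc.
\<close>

lemma jump_near_real:
  assumes "0 \<le> u" "u < s" "s < v" "v \<le> L" "\<sigma> \<le> 1 / 4" and flat: "flat_at \<sigma> \<tau> u s v"
  defines "P \<equiv> \<i> * of_real (2 * pi * orient) - log_change G 0 u (G s) - log_change G v L (G s)"
  shows "norm (P - (\<i> * of_real (pi * orient) + of_real (ln (v - s) - ln (s - u)))) \<le> 4 * \<sigma>"
proof -
  define \<alpha> \<beta> where "\<alpha> = (G s - G u) * cnj \<tau>" and "\<beta> = (G v - G s) * cnj \<tau>"
  have P: "P = \<i> * of_real (pi * orient) - Ln \<alpha> + Ln \<beta>"
    using complement_change[OF assms(1-4) _ flat] assms(5)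
    by (simp add: P_def \<alpha>_def \<beta>_def algebra_simps) 
  have "norm (Ln \<alpha> - of_real (ln (s - u))) \<le> 2 * \<sigma>"
    unfolding \<alpha>_def using flat_ends(1)[OF assms(2,3) flat] assms by (intro norm_Ln_minus_ln_le) auto
  moreover have "norm (Ln \<beta> - of_real (ln (v - s))) \<le> 2 * \<sigma>"
    unfolding \<beta>_def using flat_ends(2)[OF assms(2,3) flat] assms by (intro norm_Ln_minus_ln_le) auto
  moreover have eq: "P - (\<i> * of_real (pi * orient) + of_real (ln (v - s) - ln (s - u)))
      = (Ln \<beta> - of_real (ln (v - s))) - (Ln \<alpha> - of_real (ln (s - u)))"
    by (simp add: P algebra_simps)
  ultimately show ?thesis
    using norm_triangle_ineq4[of "Ln \<beta> - of_real (ln (v - s))" "Ln \<alpha> - of_real (ln (s - u))"]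
    unfolding eq by linarith
qed

end

text \<open>
  Two vectors that nearly point in the real direction, with small relative errors, have a nearly
  real ratio.
\<close>

lemma ratio_near_real:
  fixes p q :: complex
  assumes "x \<noteq> 0" "norm (p - of_real x) \<le> \<sigma> * \<bar>x\<bar>" "norm (q - of_real y) \<le> \<sigma> * \<bar>y\<bar>" "\<sigma> \<le> 1 / 4"
  shows "norm (q / p - of_real (y / x)) \<le> 4 * \<sigma> * (\<bar>y\<bar> / \<bar>x\<bar>)"
proof -
  have "0 \<le> \<sigma> * \<bar>x\<bar>" using assms(2) norm_ge_zero order_trans by blast
  then have "\<sigma> \<ge> 0" using assms(1) by (simp add: zero_le_mult_iff)
  have "\<bar>x\<bar> \<le> norm p + norm (p - of_real x)"
    using norm_triangle_sub[of "of_real x" p] by (simp add: norm_minus_commute)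
  moreover have "\<sigma> * \<bar>x\<bar> \<le> 1 / 4 * \<bar>x\<bar>" using assms(4) by (intro mult_right_mono) auto
  ultimately have p: "\<bar>x\<bar> / 2 \<le> norm p" using assms(2) by simp
  then have "p \<noteq> 0" using assms(1) by auto
  have "q / p - of_real (y / x) = ((q - of_real y) * of_real x - of_real y * (p - of_real x)) / (p * of_real x)"
    using assms(1) \<open>p \<noteq> 0\<close> by (simp add: field_simps)
  then have "norm (q / p - of_real (y / x))
      = norm ((q - of_real y) * of_real x - of_real y * (p - of_real x)) / (norm p * \<bar>x\<bar>)"
    by (simp add: norm_divide norm_mult)
  also have "\<dots> \<le> (2 * \<sigma> * \<bar>x\<bar> * \<bar>y\<bar>) / (\<bar>x\<bar> / 2 * \<bar>x\<bar>)"
  proof (rule frac_le)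
    have "norm ((q - of_real y) * of_real x - of_real y * (p - of_real x))
        \<le> norm (q - of_real y) * \<bar>x\<bar> + \<bar>y\<bar> * norm (p - of_real x)"
      using norm_triangle_ineq4[of "(q - of_real y) * of_real x" "of_real y * (p - of_real x)"]
      by (simp add: norm_mult)
    also have "\<dots> \<le> \<sigma> * \<bar>y\<bar> * \<bar>x\<bar> + \<bar>y\<bar> * (\<sigma> * \<bar>x\<bar>)"
      using assms by (intro add_mono mult_right_mono mult_left_mono) auto
    finally show "norm ((q - of_real y) * of_real x - of_real y * (p - of_real x)) \<le> 2 * \<sigma> * \<bar>x\<bar> * \<bar>y\<bar>"
      by (simp add: algebra_simps)
    show "\<bar>x\<bar> / 2 * \<bar>x\<bar> \<le> norm p * \<bar>x\<bar>" using p by (intro mult_right_mono) auto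
    show "0 < \<bar>x\<bar> / 2 * \<bar>x\<bar>" using assms(1) by (intro mult_pos_pos) auto
  qed (use assms \<open>\<sigma> \<ge> 0\<close> in auto)
  also have "\<dots> = 4 * \<sigma> * (\<bar>y\<bar> / \<bar>x\<bar>)" using assms(1) by (simp add: field_simps)
  finally show ?thesis .
qed

lemma abs_ln_diff_le:
  fixes a b C :: real
  assumes "0 < a" "0 < b" "a \<le> C * b" "b \<le> C * a"
  shows "\<bar>ln a - ln b\<bar> \<le> C"
proof -
  have "ln (a / b) \<le> a / b - 1" using assms by (intro ln_le_minus_one) auto
  also have "a / b \<le> C" using assms by (simp add: divide_le_eq)
  finally have 1: "ln a - ln b \<le> C" using assms by (simp add: ln_div)
  have "ln (b / a) \<le> b / a - 1" using assms by (intro ln_le_minus_one) auto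
  also have "b / a \<le> C" using assms by (simp add: divide_le_eq)
  finally have 2: "ln b - ln a \<le> C" using assms by (simp add: ln_div)
  show ?thesis using 1 2 by linarith
qed

context arclength_Jordan_curve
begin

lemma log_change_refl:
  assumes "0 \<le> u" "u \<le> L" "z \<noteq> G u"
  shows "log_change G u u z = 0"
  using log_change_add[of u u u G z] assms cont_sub[of u u] by auto

lemma sum_log_change_nodes:
  assumes "p \<le> q" "q \<le> n" "n > 0" "z \<notin> G ` {node n p..node n q}"
  shows "(\<Sum>k=p..<q. log_change G (node n k) (node n (Suc k)) z) = log_change G (node n p) (node n q) z"
  using assms
proof (induction q rule: dec_induct)
  case base
  then show ?case using log_change_refl[of "node n p" z] node_le_L[of n p] by auto
next
  case (step q)
  have sub: "{node n p..node n q} \<subseteq> {node n p..node n (Suc q)}" using node_mono[of q "Suc q" n] by auto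
  have "z \<notin> G ` {node n p..node n q}" using step.prems(3) sub by blast
  then have "(\<Sum>k=p..<q. log_change G (node n k) (node n (Suc k)) z) = log_change G (node n p) (node n q) z"
    using step.prems by (intro step.IH) auto
  then have "(\<Sum>k=p..<Suc q. log_change G (node n k) (node n (Suc k)) z)
      = log_change G (node n p) (node n q) z + log_change G (node n q) (node n (Suc q)) z"
    using step.hyps by simp
  also have "\<dots> = log_change G (node n p) (node n (Suc q)) z"
    using step node_le_L[of n "Suc q"]
    by (intro log_change_add[symmetric] node_mono cont_sub) auto
  finally show ?case .
qed

text \<open>
  The limit, from inside \<open>D\<close>, of the change along \<open>[u, v]\<close> at the point \<open>G s\<close> of this arc.
\<close>

definition jump :: "real \<Rightarrow> real \<Rightarrow> real \<Rightarrow> complex" where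
  "jump u v s = \<i> * of_real (2 * pi * orient) - log_change G 0 u (G s) - log_change G v L (G s)"

lemma boundary_kern_inner:
  assumes "node n k < s" "s < node n (Suc k)"
  shows "boundary_kern n k s = jump (node n k) (node n (Suc k)) s
           + (G (node n (Suc k)) - G (node n k)) / (G s - G (node n k))"
  using assms by (simp add: boundary_kern_def jump_def)

lemma norm_jump_le:
  assumes s: "well_inside \<kappa> n j s" and \<kappa>: "0 < \<kappa>" "\<kappa> \<le> 1" and \<sigma>: "\<sigma> \<le> 1 / 4"
    and flat: "flat_at \<sigma> \<tau> (node n j) s (node n (Suc j))"
  shows "norm (jump (node n j) (node n (Suc j)) s) \<le> 5 + 1 / \<kappa>"
proof -
  define u v \<delta> where "u = node n j" and "v = node n (Suc j)" and "\<delta> = L / real n"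
  note st = well_inside_strict[OF s \<kappa>(1)]
  have uv: "0 \<le> u" "u < s" "s < v" "v \<le> L"
    using st node_le_L[of n "Suc j"] by (auto simp: u_def v_def)
  have d: "v = u + \<delta>" "\<delta> > 0" "\<kappa> * \<delta> \<le> s - u" "\<kappa> * \<delta> \<le> v - s"
    using s L_pos by (auto simp: u_def v_def \<delta>_def node_Suc well_inside_def)
  have "\<delta> \<le> (s - u) / \<kappa>" "\<delta> \<le> (v - s) / \<kappa>"
    using d \<kappa> by (simp_all add: pos_le_divide_eq mult.commute)
  then have "\<bar>ln (v - s) - ln (s - u)\<bar> \<le> 1 / \<kappa>"
    using uv d by (intro abs_ln_diff_le) auto
  moreover have "norm (\<i> * of_real (pi * orient) + of_real (ln (v - s) - ln (s - u)) :: complex)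
      \<le> norm (\<i> * of_real (pi * orient) :: complex) + \<bar>ln (v - s) - ln (s - u)\<bar>"
    by (rule order_trans[OF norm_triangle_ineq]) (simp del: of_real_diff)
  moreover have "norm (\<i> * of_real (pi * orient) :: complex) \<le> 4"
    using orient pi_less_4 by (auto simp: norm_mult)
  moreover have "norm (jump u v s - (\<i> * of_real (pi * orient) + of_real (ln (v - s) - ln (s - u)))) \<le> 4 * \<sigma>"
    unfolding jump_def using uv \<sigma> flat by (intro jump_near_real) (auto simp: u_def v_def)
  moreover have "norm (jump u v s) \<le> norm (jump u v s - (\<i> * of_real (pi * orient) + of_real (ln (v - s) - ln (s - u))))
      + norm (\<i> * of_real (pi * orient) + of_real (ln (v - s) - ln (s - u)) :: complex)"
    by (metis norm_triangle_sub add.commute)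
  ultimately show ?thesis using \<sigma> unfolding u_def v_def by linarith
qed

lemma norm_boundary_kern_self_le:
  assumes s: "well_inside \<kappa> n j s" and \<kappa>: "0 < \<kappa>" "\<kappa> \<le> 1" and \<sigma>: "\<sigma> \<le> 1 / 4"
    and flat: "flat_at \<sigma> \<tau> (node n j) s (node n (Suc j))"
  shows "norm (boundary_kern n j s) \<le> 5 + 3 / \<kappa>"
proof -
  define u v \<delta> where "u = node n j" and "v = node n (Suc j)" and "\<delta> = L / real n"
  note st = well_inside_strict[OF s \<kappa>(1)]
  have uv: "0 \<le> u" "u < s" "s < v" "v \<le> L"
    using st node_le_L[of n "Suc j"] by (auto simp: u_def v_def)
  have d: "v = u + \<delta>" "\<delta> > 0" "\<kappa> * \<delta> \<le> s - u"
    using s L_pos by (auto simp: u_def v_def \<delta>_def node_Suc well_inside_def)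
  have nb: "norm (G v - G u) \<le> \<delta>" using lipschitz[of v u] uv d by auto
  have na: "\<kappa> * \<delta> / 2 \<le> norm (G s - G u)"
  proof -
    have \<tau>: "norm \<tau> = 1" using flat by (simp add: flat_at_def)
    define w where "w = (G s - G u) * cnj \<tau>"
    define x where "x = s - u"
    have "norm (of_real x :: complex) \<le> norm w + norm (w - of_real x)"
      by (metis norm_triangle_sub norm_minus_commute)
    moreover have "norm (w - of_real x) \<le> \<sigma> * x"
      using flat_ends(1)[of u s v] uv flat by (auto simp: u_def v_def w_def x_def)
    moreover have "\<sigma> * x \<le> 1 / 4 * x" using \<sigma> uv by (intro mult_right_mono) (auto simp: x_def)
    moreover have "norm w = norm (G s - G u)" using \<tau> by (simp add: w_def norm_mult)
    moreover have "norm (of_real x :: complex) = x" using uv by (simp add: x_def del: of_real_diff)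
    moreover have "\<kappa> * \<delta> \<le> x" "0 < x" using d uv by (auto simp: x_def)
    ultimately show ?thesis by linarith
  qed
  have "norm ((G v - G u) / (G s - G u)) \<le> \<delta> / (\<kappa> * \<delta> / 2)"
    unfolding norm_divide using nb na d \<kappa> by (intro frac_le) auto
  also have "\<dots> = 2 / \<kappa>" using d \<kappa> by simp
  finally have "norm ((G v - G u) / (G s - G u)) \<le> 2 / \<kappa>" .
  moreover have "norm (jump u v s) \<le> 5 + 1 / \<kappa>"
    unfolding u_def v_def by (rule norm_jump_le[OF assms])
  moreover have "boundary_kern n j s = jump u v s + (G v - G u) / (G s - G u)"
    unfolding u_def v_def by (rule boundary_kern_inner[OF st(2,3)])
  ultimately have "norm (boundary_kern n j s) \<le> (5 + 1 / \<kappa>) + 2 / \<kappa>"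
    using norm_triangle_ineq[of "jump u v s" "(G v - G u) / (G s - G u)"] by simp
  then show ?thesis by simp
qed

text \<open>
  Both \<open>dist z (G s)\<close> and the distance of \<open>G t\<close> from \<open>G s\<close> are controlled by that of \<open>G t\<close> from \<open>z\<close>, as
  \<open>infdist z (frontier D)\<close> is at most the latter.
\<close>

lemma nontangential_distance:
  assumes "0 < c" "0 \<le> M" "s \<in> {0..L}" "t \<in> {0..L}" "c * \<bar>t - s\<bar> \<le> norm (G t - G s)"
    and nt: "dist z (G s) \<le> M * infdist z (frontier D)"
  shows "c / (1 + M) * \<bar>t - s\<bar> \<le> norm (G t - z)"
proof -
  have "M * infdist z (frontier D) \<le> M * norm (G t - z)"
    using assms(2) infdist_frontier_le[OF assms(4)] by (intro mult_left_mono)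
  moreover have "norm (G t - G s) \<le> norm (G t - z) + dist z (G s)"
    using norm_triangle_ineq[of "G t - z" "z - G s"] by (simp add: dist_norm)
  ultimately have "c * \<bar>t - s\<bar> \<le> (1 + M) * norm (G t - z)"
    using assms(5) nt by (simp add: algebra_simps)
  then show ?thesis using assms(2) by (simp add: field_simps)
qed

text \<open>
  For \<open>z\<close> near \<open>G s\<close>, compared with the length of the cell, the change along the rest of the curve is
  close to its value at \<open>G s\<close>. Otherwise the nontangential condition keeps \<open>z\<close> at a distance from the
  curve that is comparable with the length of the cell.
\<close>

lemma norm_kern_self_le:
  assumes s: "well_inside \<kappa> n j s" and \<kappa>: "0 < \<kappa>" "\<kappa> \<le> 1" and \<sigma>: "\<sigma> \<le> 1 / 4"
    and flat: "flat_at \<sigma> \<tau> (node n j) s (node n (Suc j))"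
    and c: "0 < c" "\<And>t. t \<in> {0..L} \<Longrightarrow> c * \<bar>t - s\<bar> \<le> norm (G t - G s)"
    and M: "0 < M" and z: "z \<in> D" and nt: "dist z (G s) \<le> M * infdist z (frontier D)"
  shows "norm (kern n j z) \<le> 9 + 1 / \<kappa> + 2 / (c * \<kappa>) + 21 * (2 * M / (c * \<kappa>))\<^sup>2"
proof -
  define u v \<delta> where "u = node n j" and "v = node n (Suc j)" and "\<delta> = L / real n"
  note st = well_inside_strict[OF s \<kappa>(1)]
  have uv: "0 \<le> u" "u < s" "s < v" "v \<le> L"
    using st node_le_L[of n "Suc j"] by (auto simp: u_def v_def)
  have d: "v = u + \<delta>" "\<delta> > 0" "\<kappa> * \<delta> \<le> s - u" "\<kappa> * \<delta> \<le> v - s"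
    using s L_pos by (auto simp: u_def v_def \<delta>_def node_Suc well_inside_def)
  define r where "r = c * (\<kappa> * \<delta>) / 2"
  have r: "r > 0" using c d \<kappa> by (simp add: r_def)
  show ?thesis
  proof (cases "dist z (G s) < r")
    case True
    have far: "2 * r \<le> norm (G t - G s)" if "t \<in> {0..L}" "t \<le> u \<or> v \<le> t" for t
    proof -
      have "\<kappa> * \<delta> \<le> \<bar>t - s\<bar>" using that d by auto
      then have "c * (\<kappa> * \<delta>) \<le> c * \<bar>t - s\<bar>" using c by (intro mult_left_mono) auto
      then show ?thesis using c(2)[OF that(1)] by (simp add: r_def)
    qed
    have Lnle: "norm (Ln (1 + (G s - z) / (G t - G s))) \<le> 1" if "t \<in> {0..L}" "t \<le> u \<or> v \<le> t" for t
    proof -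
      have "norm ((G s - z) / (G t - G s)) < 1 / 2"
        using far[OF that] True r by (simp add: norm_divide dist_norm norm_minus_commute divide_less_eq)
      from norm_Ln_le[OF this] this show ?thesis by linarith
    qed
    have close: "norm (z - G s) < norm (G t - G s)" if "t \<in> {0..L}" "t \<le> u \<or> v \<le> t" for t
      using far[OF that] True r by (simp add: dist_norm)
    have A: "log_change G 0 u z = log_change G 0 u (G s) + Ln (1 + (G s - z) / (G u - G s))
        - Ln (1 + (G s - z) / (G 0 - G s))"
      using uv close by (intro log_change_perturb cont_sub) auto
    have B: "log_change G v L z = log_change G v L (G s) + Ln (1 + (G s - z) / (G L - G s))
        - Ln (1 + (G s - z) / (G v - G s))"
      using uv close by (intro log_change_perturb cont_sub) auto
    define E where "E = Ln (1 + (G s - z) / (G 0 - G s)) - Ln (1 + (G s - z) / (G u - G s))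
         + (Ln (1 + (G s - z) / (G v - G s)) - Ln (1 + (G s - z) / (G L - G s)))"
    have "kern n j z = jump u v s + E + (G v - G u) / (z - G u)"
      using log_change_split3[of u v z] total_D[OF z] D_disjoint[OF z] uv A B
      by (simp add: kern_def cell_kernel_def u_def[symmetric] v_def[symmetric] jump_def E_def algebra_simps)
    moreover have "norm (jump u v s) \<le> 5 + 1 / \<kappa>"
      unfolding u_def v_def by (rule norm_jump_le[OF s \<kappa> \<sigma> flat])
    moreover have "norm E \<le> (1 + 1) + (1 + 1)"
      unfolding E_def
      by (rule order_trans[OF norm_triangle_ineq add_mono];
          rule order_trans[OF norm_triangle_ineq4 add_mono]; rule Lnle) (use uv in auto)
    moreover have "norm ((G v - G u) / (z - G u)) \<le> \<delta> / r"
      unfolding norm_divide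
    proof (rule frac_le)
      show "norm (G v - G u) \<le> \<delta>" using lipschitz[of v u] uv d by auto
      have "norm (G u - G s) \<le> norm (z - G u) + norm (z - G s)"
        using norm_triangle_ineq4[of "z - G s" "z - G u"] by (simp add: add.commute)
      then show "r \<le> norm (z - G u)" using far[of u] True uv by (simp add: dist_norm)
    qed (use d r in auto)
    moreover have "\<delta> / r = 2 / (c * \<kappa>)" using d by (simp add: r_def)
    ultimately have "norm (kern n j z) \<le> (5 + 1 / \<kappa>) + 4 + 2 / (c * \<kappa>)"
      using norm_triangle_ineq[of "jump u v s + E" "(G v - G u) / (z - G u)"]
        norm_triangle_ineq[of "jump u v s" E] by simp
    moreover have "0 \<le> 21 * (2 * M / (c * \<kappa>))\<^sup>2" by simp
    ultimately show ?thesis by linarith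
  next
    case False
    have "norm (kern n j z) \<le> 21 * (\<delta> / (r / M))\<^sup>2"
      unfolding \<delta>_def
    proof (rule norm_kern_le[OF st(1)])
      fix t assume "t \<in> {node n j..node n (Suc j)}"
      then have "infdist z (frontier D) \<le> norm (G t - z)"
        using cell_subset[OF st(1)] infdist_frontier_le by blast
      moreover have "r / M \<le> infdist z (frontier D)"
        using False nt M by (simp add: divide_le_eq mult.commute)
      ultimately show "r / M \<le> norm (G t - z)" by linarith
    qed (use r M in simp)
    also have "\<delta> / (r / M) = 2 * M / (c * \<kappa>)" using d by (simp add: r_def)
    finally have "norm (kern n j z) \<le> 21 * (2 * M / (c * \<kappa>))\<^sup>2" .
    moreover have "0 \<le> 1 / \<kappa>" "0 \<le> 2 / (c * \<kappa>)" using \<kappa> c by auto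
    ultimately show ?thesis by linarith
  qed
qed

text \<open>
  The cells are obtained by dividing each of \<open>n1\<close> larger cells into \<open>N\<close> parts, and flatness is known
  on the larger cell \<open>J\<close> that contains \<open>s\<close>. The changes along the cells of \<open>J\<close> add up to the jump
  across \<open>J\<close>. The point masses at the nodes of \<open>J\<close> are nearly real there, with an error \<open>O(\<sigma> / \<kappa>)\<close>
  each; this gives the term with the factor \<open>N\<close>. The kernels of the cells outside \<open>J\<close> are
  estimated by their quadratic decay. For a given precision one first takes \<open>m\<close> and \<open>N\<close> large and
  then \<open>\<sigma>\<close> small.
\<close>

lemma boundary_sum:
  assumes n: "N > 0" "n1 > 0" "n = n1 * N"
    and i: "well_inside \<kappa> n1 i s" and j: "well_inside \<kappa> n j s" and \<kappa>: "0 < \<kappa>" "\<kappa> \<le> 1"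
    and \<sigma>: "0 \<le> \<sigma>" "\<sigma> \<le> 1 / 4" and flat: "flat_at \<sigma> \<tau> (node n1 i) s (node n1 (Suc i))"
    and c: "0 < c" "\<And>t. t \<in> {0..L} \<Longrightarrow> c * \<bar>t - s\<bar> \<le> norm (G t - G s)"
    and m: "0 < m" "real m \<le> \<kappa> * real N"
  shows "\<bar>Im (\<Sum>k<n. boundary_kern n k s) - pi * orient\<bar> \<le> 4 * \<sigma> + 8 * real N * \<sigma> / \<kappa> + 84 / (c * \<kappa>)\<^sup>2 / real m"
proof -
  have n0: "n > 0" using n by simp
  define u v \<delta> \<zeta> where "u = node n1 i" and "v = node n1 (Suc i)" and "\<delta> = L / real n" and "\<zeta> = G s"
  have \<delta>: "\<delta> > 0" using L_pos n0 by (simp add: \<delta>_def)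
  have big: "node n1 a = node n (a * N)" for a unfolding n(3) by (rule node_refine[OF n(1)])
  have uv_node: "u = node n (i * N)" "v = node n (Suc i * N)" by (simp_all only: u_def v_def big)
  have nd: "node n a = real a * \<delta>" for a by (simp add: node_def \<delta>_def)
  note sti = well_inside_strict[OF i \<kappa>(1)] and stj = well_inside_strict[OF j \<kappa>(1)]
  have uv: "0 \<le> u" "u < s" "s < v" "v \<le> L"
    using sti node_le_L[of n1 "Suc i"] n by (auto simp: u_def v_def)
  have sc: "0 < s" "s < L" using uv by auto
  have iN: "i * N \<le> j" "j < Suc i * N"
    using nested_cells[OF n(1) i _ \<kappa>(1)] j unfolding n(3) by blast+
  have Sn: "Suc i * N \<le> n" using sti(1) n by (metis Suc_leI mult_le_mono1)
  define J where "J = {i * N..<Suc i * N}"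
  have J: "J \<subseteq> {..<n}" "card J = N" "j \<in> J" "finite J"
    using Sn iN by (auto simp: J_def)
  define q where "q = (\<lambda>k. (G (node n (Suc k)) - G (node n k)) / (\<zeta> - G (node n k)))"
  define l where "l = (\<lambda>a b. log_change G a b \<zeta>)"
  have sep: "\<zeta> \<notin> G ` {a..b}" if "0 \<le> a" "b \<le> L" "s < a \<or> b < s" for a b
    unfolding \<zeta>_def using arc_separated[OF sc that] .
  have left: "(\<Sum>k=i * N..<j. l (node n k) (node n (Suc k))) = l u (node n j)"
    unfolding l_def uv_node using iN Sn n0 stj node_le_L[of n j]
    by (intro sum_log_change_nodes sep) auto
  have right: "(\<Sum>k=Suc j..<Suc i * N. l (node n k) (node n (Suc k))) = l (node n (Suc j)) v"
    unfolding l_def uv_node using iN Sn n0 stj node_le_L[of n "Suc i * N"]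
    by (intro sum_log_change_nodes sep) auto
  have outer_left: "l 0 (node n j) = l 0 u + l u (node n j)"
    unfolding l_def using uv iN stj node_mono[OF iN(1), of n] uv_node sc
    by (intro log_change_add cont_sub sep) auto
  have outer_right: "l (node n (Suc j)) L = l (node n (Suc j)) v + l v L"
    unfolding l_def using uv iN stj node_mono[of "Suc j" "Suc i * N" n] uv_node sc
    by (intro log_change_add cont_sub sep) auto
  have kb: "boundary_kern n k s = l (node n k) (node n (Suc k)) + q k" if "k < n" "k \<noteq> j" for k
    using boundary_kern_outer[OF j \<kappa>(1) that(2)] by (simp only: kern_def cell_kernel_def l_def q_def \<zeta>_def)
  have kbj: "boundary_kern n j s = jump (node n j) (node n (Suc j)) s + q j"
    unfolding q_def \<zeta>_def by (rule boundary_kern_inner[OF stj(2,3)])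
  have "(\<Sum>k\<in>J. boundary_kern n k s) = jump u v s + (\<Sum>k\<in>J. q k)"
  proof -
    have Jsplit: "J = insert j ({i * N..<j} \<union> {Suc j..<Suc i * N})" using iN by (auto simp: J_def)
    have kJ: "k < n" "k \<noteq> j" if "k \<in> {i * N..<j} \<union> {Suc j..<Suc i * N}" for k
      using that iN Sn by auto
    have "(\<Sum>k\<in>J. boundary_kern n k s) = boundary_kern n j s + (\<Sum>k\<in>{i * N..<j} \<union> {Suc j..<Suc i * N}. boundary_kern n k s)"
      unfolding Jsplit by (rule sum.insert) auto
    also have "(\<Sum>k\<in>{i * N..<j} \<union> {Suc j..<Suc i * N}. boundary_kern n k s)
        = (\<Sum>k\<in>{i * N..<j} \<union> {Suc j..<Suc i * N}. l (node n k) (node n (Suc k)) + q k)"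
      by (intro sum.cong refl kb kJ)
    also have "\<dots> = (\<Sum>k\<in>{i * N..<j} \<union> {Suc j..<Suc i * N}. l (node n k) (node n (Suc k)))
        + (\<Sum>k\<in>{i * N..<j} \<union> {Suc j..<Suc i * N}. q k)"
      by (rule sum.distrib)
    also have "(\<Sum>k\<in>{i * N..<j} \<union> {Suc j..<Suc i * N}. l (node n k) (node n (Suc k)))
        = l u (node n j) + l (node n (Suc j)) v"
    proof -
      have "(\<Sum>k\<in>{i * N..<j} \<union> {Suc j..<Suc i * N}. l (node n k) (node n (Suc k)))
          = (\<Sum>k=i * N..<j. l (node n k) (node n (Suc k))) + (\<Sum>k=Suc j..<Suc i * N. l (node n k) (node n (Suc k)))"
        by (rule sum.union_disjoint) auto
      then show ?thesis by (simp only: left right)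
    qed
    also have "boundary_kern n j s + (l u (node n j) + l (node n (Suc j)) v
          + (\<Sum>k\<in>{i * N..<j} \<union> {Suc j..<Suc i * N}. q k))
        = jump u v s + (q j + (\<Sum>k\<in>{i * N..<j} \<union> {Suc j..<Suc i * N}. q k))"
      using outer_left outer_right unfolding kbj jump_def l_def \<zeta>_def by (simp add: algebra_simps)
    also have "q j + (\<Sum>k\<in>{i * N..<j} \<union> {Suc j..<Suc i * N}. q k) = (\<Sum>k\<in>J. q k)"
      unfolding Jsplit by (rule sum.insert[symmetric]) auto
    finally show ?thesis .
  qed
  moreover have "(\<Sum>k<n. boundary_kern n k s) = (\<Sum>k\<in>J. boundary_kern n k s) + (\<Sum>k\<in>{..<n} - J. boundary_kern n k s)"
    using sum.subset_diff[OF J(1), of "\<lambda>k. boundary_kern n k s"] by (simp add: add.commute)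
  ultimately have total: "Im (\<Sum>k<n. boundary_kern n k s)
      = Im (jump u v s) + (\<Sum>k\<in>J. Im (q k)) + Im (\<Sum>k\<in>{..<n} - J. boundary_kern n k s)"
    by (simp add: Im_sum)
  have P: "\<bar>Im (jump u v s) - pi * orient\<bar> \<le> 4 * \<sigma>"
  proof -
    have "norm (jump u v s - (\<i> * of_real (pi * orient) + of_real (ln (v - s) - ln (s - u)))) \<le> 4 * \<sigma>"
      unfolding jump_def using uv \<sigma> flat by (intro jump_near_real) (auto simp: u_def v_def)
    moreover have "Im (jump u v s - (\<i> * of_real (pi * orient) + of_real (ln (v - s) - ln (s - u))))
        = Im (jump u v s) - pi * orient" by simp
    ultimately show ?thesis
      using abs_Im_le_cmod[of "jump u v s - (\<i> * of_real (pi * orient) + of_real (ln (v - s) - ln (s - u)))"]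
      by linarith
  qed
  have Q: "\<bar>Im (q k)\<bar> \<le> 8 * \<sigma> / \<kappa>" if k: "k \<in> J" for k
  proof -
    have \<tau>: "norm \<tau> = 1" "cnj \<tau> \<noteq> 0" using flat by (auto simp: flat_at_def)
    define p where "p = (\<lambda>a. (G (node n a) - \<zeta>) * cnj \<tau>)"
    define x where "x = (\<lambda>a. node n a - s)"
    have pn: "norm (p a - of_real (x a)) \<le> \<sigma> * \<bar>x a\<bar>" if "i * N \<le> a" "a \<le> Suc i * N" for a
      unfolding p_def x_def \<zeta>_def
      by (rule flat_at_rotated[OF flat])
         (use node_mono[OF that(1), of n] node_mono[OF that(2), of n] in \<open>simp only: big atLeastAtMost_iff\<close>)
    have xk: "\<kappa> * \<delta> \<le> \<bar>x a\<bar>" for a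
    proof -
      have "node n j + \<kappa> * \<delta> \<le> s" "s + \<kappa> * \<delta> \<le> node n (Suc j)"
        using j by (auto simp: well_inside_def \<delta>_def)
      moreover have "node n a \<le> node n j \<or> node n (Suc j) \<le> node n a"
        using node_mono[of a j n] node_mono[of "Suc j" a n] by linarith
      ultimately show ?thesis unfolding x_def by linarith
    qed
    have xS: "\<bar>x (Suc k)\<bar> \<le> \<bar>x k\<bar> + \<delta>"
      using \<delta> by (simp add: x_def nd algebra_simps)
    have xpos: "\<bar>x k\<bar> > 0" using xk[of k] \<kappa> \<delta> by (smt (verit) mult_pos_pos)
    have ratio: "\<bar>x (Suc k)\<bar> / \<bar>x k\<bar> \<le> 2 / \<kappa>"
    proof -
      have "\<delta> / \<bar>x k\<bar> \<le> \<delta> / (\<kappa> * \<delta>)" using xk[of k] \<delta> \<kappa> by (intro frac_le) auto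
      also have "\<dots> = 1 / \<kappa>" using \<delta> by simp
      finally have "\<delta> / \<bar>x k\<bar> \<le> 1 / \<kappa>" .
      have "\<bar>x (Suc k)\<bar> / \<bar>x k\<bar> \<le> (\<bar>x k\<bar> + \<delta>) / \<bar>x k\<bar>" using xS xpos by (intro divide_right_mono) auto
      also have "\<dots> = 1 + \<delta> / \<bar>x k\<bar>" using xpos by (simp add: add_divide_distrib)
      also have "\<dots> \<le> 1 / \<kappa> + 1 / \<kappa>" using \<open>\<delta> / \<bar>x k\<bar> \<le> 1 / \<kappa>\<close> \<kappa> by (intro add_mono) auto
      finally show ?thesis by simp
    qed
    have pk: "norm (p (Suc k) / p k - of_real (x (Suc k) / x k)) \<le> 4 * \<sigma> * (\<bar>x (Suc k)\<bar> / \<bar>x k\<bar>)"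
      using k xpos \<sigma> by (intro ratio_near_real pn) (auto simp: J_def)
    have "p k \<noteq> 0"
    proof
      assume "p k = 0"
      then have "\<bar>x k\<bar> \<le> \<sigma> * \<bar>x k\<bar>" using pn[of k] k by (auto simp: J_def)
      also have "\<dots> \<le> 1 / 4 * \<bar>x k\<bar>" using \<sigma> by (intro mult_right_mono) auto
      finally show False using xpos by simp
    qed
    then have "G (node n k) \<noteq> \<zeta>" by (auto simp: p_def)
    have "q k = ((G (node n (Suc k)) - G (node n k)) * cnj \<tau>) / ((\<zeta> - G (node n k)) * cnj \<tau>)"
      using \<tau> by (simp add: q_def)
    also have "\<dots> = (p (Suc k) - p k) / (- p k)" by (simp add: p_def algebra_simps)
    also have "\<dots> = 1 - p (Suc k) / p k" using \<open>p k \<noteq> 0\<close> by (simp add: field_simps)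
    finally have "Im (q k) = - Im (p (Suc k) / p k - of_real (x (Suc k) / x k))" by simp
    then have "\<bar>Im (q k)\<bar> \<le> 4 * \<sigma> * (\<bar>x (Suc k)\<bar> / \<bar>x k\<bar>)"
      using abs_Im_le_cmod[of "p (Suc k) / p k - of_real (x (Suc k) / x k)"] pk by linarith
    also have "\<dots> \<le> 4 * \<sigma> * (2 / \<kappa>)" using ratio \<sigma> by (intro mult_left_mono) auto
    finally show ?thesis by simp
  qed
  have Qsum: "\<bar>\<Sum>k\<in>J. Im (q k)\<bar> \<le> 8 * real N * \<sigma> / \<kappa>"
  proof -
    have "\<bar>\<Sum>k\<in>J. Im (q k)\<bar> \<le> (\<Sum>k\<in>J. \<bar>Im (q k)\<bar>)" by (rule sum_abs)
    also have "\<dots> \<le> real (card J) * (8 * \<sigma> / \<kappa>)" by (rule sum_bounded_above) (rule Q)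
    finally show ?thesis using J(2) by (simp add: mult_ac)
  qed
  have tail: "\<bar>Im (\<Sum>k\<in>{..<n} - J. boundary_kern n k s)\<bar> \<le> 84 / (c * \<kappa>)\<^sup>2 / real m"
  proof -
    have far: "real m \<le> \<bar>real k - real j\<bar>" if k: "k \<in> {..<n} - J" for k
    proof -
      have Ln1: "L / real n1 = real N * \<delta>" using n by (simp add: \<delta>_def field_simps)
      have s1: "u + \<kappa> * (real N * \<delta>) \<le> s" "s + \<kappa> * (real N * \<delta>) \<le> v"
        using i unfolding well_inside_def u_def v_def Ln1 by auto
      have s2: "node n j \<le> s" "s \<le> node n (Suc j)" using stj by auto
      have "\<kappa> * real N * \<delta> \<le> \<bar>real k - real j\<bar> * \<delta>"
      proof (cases "k < i * N")
        case True
        then have "real k + 1 \<le> real (i * N)" by linarith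
        then have "(real k + 1) * \<delta> \<le> u" unfolding uv_node nd using \<delta> by (intro mult_right_mono) auto
        moreover have "s \<le> (real j + 1) * \<delta>" using s2(2) by (simp add: nd algebra_simps)
        moreover have "\<bar>real k - real j\<bar> = real j - real k" using True iN by simp
        ultimately show ?thesis using s1(1) by (simp add: algebra_simps)
      next
        case False
        then have kk: "Suc i * N \<le> k" using k by (auto simp: J_def)
        then have "v \<le> real k * \<delta>" unfolding uv_node nd using \<delta> by (intro mult_right_mono) (simp_all only: of_nat_le_iff less_imp_le)
        moreover have "real j * \<delta> \<le> s" using s2(1) by (simp add: nd)
        moreover have "\<bar>real k - real j\<bar> = real k - real j" using kk iN by simp
        ultimately show ?thesis using s1(2) by (simp add: algebra_simps)
      qed
      then have "\<kappa> * real N \<le> \<bar>real k - real j\<bar>" using \<delta> by simp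
      then show ?thesis using m by linarith
    qed
    define C where "C = 21 / (c * \<kappa>)\<^sup>2"
    have C: "C \<ge> 0" by (simp add: C_def)
    have "\<bar>Im (\<Sum>k\<in>{..<n} - J. boundary_kern n k s)\<bar> \<le> norm (\<Sum>k\<in>{..<n} - J. boundary_kern n k s)"
      by (rule abs_Im_le_cmod)
    also have "\<dots> \<le> (\<Sum>k\<in>{..<n} - J. norm (boundary_kern n k s))" by (rule norm_sum)
    also have "\<dots> \<le> (\<Sum>k\<in>{..<n} - J. C * (1 / (real k - real j)\<^sup>2))"
    proof (intro sum_mono)
      fix k assume k: "k \<in> {..<n} - J"
      then have kj: "k < n" "k \<noteq> j" using J(3) by auto
      show "norm (boundary_kern n k s) \<le> C * (1 / (real k - real j)\<^sup>2)"
        using norm_kern_far[OF j \<kappa> kj c] boundary_kern_outer[OF j \<kappa>(1) kj(2)] by (simp add: C_def)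
    qed
    also have "\<dots> \<le> (\<Sum>k | k < n \<and> real m \<le> \<bar>real k - real j\<bar>. C * (1 / (real k - real j)\<^sup>2))"
      using far C by (intro sum_mono2) auto
    also have "\<dots> = C * (\<Sum>k | k < n \<and> real m \<le> \<bar>real k - real j\<bar>. 1 / (real k - real j)\<^sup>2)"
      by (simp only: sum_distrib_left)
    also have "\<dots> \<le> C * (4 / real m)"
      using C m by (intro mult_left_mono sum_inverse_square_distance) auto
    also have "\<dots> = 84 / (c * \<kappa>)\<^sup>2 / real m" by (simp add: C_def)
    finally show ?thesis .
  qed
  show ?thesis using total P Qsum tail by linarith
qed

end

section \<open>Holomorphic functions with approximate boundary data\<close>

lemma bounded_on_interval:
  fixes f :: "real \<Rightarrow> complex"
  assumes "continuous_on {0..L} f"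
  obtains B where "B \<ge> 0" "\<And>t. t \<in> {0..L} \<Longrightarrow> norm (f t) \<le> B"
proof -
  have "bounded (f ` {0..L})"
    by (intro compact_imp_bounded compact_continuous_image assms) auto
  then obtain b where "\<forall>t\<in>{0..L}. norm (f t) \<le> b" unfolding bounded_iff by auto
  then show thesis using that[of "max b 0"] by force
qed

text \<open>
  At small distances uniform continuity gives \<open>\<eta>\<close>, at other distances the second term is at
  least twice the bound of \<open>f\<close>.
\<close>

lemma quadratic_modulus:
  fixes f :: "real \<Rightarrow> complex"
  assumes "continuous_on {0..L} f" "\<eta> > 0"
  obtains A where "A \<ge> 0"
    "\<And>s t. s \<in> {0..L} \<Longrightarrow> t \<in> {0..L} \<Longrightarrow> norm (f t - f s) \<le> \<eta> + A * (t - s)\<^sup>2"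
proof -
  obtain B where B: "B \<ge> 0" "\<And>t. t \<in> {0..L} \<Longrightarrow> norm (f t) \<le> B"
    using bounded_on_interval[OF assms(1)] by blast
  have "uniformly_continuous_on {0..L} f"
    by (intro compact_uniformly_continuous assms) auto
  then obtain d where d: "d > 0"
     "\<And>s t. s \<in> {0..L} \<Longrightarrow> t \<in> {0..L} \<Longrightarrow> dist t s < d \<Longrightarrow> dist (f t) (f s) < \<eta>"
    unfolding uniformly_continuous_on_def using assms(2) by metis
  show thesis
  proof (rule that)
    show "2 * B / d\<^sup>2 \<ge> 0" using B by simp
    fix s t assume st: "s \<in> {0..L}" "t \<in> {0..L}"
    show "norm (f t - f s) \<le> \<eta> + 2 * B / d\<^sup>2 * (t - s)\<^sup>2"
    proof (cases "dist t s < d")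
      case True
      have "0 \<le> 2 * B / d\<^sup>2 * (t - s)\<^sup>2" using B by simp
      then show ?thesis using d(2)[OF st True] by (simp add: dist_norm)
    next
      case False
      have "d\<^sup>2 \<le> \<bar>t - s\<bar>\<^sup>2" using False d(1) by (intro power_mono) (auto simp: dist_real_def)
      then have "1 \<le> (t - s)\<^sup>2 / d\<^sup>2" using d(1) by simp
      then have "2 * B * 1 \<le> 2 * B * ((t - s)\<^sup>2 / d\<^sup>2)" using B by (intro mult_left_mono) auto
      moreover have "norm (f t - f s) \<le> 2 * B"
        using norm_triangle_ineq4[of "f t" "f s"] B(2)[OF st(1)] B(2)[OF st(2)] by simp
      ultimately show ?thesis using assms(2) by simp
    qed
  qed
qed

context arclength_Jordan_curve
begin

lemma well_inside_off_grid:
  assumes "n > 0" "s \<in> {0..L}" "\<kappa> > 0" "s \<notin> (\<Union>i\<le>n. cball (node n i) (\<kappa> * (L / real n)))"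
  obtains j where "well_inside \<kappa> n j s"
proof -
  have pos: "\<kappa> * (L / real n) > 0" using assms L_pos by simp
  have far: "\<kappa> * (L / real n) < \<bar>node n i - s\<bar>" if "i \<le> n" for i
    using assms(4) that by (auto simp: dist_real_def not_le)
  have "s < L" using far[of n] assms pos by auto
  then obtain j where j: "j < n" "node n j \<le> s" "s < node n (Suc j)"
    using cell_of[OF assms(1), of s] assms by auto
  have "well_inside \<kappa> n j s"
    using far[of j] far[of "Suc j"] j unfolding well_inside_def by auto
  then show thesis by (rule that)
qed

lemma grid_small:
  assumes "n > 0" "\<kappa> > 0"
  shows "(\<Union>i\<le>n. cball (node n i) (\<kappa> * (L / real n))) \<in> lmeasurable"
    and "measure lebesgue (\<Union>i\<le>n. cball (node n i) (\<kappa> * (L / real n))) \<le> 4 * \<kappa> * L"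
proof -
  define \<rho> where "\<rho> = \<kappa> * (L / real n)"
  have \<rho>: "\<rho> \<ge> 0" using assms L_pos by (simp add: \<rho>_def)
  show "(\<Union>i\<le>n. cball (node n i) (\<kappa> * (L / real n))) \<in> lmeasurable"
    using grid_neighbourhood_small(1)[OF \<rho>] by (simp only: \<rho>_def)
  have "measure lebesgue (\<Union>i\<le>n. cball (node n i) \<rho>) \<le> real (n + 1) * (2 * \<rho>)"
    by (rule grid_neighbourhood_small(2)[OF \<rho>])
  also have "\<dots> \<le> (2 * real n) * (2 * \<rho>)" using assms \<rho> by (intro mult_right_mono) auto
  also have "\<dots> = 4 * \<kappa> * L" using assms by (simp add: \<rho>_def)
  finally show "measure lebesgue (\<Union>i\<le>n. cball (node n i) (\<kappa> * (L / real n))) \<le> 4 * \<kappa> * L"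
    by (simp only: \<rho>_def)
qed

lemma node_distance:
  assumes "well_inside \<kappa> n j s" "\<kappa> > 0"
  shows "\<bar>node n k - s\<bar> \<le> (\<bar>real k - real j\<bar> + 1) * (L / real n)"
proof -
  define \<delta> where "\<delta> = L / real n"
  have nd: "node n a = real a * \<delta>" for a by (simp add: node_def \<delta>_def)
  have \<delta>: "\<delta> \<ge> 0" using L_pos by (simp add: \<delta>_def)
  have s: "real j * \<delta> \<le> s" "s \<le> real j * \<delta> + \<delta>"
    using well_inside_strict[OF assms] by (simp_all add: nd algebra_simps)
  have "\<bar>real k * \<delta> - real j * \<delta>\<bar> = \<bar>real k - real j\<bar> * \<delta>"
    using \<delta> by (simp add: left_diff_distrib[symmetric] abs_mult)
  then show ?thesis using s unfolding nd \<delta>_def[symmetric] distrib_right by linarith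
qed

text \<open>
  The function \<open>g\<close> has boundary values \<open>h\<close> from \<open>D\<close> except at the finitely many points of \<open>X\<close>, and off
  the exceptional set \<open>F\<close> they are \<open>f\<close> times a number with real part nearly 1. The bound in approach
  regions of aperture \<open>M\<close> is proportional to the data, so it is small wherever the data are.
\<close>

definition approximates where
  "approximates e M K \<eta> f g h X F \<longleftrightarrow>
     g holomorphic_on D \<and> finite X \<and> F \<in> lmeasurable \<and> measure lebesgue F \<le> e \<and>
     (\<forall>s\<in>{0..L} - X. (g \<longlongrightarrow> h s) (at (G s) within D)) \<and>
     (\<forall>s\<in>{0..L} - F. \<exists>y. \<bar>y\<bar> \<le> K \<and> norm (h s - f s * (1 + \<i> * of_real y)) \<le> \<eta>) \<and>
     (\<forall>s\<in>{0..L} - F. \<forall>z\<in>D. dist z (G s) \<le> M * infdist z (frontier D) \<longrightarrow>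
        norm (g z) \<le> K * (norm (f s) + \<eta>)) \<and>
     (\<forall>z\<in>D. \<eta> \<le> infdist z (frontier D) \<longrightarrow> norm (g z) \<le> \<eta>)"

text \<open>
  The order of the choices is essential. The exceptional measure \<open>e\<close> and the aperture \<open>M\<close> determine
  the chord-arc constant \<open>c\<close>, the margin \<open>\<kappa>\<close> and the bound \<open>K\<close>. The function \<open>f\<close> and the precision \<open>\<eta>\<close>
  come afterwards, and only the subdivision and the flatness \<open>\<sigma>\<close> depend on them.
\<close>

proposition approximate_boundary_data:
  assumes "e > 0" "M > 0"
  obtains K where "K \<ge> 1"
    "\<And>\<eta> f. \<eta> > 0 \<Longrightarrow> continuous_on {0..L} f \<Longrightarrow> \<exists>g h X F. approximates e M K \<eta> f g h X F"
proof -
  obtain c F1 where c: "0 < c" "c \<le> 1" and F1: "F1 \<in> lmeasurable" "measure lebesgue F1 \<le> e / 4"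
    and ca: "\<And>s t. s \<in> {0..L} - F1 \<Longrightarrow> t \<in> {0..L} \<Longrightarrow> c * \<bar>t - s\<bar> \<le> norm (G t - G s)"
    using chord_arc_off_small_set[of "e / 4"] assms(1) by auto
  define \<kappa> where "\<kappa> = min 1 (e / (32 * L))"
  have \<kappa>: "0 < \<kappa>" "\<kappa> \<le> 1" "4 * \<kappa> * L \<le> e / 8"
  proof -
    show "0 < \<kappa>" "\<kappa> \<le> 1" using assms L_pos by (auto simp: \<kappa>_def)
    have "\<kappa> \<le> e / (32 * L)" unfolding \<kappa>_def by (rule min.cobounded2)
    then show "4 * \<kappa> * L \<le> e / 8" using L_pos by (simp add: field_simps)
  qed
  define c1 where "c1 = c / (1 + M)"
  have c1: "0 < c1" using c assms by (simp add: c1_def)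
  have c1c: "c1 \<le> c" unfolding c1_def using c assms by (simp add: divide_le_eq mult_ge1_I)
  define Kf where "Kf = 21 / (c1 * \<kappa>)\<^sup>2"
  define Ks where "Ks = 9 + 3 / \<kappa> + 2 / (c * \<kappa>) + 21 * (2 * M / (c * \<kappa>))\<^sup>2"
  define K where "K = Ks + 4 * Kf"
  have Kf: "Kf \<ge> 0" by (simp add: Kf_def)
  have Ks: "9 \<le> Ks" "5 + 3 / \<kappa> \<le> Ks" "9 + 1 / \<kappa> + 2 / (c * \<kappa>) + 21 * (2 * M / (c * \<kappa>))\<^sup>2 \<le> Ks"
  proof -
    have "0 \<le> 1 / \<kappa>" "0 \<le> 2 / (c * \<kappa>)" "0 \<le> 21 * (2 * M / (c * \<kappa>))\<^sup>2" using \<kappa> c by auto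
    then show "9 \<le> Ks" "5 + 3 / \<kappa> \<le> Ks" "9 + 1 / \<kappa> + 2 / (c * \<kappa>) + 21 * (2 * M / (c * \<kappa>))\<^sup>2 \<le> Ks"
      unfolding Ks_def by (simp_all add: divide_right_mono) 
  qed
  have K: "K \<ge> 9" using Kf Ks by (simp add: K_def)
  show thesis
  proof (rule that[of K])
    show "1 \<le> K" using K by simp
    fix \<eta> :: real and f :: "real \<Rightarrow> complex"
    assume \<eta>: "\<eta> > 0" and f: "continuous_on {0..L} f"
    obtain B where B: "B \<ge> 0" "\<And>t. t \<in> {0..L} \<Longrightarrow> norm (f t) \<le> B"
      using bounded_on_interval[OF f] by blast
    define \<eta>2 where "\<eta>2 = \<eta> / (2 * K)"
    have \<eta>2: "\<eta>2 > 0" "K * \<eta>2 = \<eta> / 2" "\<eta>2 \<le> \<eta>"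
      using \<eta> K by (simp_all add: \<eta>2_def field_simps)
    define \<eta>3 where "\<eta>3 = \<eta> / (2 * (B + 1))"
    have \<eta>3: "\<eta>3 > 0" "B * \<eta>3 \<le> \<eta> / 2"
      using \<eta> B by (simp_all add: \<eta>3_def field_simps)
    obtain A where A: "A \<ge> 0"
      "\<And>s t. s \<in> {0..L} \<Longrightarrow> t \<in> {0..L} \<Longrightarrow> norm (f t - f s) \<le> \<eta>2 / 2 + A * (t - s)\<^sup>2"
      using quadratic_modulus[OF f, of "\<eta>2 / 2"] \<eta>2 by auto
    define T where "T = 84 / (c * \<kappa>)\<^sup>2"
    have T: "T \<ge> 0" by (simp add: T_def)
    obtain m :: nat where m: "2 * T / \<eta>3 < real m" using reals_Archimedean2 by blast
    have "0 \<le> 2 * T / \<eta>3" using T \<eta>3 by simp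
    then have m0: "m > 0" using m by linarith
    have mT: "T / real m \<le> \<eta>3 / 2"
      using m m0 \<eta>3 by (simp add: field_simps)
    obtain N :: nat where N': "real m / \<kappa> < real N" using reals_Archimedean2 by blast
    have N: "real m \<le> \<kappa> * real N" "N > 0"
    proof -
      have "real m < real N * \<kappa>" using N' \<kappa>(1) by (simp only: pos_divide_less_eq)
      then show "real m \<le> \<kappa> * real N" by (simp add: mult.commute)
      have "0 \<le> real m / \<kappa>" using \<kappa>(1) by simp
      then have "0 < real N" using N' by linarith
      then show "N > 0" by simp
    qed
    define \<sigma> where "\<sigma> = min (1 / 4) (\<eta>3 / 2 / (4 + 8 * real N / \<kappa>))"
    have den: "4 + 8 * real N / \<kappa> > 0" using \<kappa> by (simp add: add_pos_nonneg)
    have \<sigma>: "0 < \<sigma>" "\<sigma> \<le> 1 / 4" "4 * \<sigma> + 8 * real N * \<sigma> / \<kappa> \<le> \<eta>3 / 2"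
    proof -
      show "0 < \<sigma>" unfolding \<sigma>_def using den \<eta>3 by simp
      show "\<sigma> \<le> 1 / 4" unfolding \<sigma>_def by (rule min.cobounded1)
      have "\<sigma> \<le> \<eta>3 / 2 / (4 + 8 * real N / \<kappa>)" unfolding \<sigma>_def by (rule min.cobounded2)
      then have "\<sigma> * (4 + 8 * real N / \<kappa>) \<le> \<eta>3 / 2" using den by (simp only: pos_le_divide_eq)
      then show "4 * \<sigma> + 8 * real N * \<sigma> / \<kappa> \<le> \<eta>3 / 2" by (simp add: algebra_simps)
    qed
    obtain n0 where n0: "n0 > 0"
      "\<And>n. n \<ge> n0 \<Longrightarrow> \<exists>F\<in>lmeasurable. measure lebesgue F \<le> e / 4 \<and>
       (\<forall>i<n. \<forall>s\<in>{node n i..node n (Suc i)} - F. \<exists>\<tau>. norm \<tau> = 1 \<and>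
          (\<forall>t\<in>{node n i..node n (Suc i)}. norm (G t - G s - of_real (t - s) * \<tau>) \<le> \<sigma> * \<bar>t - s\<bar>))"
      using flat_cells[of "e / 4" \<sigma>] assms(1) \<sigma>(1) by auto
    obtain n1' :: nat where n1': "8 * A * L * L / \<eta>2 + 21 * B * L * L / \<eta> ^ 3 < real n1'"
      using reals_Archimedean2 by blast
    define n1 where "n1 = max n0 n1'"
    have n1: "n1 > 0" "n1 \<ge> n0" using n0 by (auto simp: n1_def)
    have n1_big: "8 * A * L * L / \<eta>2 \<le> real n1" "21 * B * L * L / \<eta> ^ 3 \<le> real n1"
    proof -
      have "0 \<le> 8 * A * L * L / \<eta>2" "0 \<le> 21 * B * L * L / \<eta> ^ 3" using A B \<eta> \<eta>2 L_pos by auto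
      moreover have "real n1' \<le> real n1" by (simp add: n1_def)
      ultimately show "8 * A * L * L / \<eta>2 \<le> real n1" "21 * B * L * L / \<eta> ^ 3 \<le> real n1"
        using n1' by linarith+
    qed
    obtain F2 where F2: "F2 \<in> lmeasurable" "measure lebesgue F2 \<le> e / 4"
       "\<And>i s. i < n1 \<Longrightarrow> s \<in> {node n1 i..node n1 (Suc i)} - F2 \<Longrightarrow> \<exists>\<tau>. flat_at \<sigma> \<tau> (node n1 i) s (node n1 (Suc i))"
      using n0(2)[OF n1(2)] unfolding flat_at_def by metis
    define n where "n = n1 * N"
    have n: "n > 0" using n1 N by (simp add: n_def)
    define \<delta> where "\<delta> = L / real n"
    have n\<delta>: "real n * \<delta> = L" using n by (simp add: \<delta>_def)
    have \<delta>: "\<delta> > 0" "\<delta> \<le> L / real n1"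
    proof -
      show "\<delta> > 0" using L_pos n by (simp add: \<delta>_def)
      have "real n1 * 1 \<le> real n1 * real N" using N(2) by (intro mult_left_mono) auto
      then have "real n1 \<le> real n" by (simp add: n_def)
      then show "\<delta> \<le> L / real n1" unfolding \<delta>_def using L_pos n1 by (intro divide_left_mono) auto
    qed
    have \<delta>A: "4 * A * L * \<delta> \<le> \<eta>2 / 2"
    proof -
      have "4 * A * L * \<delta> \<le> 4 * A * L * (L / real n1)" using \<delta> A L_pos by (intro mult_left_mono) auto
      also have "\<dots> \<le> \<eta>2 / 2" using n1_big(1) n1(1) \<eta>2(1) by (simp add: field_simps)
      finally show ?thesis .
    qed
    have \<delta>B: "21 * B * L * \<delta> \<le> \<eta> ^ 3"
    proof -
      have "21 * B * L * \<delta> \<le> 21 * B * L * (L / real n1)" using \<delta> B L_pos by (intro mult_left_mono) auto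
      also have "\<dots> \<le> \<eta> ^ 3" using n1_big(2) n1(1) \<eta> by (simp add: field_simps)
      finally show ?thesis .
    qed
    define grid where "grid = (\<lambda>k. \<Union>i\<le>k. cball (node k i) (\<kappa> * (L / real k)))"
    have grid: "grid k \<in> lmeasurable" "measure lebesgue (grid k) \<le> e / 8" if "k > 0" for k
      unfolding grid_def using grid_small[OF that \<kappa>(1)] \<kappa>(3) by auto
    define F where "F = (F1 \<union> F2) \<union> (grid n1 \<union> grid n)"
    have F: "F \<in> lmeasurable" "measure lebesgue F \<le> e"
    proof -
      show "F \<in> lmeasurable" unfolding F_def using F1(1) F2(1) grid(1)[OF n] grid(1)[OF n1(1)] by (intro fmeasurable.Un)
      have sets: "F1 \<in> sets lebesgue" "F2 \<in> sets lebesgue" "grid n1 \<in> sets lebesgue" "grid n \<in> sets lebesgue"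
        using F1(1) F2(1) grid(1)[OF n] grid(1)[OF n1(1)] by (simp_all only: fmeasurableD)
      have "measure lebesgue F \<le> measure lebesgue (F1 \<union> F2) + measure lebesgue (grid n1 \<union> grid n)"
        unfolding F_def using sets by (intro measure_Un_le sets.Un)
      also have "\<dots> \<le> (measure lebesgue F1 + measure lebesgue F2)
          + (measure lebesgue (grid n1) + measure lebesgue (grid n))"
        using sets by (intro add_mono measure_Un_le)
      also have "\<dots> \<le> (e / 4 + e / 4) + (e / 8 + e / 8)"
        using F1(2) F2(2) grid(2)[OF n] grid(2)[OF n1(1)] by (intro add_mono)
      also have "\<dots> \<le> e" using assms(1) by simp
      finally show "measure lebesgue F \<le> e" .
    qed
    define a where "a = (\<lambda>k. f (node n k))"
    \<comment> \<open>\<open>\<omega> = orient / (\<pi> \<i>)\<close> turns the jump with imaginary part \<open>\<pi> orient\<close> into a number with real part 1.\<close>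
    define \<omega> :: complex where "\<omega> = of_real (orient / pi) * (- \<i>)"
    have \<omega>: "norm \<omega> \<le> 1" using orient pi_ge_two by (auto simp: \<omega>_def norm_mult norm_divide)
    define g where "g = (\<lambda>z. \<omega> * (\<Sum>k<n. a k * kern n k z))"
    define h where "h = (\<lambda>s. \<omega> * (\<Sum>k<n. a k * boundary_kern n k s))"
    define X where "X = node n ` {..n}"
    have aB: "norm (a k) \<le> B" if "k < n" for k
      unfolding a_def using that by (intro B(2)) (auto intro!: node_le_L n)
    have g_hol: "g holomorphic_on D"
      unfolding g_def by (intro holomorphic_intros kern_holomorphic) auto
    have g_lim: "(g \<longlongrightarrow> h s) (at (G s) within D)" if s: "s \<in> {0..L} - X" for s
    proof -
      have nn: "s \<noteq> node n k" if "k \<le> n" for k using s that by (auto simp: X_def)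
      have "0 < s" "s < L" using nn[of 0] nn[of n] s n by auto
      then show ?thesis
        unfolding g_def h_def using nn by (intro tendsto_intros kern_tendsto) auto
    qed
    have good: "\<exists>y. \<bar>y\<bar> \<le> K \<and> norm (h s - f s * (1 + \<i> * of_real y)) \<le> \<eta>"
      and good_nt: "\<forall>z\<in>D. dist z (G s) \<le> M * infdist z (frontier D) \<longrightarrow> norm (g z) \<le> K * (norm (f s) + \<eta>)"
      if s: "s \<in> {0..L} - F" for s
    proof -
      have sL: "s \<in> {0..L}" using s by auto
      obtain j where j: "well_inside \<kappa> n j s"
        using well_inside_off_grid[OF n sL \<kappa>(1)] s by (auto simp: F_def grid_def)
      obtain i where i: "well_inside \<kappa> n1 i s"
        using well_inside_off_grid[OF n1(1) sL \<kappa>(1)] s by (auto simp: F_def grid_def)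
      note stj = well_inside_strict[OF j \<kappa>(1)] and sti = well_inside_strict[OF i \<kappa>(1)]
      obtain \<tau> where flat: "flat_at \<sigma> \<tau> (node n1 i) s (node n1 (Suc i))"
        using F2(3)[OF sti(1), of s] sti s by (auto simp: F_def)
      have ca_s: "c * \<bar>t - s\<bar> \<le> norm (G t - G s)" if "t \<in> {0..L}" for t
        using ca[of s t] s that by (auto simp: F_def)
      have big: "node n1 b = node n (b * N)" for b unfolding n_def by (rule node_refine[OF N(2)])
      have flat_small: "flat_at \<sigma> \<tau> (node n j) s (node n (Suc j))"
        using nested_cells[OF N(2) i j[unfolded n_def] \<kappa>(1)]
        by (intro flat_at_subinterval[OF flat]) (simp_all only: big node_mono Suc_leI)
      have a_near: "norm (a k - f s) \<le> \<eta>2 / 2 + A * ((\<bar>real k - real j\<bar> + 1) * \<delta>)\<^sup>2" if "k < n" for k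
      proof -
        have "norm (a k - f s) \<le> \<eta>2 / 2 + A * (node n k - s)\<^sup>2"
          unfolding a_def using that sL by (intro A(2)) (auto intro!: node_le_L n)
        also have "(node n k - s)\<^sup>2 = \<bar>node n k - s\<bar>\<^sup>2" by simp
        also have "\<eta>2 / 2 + A * \<bar>node n k - s\<bar>\<^sup>2 \<le> \<eta>2 / 2 + A * ((\<bar>real k - real j\<bar> + 1) * \<delta>)\<^sup>2"
          unfolding \<delta>_def using A(1) node_distance[OF j \<kappa>(1), of k]
          by (intro add_left_mono mult_left_mono power_mono) auto
        finally show ?thesis .
      qed
      have mod: "\<eta>2 / 2 + 4 * A * L * \<delta> \<le> \<eta>2" using \<delta>A by simp
      have ws: "(\<Sum>k<n. norm (w k)) \<le> K \<and> norm ((\<Sum>k<n. a k * w k) - f s * (\<Sum>k<n. w k)) \<le> \<eta>2 * K"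
        if "norm (w j) \<le> Ks" "\<And>k. k < n \<Longrightarrow> k \<noteq> j \<Longrightarrow> norm (w k) \<le> Kf / (real k - real j)\<^sup>2" for w
      proof
        show "(\<Sum>k<n. norm (w k)) \<le> K" unfolding K_def
          by (rule weighted_sum_bounds(1)[where j = j and \<delta> = \<delta> and L = L and A = A and \<eta> = "\<eta>2 / 2"])
             (use stj n\<delta> \<delta> Ks Kf A \<eta>2 that in auto)
        have "norm ((\<Sum>k<n. a k * w k) - f s * (\<Sum>k<n. w k)) \<le> (\<eta>2 / 2 + 4 * A * L * \<delta>) * (Ks + 4 * Kf)"
          by (rule weighted_sum_bounds(2)[where j = j and \<delta> = \<delta> and L = L and A = A and \<eta> = "\<eta>2 / 2"])
             (use stj n\<delta> \<delta> Ks Kf A \<eta>2 that a_near in auto)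
        also have "\<dots> \<le> \<eta>2 * K" unfolding K_def using mod Ks Kf by (intro mult_right_mono) auto
        finally show "norm ((\<Sum>k<n. a k * w k) - f s * (\<Sum>k<n. w k)) \<le> \<eta>2 * K" .
      qed
      show "\<forall>z\<in>D. dist z (G s) \<le> M * infdist z (frontier D) \<longrightarrow> norm (g z) \<le> K * (norm (f s) + \<eta>)"
      proof (intro ballI impI)
        fix z assume z: "z \<in> D" "dist z (G s) \<le> M * infdist z (frontier D)"
        have far: "c1 * \<bar>t - s\<bar> \<le> norm (G t - z)" if "t \<in> {0..L}" for t
          unfolding c1_def using assms c sL that ca_s z(2) by (intro nontangential_distance) auto
        have W: "(\<Sum>k<n. norm (kern n k z)) \<le> K"
           "norm ((\<Sum>k<n. a k * kern n k z) - f s * (\<Sum>k<n. kern n k z)) \<le> \<eta>2 * K"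
        proof -
          have "norm (kern n j z) \<le> Ks"
            using norm_kern_self_le[OF j \<kappa>(1,2) \<sigma>(2) flat_small c(1) ca_s assms(2) z] Ks(3) by linarith
          moreover have "norm (kern n k z) \<le> Kf / (real k - real j)\<^sup>2" if "k < n" "k \<noteq> j" for k
            unfolding Kf_def using norm_kern_far[OF j \<kappa>(1,2) that c1 far] .
          ultimately show "(\<Sum>k<n. norm (kern n k z)) \<le> K"
             "norm ((\<Sum>k<n. a k * kern n k z) - f s * (\<Sum>k<n. kern n k z)) \<le> \<eta>2 * K"
            using ws[of "\<lambda>k. kern n k z"] by blast+
        qed
        have "norm (f s * (\<Sum>k<n. kern n k z)) \<le> norm (f s) * K"
          unfolding norm_mult using W(1) norm_sum[of "\<lambda>k. kern n k z" "{..<n}"]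
          by (intro mult_left_mono) auto
        then have "norm (\<Sum>k<n. a k * kern n k z) \<le> norm (f s) * K + \<eta>2 * K"
          using W(2) norm_triangle_sub[of "\<Sum>k<n. a k * kern n k z" "f s * (\<Sum>k<n. kern n k z)"] by linarith
        also have "\<dots> \<le> norm (f s) * K + \<eta> * K" using \<eta>2 K by (intro add_left_mono mult_right_mono) auto
        finally have "norm (\<Sum>k<n. a k * kern n k z) \<le> K * (norm (f s) + \<eta>)" by (simp add: algebra_simps)
        moreover have "norm (g z) \<le> 1 * norm (\<Sum>k<n. a k * kern n k z)"
          unfolding g_def norm_mult using \<omega> by (intro mult_right_mono) auto
        ultimately show "norm (g z) \<le> K * (norm (f s) + \<eta>)" by linarith
      qed
      define S where "S = (\<Sum>k<n. boundary_kern n k s)"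
      have W: "(\<Sum>k<n. norm (boundary_kern n k s)) \<le> K"
           "norm ((\<Sum>k<n. a k * boundary_kern n k s) - f s * S) \<le> \<eta>2 * K"
      proof -
        have "norm (boundary_kern n j s) \<le> Ks"
          using norm_boundary_kern_self_le[OF j \<kappa>(1,2) \<sigma>(2) flat_small] Ks(2) by linarith
        moreover have "norm (boundary_kern n k s) \<le> Kf / (real k - real j)\<^sup>2" if k: "k < n" "k \<noteq> j" for k
        proof -
          have "boundary_kern n k s = kern n k (G s)" by (rule boundary_kern_outer[OF j \<kappa>(1) k(2)])
          moreover have "c1 * \<bar>t - s\<bar> \<le> norm (G t - G s)" if "t \<in> {0..L}" for t
            using ca_s[OF that] mult_right_mono[OF c1c, of "\<bar>t - s\<bar>"] by linarith
          ultimately show ?thesis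
            unfolding Kf_def using norm_kern_far[OF j \<kappa>(1,2) k c1] by simp
        qed
        ultimately show "(\<Sum>k<n. norm (boundary_kern n k s)) \<le> K"
           "norm ((\<Sum>k<n. a k * boundary_kern n k s) - f s * S) \<le> \<eta>2 * K"
          using ws[of "\<lambda>k. boundary_kern n k s"] unfolding S_def by blast+
      qed
      have "\<bar>Im S - pi * orient\<bar> \<le> 4 * \<sigma> + 8 * real N * \<sigma> / \<kappa> + T / real m"
        unfolding S_def T_def
        by (rule boundary_sum[OF N(2) n1(1) n_def i j \<kappa>(1,2) _ \<sigma>(2) flat c(1) ca_s m0 N(1)]) (use \<sigma> in auto)
      then have ImS: "\<bar>Im S - pi * orient\<bar> \<le> \<eta>3" using \<sigma>(3) mT by linarith
      have nS: "norm S \<le> K" unfolding S_def using W(1) norm_sum[of "\<lambda>k. boundary_kern n k s" "{..<n}"] by linarith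
      define y where "y = - (orient / pi) * Re S"
      have "\<omega> * S - (1 + \<i> * of_real y) = of_real ((orient / pi) * (Im S - pi * orient))"
        using orient by (auto simp: \<omega>_def y_def complex_eq_iff right_diff_distrib)
      moreover have "\<bar>orient / pi\<bar> \<le> 1" using orient pi_ge_two by auto
      ultimately have near: "norm (\<omega> * S - (1 + \<i> * of_real y)) \<le> 1 * \<eta>3"
        using ImS by (simp only: norm_of_real abs_mult) (intro mult_mono, auto)
      show "\<exists>y. \<bar>y\<bar> \<le> K \<and> norm (h s - f s * (1 + \<i> * of_real y)) \<le> \<eta>"
      proof (intro exI conjI)
        have "\<bar>y\<bar> = \<bar>orient / pi\<bar> * \<bar>Re S\<bar>" by (simp add: y_def abs_mult)
        also have "\<dots> \<le> 1 * K"
          using \<open>\<bar>orient / pi\<bar> \<le> 1\<close> abs_Re_le_cmod[of S] nS by (intro mult_mono) auto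
        finally show "\<bar>y\<bar> \<le> K" by simp
        have eq: "h s - f s * (1 + \<i> * of_real y)
            = \<omega> * ((\<Sum>k<n. a k * boundary_kern n k s) - f s * S) + f s * (\<omega> * S - (1 + \<i> * of_real y))"
          by (simp add: h_def algebra_simps)
        have "norm (h s - f s * (1 + \<i> * of_real y))
            \<le> norm \<omega> * norm ((\<Sum>k<n. a k * boundary_kern n k s) - f s * S)
              + norm (f s) * norm (\<omega> * S - (1 + \<i> * of_real y))"
          unfolding eq norm_mult[symmetric] by (rule norm_triangle_ineq)
        also have "\<dots> \<le> 1 * (\<eta>2 * K) + B * \<eta>3"
          using \<omega> W(2) B(2)[OF sL] B(1) near by (intro add_mono mult_mono) auto
        also have "\<dots> \<le> \<eta>" using \<eta>2(2) \<eta>3(2) by (simp add: mult.commute)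
        finally show "norm (h s - f s * (1 + \<i> * of_real y)) \<le> \<eta>" .
      qed
    qed
    have small: "norm (g z) \<le> \<eta>" if z: "z \<in> D" "\<eta> \<le> infdist z (frontier D)" for z
    proof -
      have kz: "norm (kern n k z) \<le> 21 * (\<delta> / \<eta>)\<^sup>2" if k: "k < n" for k
        unfolding \<delta>_def
      proof (rule norm_kern_le[OF k \<eta>])
        fix t assume "t \<in> {node n k..node n (Suc k)}"
        then have "infdist z (frontier D) \<le> norm (G t - z)"
          using cell_subset[OF k] infdist_frontier_le by blast
        then show "\<eta> \<le> norm (G t - z)" using z(2) by linarith
      qed
      have "norm (\<Sum>k<n. a k * kern n k z) \<le> (\<Sum>k<n. norm (a k * kern n k z))" by (rule norm_sum)
      also have "\<dots> \<le> (\<Sum>k<n. B * (21 * (\<delta> / \<eta>)\<^sup>2))"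
        unfolding norm_mult using aB kz B by (intro sum_mono mult_mono) auto
      also have "\<dots> = 21 * B * (real n * \<delta>) * \<delta> / \<eta>\<^sup>2" by (simp add: power2_eq_square)
      also have "\<dots> = 21 * B * L * \<delta> / \<eta>\<^sup>2" by (simp only: n\<delta>)
      also have "\<dots> \<le> \<eta> ^ 3 / \<eta>\<^sup>2" using \<delta>B by (intro divide_right_mono) auto
      also have "\<dots> = \<eta>" using \<eta> by (simp add: power2_eq_square power3_eq_cube)
      finally have "norm (\<Sum>k<n. a k * kern n k z) \<le> \<eta>" .
      moreover have "norm (g z) \<le> 1 * norm (\<Sum>k<n. a k * kern n k z)"
        unfolding g_def norm_mult using \<omega> by (intro mult_right_mono) auto
      ultimately show ?thesis by linarith
    qed
    have "finite X" by (simp add: X_def)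
    then have "approximates e M K \<eta> f g h X F"
      using g_hol F g_lim good good_nt small unfolding approximates_def by blast
    then show "\<exists>g h X F. approximates e M K \<eta> f g h X F" by blast
  qed
qed

end

section \<open>Measurable boundary data\<close>

text \<open>
  A measurable function is almost everywhere a limit of continuous ones, and on a set of finite
  measure this convergence holds in measure.
\<close>

lemma continuous_off_small_set:
  fixes f :: "real \<Rightarrow> complex"
  assumes f: "f \<in> borel_measurable (lebesgue_on {0..L})" and "e > 0" "\<eta> > 0"
  obtains c F where "continuous_on {0..L} c" "F \<in> lmeasurable" "measure lebesgue F \<le> e"
    "\<And>s. s \<in> {0..L} - F \<Longrightarrow> norm (c s - f s) \<le> \<eta>"
proof -
  define M where "M = lebesgue_on {0..L}"
  have "f measurable_on {0..L}"
    using f by (simp add: measurable_on_iff_borel_measurable)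
  then obtain N c where N: "negligible N" and c: "\<And>n. continuous_on UNIV (c n :: real \<Rightarrow> complex)"
    and lim: "\<And>x. x \<notin> N \<Longrightarrow> (\<lambda>n. c n x) \<longlonglongrightarrow> (if x \<in> {0..L} then f x else 0)"
    unfolding measurable_on_def by blast
  have N0: "N \<in> lmeasurable" "measure lebesgue N = 0"
    using N by (auto simp: negligible_iff_measure)
  define A where "A = (\<lambda>k. {s \<in> space M. \<exists>n\<ge>k. \<eta> < norm (c n s - f s)})"
  have cm: "c n \<in> borel_measurable M" for n
    unfolding M_def using c[of n]
    by (intro continuous_imp_measurable_on_sets_lebesgue) (auto intro: continuous_on_subset)
  have A_sets: "A k \<in> sets M" for k
  proof -
    have [measurable]: "f \<in> borel_measurable M" using f by (simp add: M_def)
    have [measurable]: "\<And>n. c n \<in> borel_measurable M" by (rule cm)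
    show ?thesis unfolding A_def by measurable
  qed
  have fin: "emeasure M (A k) \<noteq> \<infinity>" for k
  proof -
    have "emeasure M (A k) \<le> emeasure M (space M)" by (rule emeasure_space)
    also have "\<dots> < \<infinity>" by (simp add: M_def space_restrict_space emeasure_restrict_space emeasure_lborel_Icc_eq)
    finally show ?thesis by simp
  qed
  have "(\<lambda>k. measure M (A k)) \<longlonglongrightarrow> measure M (\<Inter>k. A k)"
  proof (rule Lim_measure_decseq)
    show "decseq A" unfolding A_def decseq_def by (auto intro: order_trans)
  qed (use A_sets fin in auto)
  moreover have "measure M (\<Inter>k. A k) = 0"
  proof -
    have "(\<Inter>k. A k) \<subseteq> N"
    proof
      fix s assume s: "s \<in> (\<Inter>k. A k)"
      show "s \<in> N"
      proof (rule ccontr)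
        assume "s \<notin> N"
        have sL: "s \<in> {0..L}" using s by (auto simp: A_def M_def space_restrict_space)
        then have "(\<lambda>n. c n s) \<longlonglongrightarrow> f s" using lim[OF \<open>s \<notin> N\<close>] by simp
        then obtain k where "\<And>n. n \<ge> k \<Longrightarrow> dist (c n s) (f s) < \<eta>"
          using assms(3) unfolding lim_sequentially by blast
        moreover have "s \<in> A k" using s by blast
        ultimately show False by (force simp: A_def dist_norm)
      qed
    qed
    then have "negligible (\<Inter>k. A k)" using N negligible_subset by blast
    moreover have "(\<Inter>k. A k) \<subseteq> {0..L}" by (auto simp: A_def M_def space_restrict_space)
    then have "measure M (\<Inter>k. A k) = measure lebesgue (\<Inter>k. A k)"
      unfolding M_def by (intro measure_restrict_space) auto
    ultimately show ?thesis by (simp add: negligible_imp_measure0)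
  qed
  ultimately have "(\<lambda>k. measure M (A k)) \<longlonglongrightarrow> 0" by simp
  then obtain k where k: "measure M (A k) < e"
    using assms(2) unfolding lim_sequentially by (force simp: dist_real_def)
  have Ak: "A k \<subseteq> {0..L}" "A k \<in> sets lebesgue" "measure M (A k) = measure lebesgue (A k)"
  proof -
    show sub: "A k \<subseteq> {0..L}" by (auto simp: A_def M_def space_restrict_space)
    show "A k \<in> sets lebesgue" using A_sets[of k] unfolding M_def
      by (subst (asm) sets_restrict_space_iff) auto
    show "measure M (A k) = measure lebesgue (A k)"
      unfolding M_def using sub by (intro measure_restrict_space) auto
  qed
  have Akl: "A k \<in> lmeasurable"
    using Ak bounded_subset[OF bounded_closed_interval Ak(1)]
    by (intro bounded_set_imp_lmeasurable) (auto intro: bounded_subset)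
  show thesis
  proof
    show "continuous_on {0..L} (c k)" using c[of k] by (rule continuous_on_subset) simp
    show "A k \<union> N \<in> lmeasurable" using Akl N0 by auto
    show "measure lebesgue (A k \<union> N) \<le> e"
      using measure_Un_le[of "A k" lebesgue N] Akl N0 Ak k by (auto simp: fmeasurableD)
    fix s assume "s \<in> {0..L} - (A k \<union> N)"
    then show "norm (c k s - f s) \<le> \<eta>"
      by (auto simp: A_def M_def space_restrict_space not_less)
  qed
qed

context arclength_Jordan_curve
begin

lemma boundary_point_not_isolated:
  assumes "s \<in> {0..L}"
  shows "at (G s) within D \<noteq> bot"
proof -
  have "G s \<in> closure D" using frontier_D assms by (auto simp: frontier_def)
  moreover have "G s \<notin> D" using D_disjoint assms by blast
  ultimately show ?thesis by (auto simp: closure_def trivial_limit_within)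
qed

text \<open>
  Where limits from \<open>D\<close> exist at all points of a subset of the boundary, they form a continuous
  function on that subset, since every boundary point is a limit of points of \<open>D\<close>.
\<close>

lemma boundary_limit_measurable:
  assumes "finite X" and lim: "\<And>s. s \<in> {0..L} - X \<Longrightarrow> (g \<longlongrightarrow> h s) (at (G s) within D)"
  shows "(\<lambda>s. if s \<in> {0..L} - X then h s else (0::complex)) \<in> borel_measurable (lebesgue_on {0..L})"
proof -
  have "continuous_on ({0..L} - X) h"
    unfolding continuous_on_iff
  proof (intro ballI allI impI)
    fix s e :: real assume s: "s \<in> {0..L} - X" and e: "e > 0"
    obtain r where r: "r > 0" "\<And>z. z \<in> D \<Longrightarrow> dist z (G s) < r \<Longrightarrow> dist (g z) (h s) < e / 2"
    proof -
      obtain r where "r > 0" "\<And>z. z \<in> D \<Longrightarrow> 0 < dist z (G s) \<Longrightarrow> dist z (G s) < r \<Longrightarrow> dist (g z) (h s) < e / 2"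
        using lim[OF s, unfolded Lim_within, rule_format, OF half_gt_zero[OF e]] by blast
      moreover have "0 < dist z (G s)" if "z \<in> D" for z using D_disjoint[OF that] s by auto
      ultimately show thesis using that by blast
    qed
    show "\<exists>d>0. \<forall>s'\<in>{0..L} - X. dist s' s < d \<longrightarrow> dist (h s') (h s) < e"
    proof (intro exI[of _ r] conjI ballI impI r(1))
      fix s' assume s': "s' \<in> {0..L} - X" "dist s' s < r"
      have "dist (G s') (G s) \<le> dist s' s"
        using lipschitz[of s' s] s s' by (auto simp: dist_norm)
      then have "G s' \<in> ball (G s) r" using s' by (simp add: dist_commute)
      then have "\<forall>\<^sub>F z in at (G s') within D. z \<in> ball (G s) r"
        by (intro topological_tendstoD[OF tendsto_ident_at]) auto
      moreover have "\<forall>\<^sub>F z in at (G s') within D. z \<in> D"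
        by (simp add: eventually_at_filter)
      ultimately have "\<forall>\<^sub>F z in at (G s') within D. dist (h s) (g z) \<le> e / 2"
        by eventually_elim (use r(2) in \<open>auto simp: dist_commute less_imp_le\<close>)
      then have "dist (h s) (h s') \<le> e / 2"
        using s'(1) by (intro Lim_dist_ubound[OF boundary_point_not_isolated lim[OF s'(1)]]) auto
      then show "dist (h s') (h s) < e" using e by (simp add: dist_commute)
    qed
  qed
  moreover have S: "{0..L} - X \<in> sets lebesgue"
    using negligible_imp_sets[OF negligible_finite[OF assms(1)]] by (intro sets.Diff) auto
  ultimately have "h \<in> borel_measurable (lebesgue_on ({0..L} - X))"
    by (rule continuous_imp_measurable_on_sets_lebesgue)
  then have "(\<lambda>s. if s \<in> {0..L} - X then h s else 0) \<in> borel_measurable lebesgue"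
    using borel_measurable_if[OF S, of h] by simp
  then show ?thesis by (rule measurable_restrict_space1)
qed

text \<open>
  The function \<open>g\<close> reaches the data \<open>ph\<close> up to the exact remainder \<open>ph'\<close>, which is at most \<open>\<eta>\<close> off the
  exceptional set \<open>F\<close>. The limits exist also at the points of \<open>F\<close>, up to the finite set \<open>X\<close>, so that
  later steps can start from \<open>ph'\<close> there too. The last condition gives locally uniform convergence in
  \<open>D\<close> when the steps are added up.
\<close>

definition corrects where
  "corrects nu e M K \<eta> ph g ph' X F \<longleftrightarrow>
     g holomorphic_on D \<and> ph' \<in> borel_measurable (lebesgue_on {0..L}) \<and> finite X \<and>
     F \<in> lmeasurable \<and> measure lebesgue F \<le> e \<and>
     (\<forall>s\<in>{0..L} - X. ((\<lambda>z. Re (nu s * g z)) \<longlongrightarrow> ph s - ph' s) (at (G s) within D)) \<and>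
     (\<forall>s\<in>{0..L} - F. \<bar>ph' s\<bar> \<le> \<eta>) \<and>
     (\<forall>s\<in>{0..L} - F. \<forall>z\<in>D. dist z (G s) \<le> M * infdist z (frontier D) \<longrightarrow>
        norm (g z) \<le> K * (\<bar>ph s\<bar> + \<eta>)) \<and>
     (\<forall>z\<in>D. \<eta> \<le> infdist z (frontier D) \<longrightarrow> norm (g z) \<le> \<eta>)"

text \<open>
  Approximate \<open>ph\<close> times the conjugate of \<open>nu\<close> by a continuous function \<open>f\<close>. Then the product of
  \<open>nu\<close> and \<open>f (1 + \<i> y)\<close> has a real part close to \<open>ph\<close>, whatever the bounded real number \<open>y\<close> is.
\<close>

lemma correction_step:
  fixes nu :: "real \<Rightarrow> complex"
  assumes nu: "nu \<in> borel_measurable (lebesgue_on {0..L})" "\<And>s. s \<in> {0..L} \<Longrightarrow> norm (nu s) = 1"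
    and "e > 0" "M > 0"
  obtains K where "K \<ge> 1"
    "\<And>\<eta> ph. \<eta> > 0 \<Longrightarrow> ph \<in> borel_measurable (lebesgue_on {0..L}) \<Longrightarrow>
      \<exists>g ph' X F. corrects nu e M K \<eta> ph g ph' X F"
proof -
  obtain K where K: "K \<ge> 1" and approx: "\<And>\<eta> f. \<eta> > 0 \<Longrightarrow> continuous_on {0..L} f \<Longrightarrow>
      \<exists>g h X F. approximates (e / 2) M K \<eta> f g h X F"
    by (rule approximate_boundary_data[OF half_gt_zero[OF assms(3)] assms(4)]) blast
  show thesis
  proof (rule that[OF K])
    fix \<eta> :: real and ph :: "real \<Rightarrow> real"
    assume \<eta>: "\<eta> > 0" and ph: "ph \<in> borel_measurable (lebesgue_on {0..L})"
    define \<epsilon> where "\<epsilon> = \<eta> / (3 * K)"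
    have \<epsilon>: "\<epsilon> > 0" "3 * K * \<epsilon> = \<eta>" using \<eta> K by (simp_all add: \<epsilon>_def)
    have \<epsilon>K: "\<epsilon> \<le> K * \<epsilon>" using \<epsilon> K by simp
    have \<epsilon>3: "3 * \<epsilon> \<le> \<eta>" using \<epsilon>K \<epsilon>(2) by (simp only: mult.assoc)
    have [measurable]: "nu \<in> borel_measurable (lebesgue_on {0..L})" "ph \<in> borel_measurable (lebesgue_on {0..L})"
      by fact+
    have "(\<lambda>s. cnj (nu s)) \<in> borel_measurable (lebesgue_on {0..L})"
      by (rule measurable_compose[OF nu(1)]) (intro borel_measurable_continuous_onI continuous_intros)
    moreover have "(\<lambda>s. complex_of_real (ph s)) \<in> borel_measurable (lebesgue_on {0..L})"
      by (rule measurable_compose[OF ph]) (intro borel_measurable_continuous_onI continuous_intros)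
    ultimately have "(\<lambda>s. of_real (ph s) * cnj (nu s)) \<in> borel_measurable (lebesgue_on {0..L})"
      by (rule borel_measurable_times[rotated])
    then obtain f F1 where f: "continuous_on {0..L} f" and F1: "F1 \<in> lmeasurable" "measure lebesgue F1 \<le> e / 2"
      and f_near: "\<And>s. s \<in> {0..L} - F1 \<Longrightarrow> norm (f s - of_real (ph s) * cnj (nu s)) \<le> \<epsilon>"
      using continuous_off_small_set[of "\<lambda>s. of_real (ph s) * cnj (nu s)" L "e / 2" \<epsilon>] assms(3) \<epsilon>(1) by auto
    from approx[OF \<epsilon>(1) f] obtain g h X F2 where all: "approximates (e / 2) M K \<epsilon> f g h X F2"
      by blast
    have g: "g holomorphic_on D" "finite X" "F2 \<in> lmeasurable" "measure lebesgue F2 \<le> e / 2"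
      and lim: "\<And>s. s \<in> {0..L} - X \<Longrightarrow> (g \<longlongrightarrow> h s) (at (G s) within D)"
      and near: "\<And>s. s \<in> {0..L} - F2 \<Longrightarrow> \<exists>y. \<bar>y\<bar> \<le> K \<and> norm (h s - f s * (1 + \<i> * of_real y)) \<le> \<epsilon>"
      and nt: "\<And>s z. s \<in> {0..L} - F2 \<Longrightarrow> z \<in> D \<Longrightarrow> dist z (G s) \<le> M * infdist z (frontier D) \<Longrightarrow> norm (g z) \<le> K * (norm (f s) + \<epsilon>)"
      and far: "\<And>z. z \<in> D \<Longrightarrow> \<epsilon> \<le> infdist z (frontier D) \<Longrightarrow> norm (g z) \<le> \<epsilon>"
      using all unfolding approximates_def by blast+
    define h' where "h' = (\<lambda>s. if s \<in> {0..L} - X then h s else 0)"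
    define ph' where "ph' = (\<lambda>s. ph s - Re (nu s * h' s))"
    have [measurable]: "h' \<in> borel_measurable (lebesgue_on {0..L})"
      unfolding h'_def by (rule boundary_limit_measurable[OF g(2) lim])
    have ph'_meas: "ph' \<in> borel_measurable (lebesgue_on {0..L})"
      unfolding ph'_def by measurable
    have X: "X \<in> lmeasurable" "measure lebesgue X = 0"
      using negligible_finite[OF g(2)] by (auto simp: negligible_iff_measure)
    define F where "F = (F1 \<union> F2) \<union> X"
    have F: "F \<in> lmeasurable" "measure lebesgue F \<le> e"
    proof -
      show "F \<in> lmeasurable" unfolding F_def using F1(1) g(3) X(1) by (intro fmeasurable.Un)
      have sets: "F1 \<in> sets lebesgue" "F2 \<in> sets lebesgue" "X \<in> sets lebesgue"
        using F1(1) g(3) X(1) by (simp_all only: fmeasurableD)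
      have "measure lebesgue F \<le> measure lebesgue (F1 \<union> F2) + measure lebesgue X"
        unfolding F_def using sets by (intro measure_Un_le sets.Un)
      also have "\<dots> \<le> (measure lebesgue F1 + measure lebesgue F2) + 0"
        using sets X by (intro add_mono measure_Un_le) auto
      finally show "measure lebesgue F \<le> e" using F1(2) g(4) by linarith
    qed
    have nunu: "nu s * cnj (nu s) = 1" if "s \<in> {0..L}" for s
      using nu(2)[OF that] by (simp add: complex_norm_square[symmetric])
    have rest: "\<bar>ph' s\<bar> \<le> \<eta>" and bound: "norm (f s) \<le> \<bar>ph s\<bar> + \<epsilon>" if s: "s \<in> {0..L} - F" for s
    proof -
      have sL: "s \<in> {0..L}" and s1: "s \<in> {0..L} - F1" and s2: "s \<in> {0..L} - F2" and sX: "s \<in> {0..L} - X"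
        using s by (auto simp: F_def)
      obtain y where y: "\<bar>y\<bar> \<le> K" "norm (h s - f s * (1 + \<i> * of_real y)) \<le> \<epsilon>"
        using near[OF s2] by blast
      define w where "w = f s - of_real (ph s) * cnj (nu s)"
      define v where "v = h s - f s * (1 + \<i> * of_real y)"
      have "norm (of_real (ph s) * cnj (nu s)) = \<bar>ph s\<bar>" using nu(2)[OF sL] by (simp add: norm_mult)
      then show "norm (f s) \<le> \<bar>ph s\<bar> + \<epsilon>"
        using norm_triangle_sub[of "f s" "of_real (ph s) * cnj (nu s)"] f_near[OF s1] by linarith
      have "nu s * h s = (nu s * cnj (nu s)) * of_real (ph s) * (1 + \<i> * of_real y)
          + nu s * w * (1 + \<i> * of_real y) + nu s * v"
        by (simp add: w_def v_def algebra_simps)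
      then have eq: "nu s * h s = of_real (ph s) * (1 + \<i> * of_real y) + (nu s * w * (1 + \<i> * of_real y) + nu s * v)"
        using nunu[OF sL] by simp
      have "Re (of_real (ph s) * (1 + \<i> * of_real y)) = ph s" by simp
      then have "Re (nu s * h s) = ph s + Re (nu s * w * (1 + \<i> * of_real y) + nu s * v)"
        unfolding eq by (simp only: plus_complex.simps)
      moreover have "h' s = h s" using sX by (simp add: h'_def)
      ultimately have "ph' s = - Re (nu s * w * (1 + \<i> * of_real y) + nu s * v)"
      proof -
        have "b - a = - c" if "a = b + c" for a b c :: real using that by simp
        then show ?thesis
          unfolding ph'_def \<open>h' s = h s\<close> using \<open>Re (nu s * h s) = _\<close> by blast
      qed
      then have "\<bar>ph' s\<bar> \<le> norm (nu s * w * (1 + \<i> * of_real y) + nu s * v)"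
        using abs_Re_le_cmod[of "nu s * w * (1 + \<i> * of_real y) + nu s * v"] by linarith
      also have "\<dots> \<le> norm (nu s) * norm w * norm (1 + \<i> * of_real y :: complex) + norm (nu s) * norm v"
        unfolding norm_mult[symmetric] by (rule norm_triangle_ineq)
      also have "\<dots> \<le> 1 * \<epsilon> * (2 * K) + 1 * \<epsilon>"
      proof (intro add_mono mult_mono)
        have "norm (1 + \<i> * of_real y :: complex) \<le> norm (1 :: complex) + norm (\<i> * of_real y :: complex)"
          by (rule norm_triangle_ineq)
        then show "norm (1 + \<i> * of_real y :: complex) \<le> 2 * K" using y(1) K by (simp add: norm_mult)
        show "norm w \<le> \<epsilon>" unfolding w_def by (rule f_near[OF s1])
        show "norm v \<le> \<epsilon>" unfolding v_def by (rule y(2))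
      qed (use nu(2)[OF sL] \<epsilon> K in auto)
      also have "\<dots> = 2 * (K * \<epsilon>) + \<epsilon>" by simp
      also have "\<dots> \<le> 3 * (K * \<epsilon>)" using \<epsilon>K by linarith
      also have "\<dots> = \<eta>" using \<epsilon>(2) by (simp only: mult.assoc)
      finally show "\<bar>ph' s\<bar> \<le> \<eta>" .
    qed
    have lim': "((\<lambda>z. Re (nu s * g z)) \<longlongrightarrow> ph s - ph' s) (at (G s) within D)"
      if s: "s \<in> {0..L} - X" for s
    proof -
      have "((\<lambda>z. Re (nu s * g z)) \<longlongrightarrow> Re (nu s * h s)) (at (G s) within D)"
        by (intro tendsto_intros lim[OF s])
      then show ?thesis
        using s by (simp add: ph'_def h'_def)
    qed
    have nt': "norm (g z) \<le> K * (\<bar>ph s\<bar> + \<eta>)"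
      if s: "s \<in> {0..L} - F" and z: "z \<in> D" "dist z (G s) \<le> M * infdist z (frontier D)" for s z
    proof -
      have "norm (g z) \<le> K * (norm (f s) + \<epsilon>)" using nt[OF _ z] s by (auto simp: F_def)
      also have "\<dots> \<le> K * (\<bar>ph s\<bar> + \<eta>)"
        using bound[OF s] K \<epsilon>(1) \<epsilon>3 by (intro mult_left_mono) linarith+
      finally show ?thesis .
    qed
    have far': "norm (g z) \<le> \<eta>" if z: "z \<in> D" "\<eta> \<le> infdist z (frontier D)" for z
    proof -
      have "\<epsilon> \<le> \<eta>" using \<epsilon>(1) \<epsilon>3 by linarith
      then show "norm (g z) \<le> \<eta>" using far[of z] z by linarith
    qed
    have "corrects nu e M K \<eta> ph g ph' X F"
      unfolding corrects_def using g(1,2) ph'_meas F lim' rest nt' far' by blast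
    then show "\<exists>g ph' X F. corrects nu e M K \<eta> ph g ph' X F" by blast
  qed
qed

end

context arclength_Jordan_curve
begin

text \<open>
  The constants \<open>K n\<close> belong to the measures \<open>(1 / 2) ^ n\<close> and the apertures \<open>n + 1\<close>, and so are known in
  advance. The precision \<open>(1 / 2) ^ n / (K n * K (Suc n))\<close> makes the remainder of the \<open>n\<close>-th step so
  small that the next correction is nontangentially bounded by a multiple of \<open>(1 / 2) ^ n\<close>.
\<close>

lemma boundary_correction_sequence:
  fixes nu :: "real \<Rightarrow> complex" and \<phi> :: "real \<Rightarrow> real"
  assumes nu: "nu \<in> borel_measurable (lebesgue_on {0..L})" "\<And>s. s \<in> {0..L} \<Longrightarrow> norm (nu s) = 1"
    and \<phi>: "\<phi> \<in> borel_measurable (lebesgue_on {0..L})"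
  obtains g :: "nat \<Rightarrow> complex \<Rightarrow> complex" and ph :: "nat \<Rightarrow> real \<Rightarrow> real" and X F :: "nat \<Rightarrow> real set"
  where "\<And>n. g n holomorphic_on D" "ph 0 = \<phi>" "\<And>n. finite (X n)" "\<And>n. F n \<in> lmeasurable"
    "\<And>n. measure lebesgue (F n) \<le> (1 / 2) ^ n"
    "\<And>n s. s \<in> {0..L} - X n \<Longrightarrow> ((\<lambda>z. Re (nu s * g n z)) \<longlongrightarrow> ph n s - ph (Suc n) s) (at (G s) within D)"
    "\<And>n s. s \<in> {0..L} - F n \<Longrightarrow> \<bar>ph (Suc n) s\<bar> \<le> (1 / 2) ^ n"
    "\<And>n s z. s \<in> {0..L} - (F n \<union> F (Suc n)) \<Longrightarrow> z \<in> D \<Longrightarrow>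
       dist z (G s) \<le> real (Suc n) * infdist z (frontier D) \<Longrightarrow> norm (g (Suc n) z) \<le> 2 * (1 / 2) ^ n"
    "\<And>n z. z \<in> D \<Longrightarrow> (1 / 2) ^ n \<le> infdist z (frontier D) \<Longrightarrow> norm (g n z) \<le> (1 / 2) ^ n"
proof -
  define M where "M = lebesgue_on {0..L}"
  define step where "step = (\<lambda>n. corrects nu ((1 / 2) ^ n) (real (Suc n)))"
  have "\<exists>K\<ge>1. \<forall>\<eta> ph. \<eta> > 0 \<longrightarrow> ph \<in> borel_measurable M \<longrightarrow> (\<exists>g ph' X F. step n K \<eta> ph g ph' X F)" for n :: nat
    unfolding step_def M_def
    by (rule correction_step[OF nu, of "(1 / 2) ^ n" "real (Suc n)"]) (assumption, simp, simp, blast)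
  then obtain K where K: "\<And>n::nat. K n \<ge> (1::real)"
    and ex: "\<And>n \<eta> ph. \<eta> > 0 \<Longrightarrow> ph \<in> borel_measurable M \<Longrightarrow> \<exists>g ph' X F. step n (K n) \<eta> ph g ph' X F"
    by metis
  define \<eta> where "\<eta> = (\<lambda>n. (1 / 2) ^ n / (K n * K (Suc n)))"
  have \<eta>: "\<eta> n > 0" "\<eta> n \<le> (1 / 2) ^ n" "K n * \<eta> n \<le> (1 / 2) ^ n" "K (Suc n) * \<eta> n \<le> (1 / 2) ^ n" for n
  proof -
    have K0: "K n > 0" "K (Suc n) > 0" using K[of n] K[of "Suc n"] by linarith+
    have K1: "1 \<le> K n * K (Suc n)" using mult_mono[OF K[of n] K[of "Suc n"]] K0 by simp
    show "\<eta> n > 0" using K0 by (simp add: \<eta>_def)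
    have "(1 / 2) ^ n / (K n * K (Suc n)) \<le> (1 / 2) ^ n / (1::real)"
      by (intro divide_left_mono K1) (use K0 in auto)
    then show "\<eta> n \<le> (1 / 2) ^ n" by (simp add: \<eta>_def)
    have "K n * \<eta> n = (1 / 2) ^ n / K (Suc n)" using K0 by (simp add: \<eta>_def)
    also have "\<dots> \<le> (1 / 2) ^ n / (1::real)" by (intro divide_left_mono K) (use K0 in auto)
    finally show "K n * \<eta> n \<le> (1 / 2) ^ n" by simp
    have "K (Suc n) * \<eta> n = (1 / 2) ^ n / K n" using K0 by (simp add: \<eta>_def)
    also have "\<dots> \<le> (1 / 2) ^ n / (1::real)" by (intro divide_left_mono K) (use K0 in auto)
    finally show "K (Suc n) * \<eta> n \<le> (1 / 2) ^ n" by simp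
  qed
  define stepP where "stepP = (\<lambda>n ph p. step n (K n) (\<eta> n) ph (fst p) (fst (snd p)) (fst (snd (snd p))) (snd (snd (snd p))))"
  define ch where "ch = (\<lambda>n ph. SOME p. stepP n ph p)"
  have ch: "stepP n ph (ch n ph)" if "ph \<in> borel_measurable M" for n ph
  proof -
    from ex[OF \<eta>(1) that] obtain g ph' X F where "step n (K n) (\<eta> n) ph g ph' X F" by blast
    then have "stepP n ph (g, ph', X, F)" by (simp add: stepP_def)
    then show ?thesis unfolding ch_def by (rule someI)
  qed
  define ph where "ph = rec_nat \<phi> (\<lambda>n p. fst (snd (ch n p)))"
  have ph0: "ph 0 = \<phi>" and phS: "ph (Suc n) = fst (snd (ch n (ph n)))" for n
    by (simp_all add: ph_def)
  have ph_meas: "ph n \<in> borel_measurable M" for n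
  proof (induction n)
    case 0
    then show ?case using \<phi> by (simp add: ph0 M_def)
  next
    case (Suc n)
    then show ?case using ch[OF Suc, of n] unfolding stepP_def step_def corrects_def phS M_def by blast
  qed
  define g where "g = (\<lambda>n. fst (ch n (ph n)))"
  define X where "X = (\<lambda>n. fst (snd (snd (ch n (ph n)))))"
  define F where "F = (\<lambda>n. snd (snd (snd (ch n (ph n)))))"
  have st: "step n (K n) (\<eta> n) (ph n) (g n) (ph (Suc n)) (X n) (F n)" for n
    using ch[OF ph_meas, of n n] unfolding stepP_def g_def X_def F_def phS .
  have small: "\<bar>ph (Suc n) s\<bar> \<le> \<eta> n" if "s \<in> {0..L} - F n" for n s
    using st[of n] that unfolding step_def corrects_def by blast
  show thesis
  proof (rule that[of g ph X F])
    show "g n holomorphic_on D" "finite (X n)" "F n \<in> lmeasurable" "measure lebesgue (F n) \<le> (1 / 2) ^ n" for n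
      using st[of n] unfolding step_def corrects_def by blast+
    show "ph 0 = \<phi>" by (rule ph0)
    show "((\<lambda>z. Re (nu s * g n z)) \<longlongrightarrow> ph n s - ph (Suc n) s) (at (G s) within D)"
      if "s \<in> {0..L} - X n" for n s
      using st[of n] that unfolding step_def corrects_def by blast
    show "\<bar>ph (Suc n) s\<bar> \<le> (1 / 2) ^ n" if "s \<in> {0..L} - F n" for n s
      using small[OF that] \<eta>(2)[of n] by linarith
    show "norm (g (Suc n) z) \<le> 2 * (1 / 2) ^ n"
      if s: "s \<in> {0..L} - (F n \<union> F (Suc n))" and z: "z \<in> D"
        "dist z (G s) \<le> real (Suc n) * infdist z (frontier D)" for n s z
    proof -
      have "dist z (G s) \<le> real (Suc (Suc n)) * infdist z (frontier D)"
        using z(2) infdist_nonneg[of z "frontier D"] by (simp add: algebra_simps)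
      then have "norm (g (Suc n) z) \<le> K (Suc n) * (\<bar>ph (Suc n) s\<bar> + \<eta> (Suc n))"
        using st[of "Suc n"] s z(1) unfolding step_def corrects_def by blast
      also have "\<dots> \<le> K (Suc n) * (\<eta> n + \<eta> (Suc n))"
        using small[of s n] s K[of "Suc n"] by (intro mult_left_mono add_right_mono) auto
      also have "\<dots> \<le> (1 / 2) ^ n + (1 / 2) ^ Suc n"
        using \<eta>(4)[of n] \<eta>(3)[of "Suc n"] by (simp add: distrib_left)
      also have "\<dots> \<le> 2 * (1 / 2) ^ n" by simp
      finally show ?thesis .
    qed
    show "norm (g n z) \<le> (1 / 2) ^ n" if z: "z \<in> D" "(1 / 2) ^ n \<le> infdist z (frontier D)" for n z
    proof -
      have "\<eta> n \<le> infdist z (frontier D)" using \<eta>(2)[of n] z(2) by linarith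
      then have "norm (g n z) \<le> \<eta> n" using st[of n] z(1) unfolding step_def corrects_def by blast
      then show ?thesis using \<eta>(2)[of n] by linarith
    qed
  qed
qed

text \<open>
  At a point outside all but finitely many exceptional sets, the first terms of the series have
  boundary values that add up to \<open>\<phi>\<close> minus a small remainder, and the tail is uniformly small in
  approach regions. An approach region of any aperture is eventually covered by those of the steps.
\<close>

theorem boundary_values_of_rotated_real_part:
  fixes nu :: "real \<Rightarrow> complex" and \<phi> :: "real \<Rightarrow> real"
  assumes nu: "nu \<in> borel_measurable (lebesgue_on {0..L})" "\<And>s. s \<in> {0..L} \<Longrightarrow> norm (nu s) = 1"
    and \<phi>: "\<phi> \<in> borel_measurable (lebesgue_on {0..L})"
  obtains g where "g holomorphic_on D"
    "AE s in lebesgue_on {0..L}. \<forall>p. nontangential_path D (G s) p \<longrightarrow>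
       ((\<lambda>t. Re (nu s * g (p t))) \<longlongrightarrow> \<phi> s) (at_left 1)"
proof (rule boundary_correction_sequence[OF nu \<phi>])
  fix g :: "nat \<Rightarrow> complex \<Rightarrow> complex" and ph :: "nat \<Rightarrow> real \<Rightarrow> real" and X F :: "nat \<Rightarrow> real set"
  assume hol: "\<And>n. g n holomorphic_on D" and ph0: "ph 0 = \<phi>"
    and X: "\<And>n. finite (X n)" and F: "\<And>n. F n \<in> lmeasurable" "\<And>n. measure lebesgue (F n) \<le> (1 / 2) ^ n"
    and lim: "\<And>n s. s \<in> {0..L} - X n \<Longrightarrow> ((\<lambda>z. Re (nu s * g n z)) \<longlongrightarrow> ph n s - ph (Suc n) s) (at (G s) within D)"
    and small: "\<And>n s. s \<in> {0..L} - F n \<Longrightarrow> \<bar>ph (Suc n) s\<bar> \<le> (1 / 2) ^ n"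
    and nt: "\<And>n s z. s \<in> {0..L} - (F n \<union> F (Suc n)) \<Longrightarrow> z \<in> D \<Longrightarrow>
       dist z (G s) \<le> real (Suc n) * infdist z (frontier D) \<Longrightarrow> norm (g (Suc n) z) \<le> 2 * (1 / 2) ^ n"
    and far: "\<And>n z. z \<in> D \<Longrightarrow> (1 / 2) ^ n \<le> infdist z (frontier D) \<Longrightarrow> norm (g n z) \<le> (1 / 2) ^ n"
  define S where "S = (\<lambda>z. \<Sum>n. g n z)"
  have fr: "frontier D \<noteq> {}" using frontier_D L_pos by auto
  have away: "eventually (\<lambda>n. (1 / 2) ^ n \<le> \<rho>) sequentially" if "\<rho> > 0" for \<rho> :: real
    using order_tendstoD(2)[OF LIMSEQ_power_zero[of "1 / 2 :: real"] that]
    by (auto elim!: eventually_mono)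
  have inf_pos: "infdist z (frontier D) > 0" if "z \<in> D" for z
  proof -
    have "z \<notin> frontier D" using D_disjoint[OF that] frontier_D by simp
    then show ?thesis using infdist_pos_not_in_closed[OF frontier_closed fr] by blast
  qed
  have summ: "summable (\<lambda>n. g n z)" if z: "z \<in> D" for z
  proof (rule summable_comparison_test_ev)
    show "eventually (\<lambda>n. norm (g n z) \<le> (1 / 2) ^ n) sequentially"
      using away[OF inf_pos[OF z]] by eventually_elim (rule far[OF z])
    show "summable (\<lambda>n. (1 / 2 :: real) ^ n)" by (rule summable_geometric) simp
  qed
  have S_hol: "S holomorphic_on D"
  proof (rule holomorphic_uniform_sequence[OF D_open, where f = "\<lambda>n z. \<Sum>i<n. g i z"])
    show "(\<lambda>z. \<Sum>i<n. g i z) holomorphic_on D" for n by (intro holomorphic_intros hol)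
    fix z assume z: "z \<in> D"
    obtain r where r: "r > 0" "cball z r \<subseteq> D" using D_open z open_contains_cball by blast
    have inf_ge: "r / 2 \<le> infdist w (frontier D)" if w: "w \<in> cball z (r / 2)" for w
    proof -
      have "r / 2 \<le> dist w a" if a: "a \<in> frontier D" for a
      proof -
        have "a \<notin> D" using a D_disjoint unfolding frontier_D by blast
        then have "a \<notin> cball z r" using r(2) by blast
        then show ?thesis using w dist_triangle[of z a w] by (auto simp: dist_commute)
      qed
      then show ?thesis unfolding infdist_notempty[OF fr] by (intro cINF_greatest[OF fr])
    qed
    show "\<exists>d>0. cball z d \<subseteq> D \<and> uniform_limit (cball z d) (\<lambda>n z. \<Sum>i<n. g i z) S sequentially"
    proof (intro exI[of _ "r / 2"] conjI)
      show sub: "cball z (r / 2) \<subseteq> D" using r by (auto intro: order_trans[OF subset_cball])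
      show "uniform_limit (cball z (r / 2)) (\<lambda>n z. \<Sum>i<n. g i z) S sequentially"
        unfolding S_def
      proof (rule Weierstrass_m_test_ev)
        have "eventually (\<lambda>n. (1 / 2) ^ n \<le> r / 2) sequentially" using r by (intro away) auto
        then show "eventually (\<lambda>n. \<forall>w\<in>cball z (r / 2). norm (g n w) \<le> (1 / 2) ^ n) sequentially"
          by eventually_elim (use inf_ge sub far in \<open>blast intro: order_trans\<close>)
        show "summable (\<lambda>n. (1 / 2 :: real) ^ n)" by (rule summable_geometric) simp
      qed
    qed (use r in auto)
  qed
  define M where "M = lebesgue_on {0..L}"
  have good_limit: "((\<lambda>t. Re (nu s * S (p t))) \<longlongrightarrow> \<phi> s) (at_left 1)"
    if s: "s \<in> {0..L}" and sX: "\<And>n. s \<notin> X n" and sF: "\<And>n. n \<ge> n0 \<Longrightarrow> s \<notin> F n"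
      and p: "nontangential_path D (G s) p" for s n0 p
  proof (rule tendstoI)
    fix e :: real assume e: "e > 0"
    obtain m where ev_nt: "\<forall>\<^sub>F t in at_left 1. dist (p t) (G s) \<le> m * infdist (p t) (frontier D)"
      using p unfolding nontangential_path_def by blast
    have ev_D: "\<forall>\<^sub>F t in at_left 1. p t \<in> D"
    proof -
      have "\<forall>\<^sub>F t in at_left (1::real). t \<in> {0<..<1}"
        by (rule eventually_at_left_real) simp
      then show ?thesis
        by eventually_elim (use p in \<open>auto simp: nontangential_path_def\<close>)
    qed
    have p_lim: "(p \<longlongrightarrow> G s) (at_left 1)"
    proof -
      have "continuous_on {0..1} p" "p 1 = G s"
        using p by (auto simp: nontangential_path_def path_def pathfinish_def)
      then have "(p \<longlongrightarrow> G s) (at 1 within {0..1})"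
        unfolding continuous_on_def by (metis atLeastAtMost_iff order_refl zero_le_one)
      then show ?thesis by (simp add: at_within_Icc_at_left)
    qed
    have p_lim_D: "filterlim p (at (G s) within D) (at_left 1)"
      unfolding filterlim_at
    proof (intro conjI p_lim)
      show "\<forall>\<^sub>F t in at_left 1. p t \<in> D \<and> p t \<noteq> G s"
        using ev_D by eventually_elim (use D_disjoint s in blast)
    qed
    obtain N :: nat where N: "N \<ge> n0" "real N \<ge> m" "5 * (1 / 2) ^ N < e / 2"
    proof -
      have "(\<lambda>n. 5 * (1 / 2) ^ n) \<longlonglongrightarrow> 5 * (0::real)"
        by (intro tendsto_mult_left LIMSEQ_power_zero) simp
      then have "\<forall>\<^sub>F n in sequentially. 5 * (1 / 2) ^ n < e / 2"
        by (rule order_tendstoD) (use e in simp)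
      moreover have "\<forall>\<^sub>F n in sequentially. n \<ge> n0" by (rule eventually_ge_at_top)
      moreover have "\<forall>\<^sub>F n in sequentially. real n \<ge> m" 
        using filterlim_real_sequentially by (simp add: filterlim_at_top)
      ultimately have "\<forall>\<^sub>F n in sequentially. n \<ge> n0 \<and> real n \<ge> m \<and> 5 * (1 / 2) ^ n < e / 2"
        by eventually_elim auto
      then show thesis using that eventually_happens'[OF sequentially_bot] by blast
    qed
    have head: "((\<lambda>t. \<Sum>n<Suc N. Re (nu s * g n (p t))) \<longlongrightarrow> (\<Sum>n<Suc N. ph n s - ph (Suc n) s)) (at_left 1)"
      using s sX by (intro tendsto_sum filterlim_compose[OF lim p_lim_D]) auto
    have head_sum: "(\<Sum>n<Suc N. ph n s - ph (Suc n) s) = \<phi> s - ph (Suc N) s"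
      by (subst sum_lessThan_telescope') (simp add: ph0)
    have rest: "\<bar>ph (Suc N) s\<bar> \<le> (1 / 2) ^ N" using small[of s N] s sF[OF N(1)] by auto
    have tail: "norm (\<Sum>n. g (n + Suc N) z) \<le> 4 * (1 / 2) ^ N"
      if z: "z \<in> D" "dist z (G s) \<le> m * infdist z (frontier D)" for z
    proof -
      have b: "norm (g (n + Suc N) z) \<le> 2 * (1 / 2) ^ N * (1 / 2) ^ n" for n
      proof -
        have "m * infdist z (frontier D) \<le> real (Suc (n + N)) * infdist z (frontier D)"
          using N(2) by (intro mult_right_mono infdist_nonneg) auto
        then have "norm (g (Suc (n + N)) z) \<le> 2 * (1 / 2) ^ (n + N)"
          using nt[of s "n + N" z] s sF[of "n + N"] sF[of "Suc (n + N)"] N(1) z by auto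
        then show ?thesis by (simp add: power_add mult_ac)
      qed
      have sm: "summable (\<lambda>n. 2 * (1 / 2) ^ N * (1 / 2 :: real) ^ n)"
        by (intro summable_mult summable_geometric) simp
      have "norm (\<Sum>n. g (n + Suc N) z) \<le> (\<Sum>n. 2 * (1 / 2) ^ N * (1 / 2 :: real) ^ n)"
        by (rule norm_suminf_le[OF b sm])
      also have "\<dots> = 2 * (1 / 2) ^ N * (\<Sum>n. (1 / 2 :: real) ^ n)"
        by (rule suminf_mult) (simp add: summable_geometric)
      also have "(\<Sum>n. (1 / 2 :: real) ^ n) = 2" by (subst suminf_geometric) auto
      finally show ?thesis by simp
    qed
    have "\<forall>\<^sub>F t in at_left 1. dist (\<Sum>n<Suc N. Re (nu s * g n (p t))) (\<phi> s - ph (Suc N) s) < e / 2"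
      using tendstoD[OF head, of "e / 2"] e unfolding head_sum by simp
    then show "\<forall>\<^sub>F t in at_left 1. dist (Re (nu s * S (p t))) (\<phi> s) < e"
      using ev_D ev_nt
    proof eventually_elim
      case (elim t)
      define T where "T = (\<Sum>n. g (n + Suc N) (p t))"
      have "S (p t) = T + (\<Sum>n<Suc N. g n (p t))"
        unfolding S_def T_def by (rule suminf_split_initial_segment[OF summ[OF elim(2)]])
      then have "Re (nu s * S (p t)) = Re (nu s * T) + (\<Sum>n<Suc N. Re (nu s * g n (p t)))"
        by (simp only: distrib_left sum_distrib_left plus_complex.simps Re_sum)
      moreover have "\<bar>Re (nu s * T)\<bar> \<le> 4 * (1 / 2) ^ N"
      proof -
        have "\<bar>Re (nu s * T)\<bar> \<le> norm (nu s * T)" by (rule abs_Re_le_cmod)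
        also have "\<dots> = norm T" using nu(2)[OF s] by (simp only: norm_mult mult_1_left)
        also have "\<dots> \<le> 4 * (1 / 2) ^ N" unfolding T_def by (rule tail[OF elim(2,3)])
        finally show ?thesis .
      qed
      moreover have "\<bar>a + b - f\<bar> < e"
        if "\<bar>a\<bar> \<le> 4 * (1 / 2) ^ N" "\<bar>b - (f - r)\<bar> < e / 2" "\<bar>r\<bar> \<le> (1 / 2) ^ N" for a b f r :: real
        using that N(3) by linarith
      ultimately show ?case
        using elim(1) rest unfolding dist_real_def by metis
    qed
  qed
  show thesis
  proof (rule that[OF S_hol])
    have FM: "F n \<inter> {0..L} \<in> sets M" for n
      using F(1)[of n] unfolding M_def by (subst sets_restrict_space_iff) auto
    have FMm: "measure M (F n \<inter> {0..L}) \<le> (1 / 2) ^ n" and FMfin: "emeasure M (F n \<inter> {0..L}) < \<infinity>" for n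
    proof -
      have "measure M (F n \<inter> {0..L}) = measure lebesgue (F n \<inter> {0..L})"
        unfolding M_def by (intro measure_restrict_space) auto
      also have "\<dots> \<le> measure lebesgue (F n)"
        using F(1)[of n] by (intro measure_mono_fmeasurable) auto
      finally show "measure M (F n \<inter> {0..L}) \<le> (1 / 2) ^ n" using F(2)[of n] by linarith
      have "emeasure M (F n \<inter> {0..L}) \<le> emeasure M (space M)" by (rule emeasure_space)
      also have "\<dots> < \<infinity>" by (simp add: M_def space_restrict_space emeasure_restrict_space emeasure_lborel_Icc_eq)
      finally show "emeasure M (F n \<inter> {0..L}) < \<infinity>" .
    qed
    have "AE s in M. \<forall>\<^sub>F n in sequentially. s \<in> space M - (F n \<inter> {0..L})"
    proof (rule borel_cantelli_AE1[OF FM FMfin])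
      show "summable (\<lambda>n. measure M (F n \<inter> {0..L}))"
      proof (rule summable_comparison_test')
        show "summable (\<lambda>n. (1 / 2 :: real) ^ n)" by (rule summable_geometric) simp
        show "norm (measure M (F n \<inter> {0..L})) \<le> (1 / 2) ^ n" if "n \<ge> 0" for n using FMm[of n] by simp
      qed
    qed
    moreover have "AE s in M. s \<notin> (\<Union>n. X n)"
    proof -
      have "negligible (\<Union>n. X n)"
        by (rule negligible_countable_Union) (use X in \<open>auto intro: negligible_finite\<close>)
      then have "AE s in lebesgue. s \<notin> (\<Union>n. X n)"
        by (intro AE_not_in) (simp add: negligible_iff_null_sets)
      then show ?thesis unfolding M_def by (subst AE_restrict_space_iff) auto
    qed
    moreover have "AE s in M. s \<in> space M" by (rule AE_space)
    ultimately have "AE s in M. \<forall>p. nontangential_path D (G s) p \<longrightarrow>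
       ((\<lambda>t. Re (nu s * S (p t))) \<longlongrightarrow> \<phi> s) (at_left 1)"
    proof eventually_elim
      case (elim s)
      have s: "s \<in> {0..L}" using elim(3) by (simp add: M_def space_restrict_space)
      obtain n0 where "\<And>n. n \<ge> n0 \<Longrightarrow> s \<notin> F n"
        using elim(1) s unfolding eventually_sequentially by blast
      then show ?case using good_limit[OF s] elim(2) by blast
    qed
    then show "AE s in lebesgue_on {0..L}. \<forall>p. nontangential_path D (G s) p \<longrightarrow>
       ((\<lambda>t. Re (nu s * S (p t))) \<longlongrightarrow> \<phi> s) (at_left 1)"
      by (simp only: M_def)
  qed
qed

end

section \<open>Arc length as a parameter\<close>

lemma polygonal_lengthsI:
  "t 0 = a \<Longrightarrow> t n = b \<Longrightarrow> (\<And>i. i < n \<Longrightarrow> t i \<le> t (Suc i)) \<Longrightarrow>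
   (\<Sum>i<n. dist (\<gamma> (t i)) (\<gamma> (t (Suc i)))) \<in> polygonal_lengths \<gamma> a b"
  unfolding polygonal_lengths_def by blast

lemma dist_in_polygonal_lengths: "a \<le> b \<Longrightarrow> dist (\<gamma> a) (\<gamma> b) \<in> polygonal_lengths \<gamma> a b"
  using polygonal_lengthsI[of "\<lambda>i. if i = 0 then a else b" a 1 b \<gamma>] by simp

lemma polygonal_lengths_concat:
  assumes "x \<in> polygonal_lengths \<gamma> a b" "y \<in> polygonal_lengths \<gamma> b c"
  shows "x + y \<in> polygonal_lengths \<gamma> a c"
proof -
  obtain n t where t: "x = (\<Sum>i<n. dist (\<gamma> (t i)) (\<gamma> (t (Suc i))))" "t 0 = a" "t n = b"
      "\<forall>i<n. t i \<le> t (Suc i)"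
    using assms(1) unfolding polygonal_lengths_def by blast
  obtain m u where u: "y = (\<Sum>i<m. dist (\<gamma> (u i)) (\<gamma> (u (Suc i))))" "u 0 = b" "u m = c"
      "\<forall>i<m. u i \<le> u (Suc i)"
    using assms(2) unfolding polygonal_lengths_def by blast
  define v where "v = (\<lambda>i. if i < n then t i else u (i - n))"
  have v1: "v i = t i" if "i \<le> n" for i using that t u by (auto simp: v_def)
  have v2: "v (n + i) = u i" for i by (simp add: v_def)
  have "x + y = (\<Sum>i<n + m. dist (\<gamma> (v i)) (\<gamma> (v (Suc i))))"
  proof -
    have "(\<Sum>i<n + m. dist (\<gamma> (v i)) (\<gamma> (v (Suc i))))
        = (\<Sum>i<n. dist (\<gamma> (v i)) (\<gamma> (v (Suc i)))) + (\<Sum>i<m. dist (\<gamma> (v (n + i))) (\<gamma> (v (n + Suc i))))"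
      by (induction m) simp_all
    then show ?thesis unfolding t(1) u(1) v2 by (simp add: v1)
  qed
  also have "\<dots> \<in> polygonal_lengths \<gamma> a c"
  proof (rule polygonal_lengthsI)
    show "v 0 = a" using v1[of 0] t by simp
    show "v (n + m) = c" using v2 u by simp
    fix i assume i: "i < n + m"
    show "v i \<le> v (Suc i)"
    proof (cases "i < n")
      case True
      then show ?thesis using v1[of i] v1[of "Suc i"] t(4) by simp
    next
      case False
      then show ?thesis using v2[of "i - n"] v2[of "Suc i - n"] u(4) i by (simp add: Suc_diff_le)
    qed
  qed
  finally show ?thesis .
qed

text \<open>
  Inserting the point \<open>b\<close> into a polygon: clipping the parameters at \<open>b\<close> from above and from below gives
  polygons for the two parts of the curve.
\<close>

lemma polygon_split:
  fixes t :: "nat \<Rightarrow> real" and \<gamma> :: "real \<Rightarrow> complex"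
  assumes "\<And>i. i < n \<Longrightarrow> t i \<le> t (Suc i)"
  shows "(\<Sum>i<n. dist (\<gamma> (t i)) (\<gamma> (t (Suc i))))
     \<le> (\<Sum>i<n. dist (\<gamma> (min (t i) b)) (\<gamma> (min (t (Suc i)) b)))
       + (\<Sum>i<n. dist (\<gamma> (max (t i) b)) (\<gamma> (max (t (Suc i)) b)))"
  unfolding sum.distrib[symmetric]
proof (rule sum_mono)
  fix i assume "i \<in> {..<n}"
  then have "t i \<le> t (Suc i)" using assms by simp
  then consider "t (Suc i) \<le> b" | "b \<le> t i" | "t i < b" "b < t (Suc i)" by linarith
  then show "dist (\<gamma> (t i)) (\<gamma> (t (Suc i)))
      \<le> dist (\<gamma> (min (t i) b)) (\<gamma> (min (t (Suc i)) b)) + dist (\<gamma> (max (t i) b)) (\<gamma> (max (t (Suc i)) b))"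
    using \<open>t i \<le> t (Suc i)\<close> by cases (auto simp: min_def max_def dist_triangle)
qed

locale rectifiable_curve =
  fixes \<gamma> :: "real \<Rightarrow> complex"
  assumes rectifiable: "rectifiable_path \<gamma>"
begin

lemma cont: "continuous_on {0..1} \<gamma>"
  using rectifiable by (simp add: rectifiable_path_def path_def)

lemma bdd:
  assumes "0 \<le> a" "a \<le> b" "b \<le> 1"
  shows "bdd_above (polygonal_lengths \<gamma> a b)"
proof -
  obtain B where B: "\<And>x. x \<in> polygonal_lengths \<gamma> 0 1 \<Longrightarrow> x \<le> B"
    using rectifiable by (auto simp: rectifiable_path_def bdd_above_def)
  show ?thesis
  proof (rule bdd_aboveI)
    fix x assume "x \<in> polygonal_lengths \<gamma> a b"
    then have "dist (\<gamma> 0) (\<gamma> a) + x + dist (\<gamma> b) (\<gamma> 1) \<in> polygonal_lengths \<gamma> 0 1"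
      by (rule polygonal_lengths_concat[OF polygonal_lengths_concat[OF dist_in_polygonal_lengths]
            dist_in_polygonal_lengths, rotated]) (use assms in auto)
    from B[OF this] show "x \<le> B"
      using zero_le_dist[of "\<gamma> 0" "\<gamma> a"] zero_le_dist[of "\<gamma> b" "\<gamma> 1"] by linarith
  qed
qed

lemma le_arclength:
  assumes "0 \<le> a" "a \<le> b" "b \<le> 1" "x \<in> polygonal_lengths \<gamma> a b"
  shows "x \<le> arclength \<gamma> a b"
  unfolding arclength_def using assms bdd by (intro cSup_upper)

lemma dist_le_arclength: "0 \<le> a \<Longrightarrow> a \<le> b \<Longrightarrow> b \<le> 1 \<Longrightarrow> dist (\<gamma> a) (\<gamma> b) \<le> arclength \<gamma> a b"
  by (intro le_arclength dist_in_polygonal_lengths)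

lemma near_arclength:
  assumes "0 \<le> a" "a \<le> b" "b \<le> 1" "e > 0"
  obtains n t where "t 0 = a" "t n = b" "\<And>i. i < n \<Longrightarrow> t i \<le> t (Suc i)"
    "arclength \<gamma> a b - e \<le> (\<Sum>i<n. dist (\<gamma> (t i)) (\<gamma> (t (Suc i))))"
proof -
  have "polygonal_lengths \<gamma> a b \<noteq> {}" using dist_in_polygonal_lengths[of a b \<gamma>] assms by auto
  then obtain x where "x \<in> polygonal_lengths \<gamma> a b" "arclength \<gamma> a b - e < x"
    using less_cSup_iff[of "polygonal_lengths \<gamma> a b" "arclength \<gamma> a b - e"] bdd assms
    unfolding arclength_def by auto
  then show thesis using that unfolding polygonal_lengths_def by fastforce
qed

lemma polygon_mono:
  fixes t :: "nat \<Rightarrow> real"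
  assumes "\<And>i. i < n \<Longrightarrow> t i \<le> t (Suc i)" "j \<le> k" "k \<le> n"
  shows "t j \<le> t k"
  using assms(2,3)
proof (induction k rule: dec_induct)
  case (step k)
  then show ?case using assms(1)[of k] by auto
qed simp

lemma arclength_add:
  assumes "0 \<le> a" "a \<le> b" "b \<le> c" "c \<le> 1"
  shows "arclength \<gamma> a c = arclength \<gamma> a b + arclength \<gamma> b c"
proof (rule antisym)
  show "arclength \<gamma> a c \<le> arclength \<gamma> a b + arclength \<gamma> b c"
  proof (rule field_le_epsilon)
    fix e :: real assume "e > 0"
    then obtain n t where t: "t 0 = a" "t n = c" "\<And>i. i < n \<Longrightarrow> t i \<le> t (Suc i)"
      "arclength \<gamma> a c - e \<le> (\<Sum>i<n. dist (\<gamma> (t i)) (\<gamma> (t (Suc i))))"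
      by (rule near_arclength[OF assms(1) order_trans[OF assms(2,3)] assms(4)]) blast
    have "(\<Sum>i<n. dist (\<gamma> (min (t i) b)) (\<gamma> (min (t (Suc i)) b))) \<in> polygonal_lengths \<gamma> a b"
      by (rule polygonal_lengthsI) (use t(1,2) assms min.mono[OF t(3) order_refl] in \<open>simp_all del: min.bounded_iff\<close>)
    then have "(\<Sum>i<n. dist (\<gamma> (min (t i) b)) (\<gamma> (min (t (Suc i)) b))) \<le> arclength \<gamma> a b"
      using assms by (intro le_arclength) auto
    moreover have "(\<Sum>i<n. dist (\<gamma> (max (t i) b)) (\<gamma> (max (t (Suc i)) b))) \<in> polygonal_lengths \<gamma> b c"
      by (rule polygonal_lengthsI) (use t(1,2) assms max.mono[OF t(3) order_refl] in \<open>simp_all del: max.bounded_iff\<close>)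
    then have "(\<Sum>i<n. dist (\<gamma> (max (t i) b)) (\<gamma> (max (t (Suc i)) b))) \<le> arclength \<gamma> b c"
      using assms by (intro le_arclength) auto
    moreover have "(\<Sum>i<n. dist (\<gamma> (t i)) (\<gamma> (t (Suc i))))
       \<le> (\<Sum>i<n. dist (\<gamma> (min (t i) b)) (\<gamma> (min (t (Suc i)) b)))
         + (\<Sum>i<n. dist (\<gamma> (max (t i) b)) (\<gamma> (max (t (Suc i)) b)))"
      by (rule polygon_split) (rule t(3))
    ultimately show "arclength \<gamma> a c \<le> arclength \<gamma> a b + arclength \<gamma> b c + e"
      using t(4) by linarith
  qed
  show "arclength \<gamma> a b + arclength \<gamma> b c \<le> arclength \<gamma> a c"
  proof (rule field_le_epsilon)
    fix e :: real assume "e > 0"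
    then have e2: "e / 2 > 0" by simp
    obtain n t where t: "t 0 = a" "t n = b" "\<And>i. i < n \<Longrightarrow> t i \<le> t (Suc i)"
      "arclength \<gamma> a b - e / 2 \<le> (\<Sum>i<n. dist (\<gamma> (t i)) (\<gamma> (t (Suc i))))"
      by (rule near_arclength[OF assms(1,2) order_trans[OF assms(3,4)] e2]) blast
    obtain m u where u: "u 0 = b" "u m = c" "\<And>i. i < m \<Longrightarrow> u i \<le> u (Suc i)"
      "arclength \<gamma> b c - e / 2 \<le> (\<Sum>i<m. dist (\<gamma> (u i)) (\<gamma> (u (Suc i))))"
      by (rule near_arclength[OF order_trans[OF assms(1,2)] assms(3,4) e2]) blast
    have "(\<Sum>i<n. dist (\<gamma> (t i)) (\<gamma> (t (Suc i)))) + (\<Sum>i<m. dist (\<gamma> (u i)) (\<gamma> (u (Suc i)))) \<le> arclength \<gamma> a c"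
      using assms t u by (intro le_arclength polygonal_lengths_concat[where b = b] polygonal_lengthsI) auto
    then show "arclength \<gamma> a b + arclength \<gamma> b c \<le> arclength \<gamma> a c + e"
      using t(4) u(4) by linarith
  qed
qed

text \<open>
  Clip a polygon of almost full length to \<open>[x, y]\<close>. The parts before \<open>x\<close> and after \<open>y\<close> have at most the
  length of these pieces of the curve, so the clipped polygon loses no more than the whole polygon
  does. It has a fixed number of edges, each of them short when \<open>x\<close> and \<open>y\<close> are close.
\<close>

lemma short_arclength:
  assumes "e > 0"
  obtains d where "d > 0"
    "\<And>x y. 0 \<le> x \<Longrightarrow> x \<le> y \<Longrightarrow> y \<le> 1 \<Longrightarrow> y - x < d \<Longrightarrow> arclength \<gamma> x y \<le> e"
proof -
  obtain n t where t: "t 0 = 0" "t n = 1" "\<And>i. i < n \<Longrightarrow> t i \<le> t (Suc i)"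
      "arclength \<gamma> 0 1 - e / 2 \<le> (\<Sum>i<n. dist (\<gamma> (t i)) (\<gamma> (t (Suc i))))"
    by (rule near_arclength[OF order_refl zero_le_one order_refl half_gt_zero[OF assms]]) blast
  define e' where "e' = e / (2 * real (Suc n))"
  have e': "e' > 0" "real n * e' \<le> e / 2" using assms by (simp_all add: e'_def field_simps)
  have "uniformly_continuous_on {0..1} \<gamma>"
    by (intro compact_uniformly_continuous cont) auto
  then obtain d where d: "d > 0"
     "\<And>x y. x \<in> {0..1} \<Longrightarrow> y \<in> {0..1} \<Longrightarrow> dist y x < d \<Longrightarrow> dist (\<gamma> y) (\<gamma> x) < e'"
    unfolding uniformly_continuous_on_def using e' by metis
  show thesis
  proof (rule that[OF d(1)])
    fix x y :: real assume xy: "0 \<le> x" "x \<le> y" "y \<le> 1" "y - x < d"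
    define v where "v = (\<lambda>i. max (t i) x)"
    have v: "v i \<le> v (Suc i)" if "i < n" for i
      using t(3)[OF that] by (auto simp: v_def)
    have "(\<Sum>i<n. dist (\<gamma> (t i)) (\<gamma> (t (Suc i))))
       \<le> (\<Sum>i<n. dist (\<gamma> (min (t i) x)) (\<gamma> (min (t (Suc i)) x)))
         + (\<Sum>i<n. dist (\<gamma> (v i)) (\<gamma> (v (Suc i))))"
      unfolding v_def by (rule polygon_split) (rule t(3))
    moreover have "(\<Sum>i<n. dist (\<gamma> (v i)) (\<gamma> (v (Suc i))))
       \<le> (\<Sum>i<n. dist (\<gamma> (min (v i) y)) (\<gamma> (min (v (Suc i)) y)))
         + (\<Sum>i<n. dist (\<gamma> (max (v i) y)) (\<gamma> (max (v (Suc i)) y)))"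
      by (rule polygon_split) (rule v)
    moreover have "(\<Sum>i<n. dist (\<gamma> (min (t i) x)) (\<gamma> (min (t (Suc i)) x))) \<in> polygonal_lengths \<gamma> 0 x"
      by (rule polygonal_lengthsI) (use t(1,2) xy min.mono[OF t(3) order_refl] in \<open>simp_all del: min.bounded_iff\<close>)
    then have "(\<Sum>i<n. dist (\<gamma> (min (t i) x)) (\<gamma> (min (t (Suc i)) x))) \<le> arclength \<gamma> 0 x"
      using xy by (intro le_arclength) auto
    moreover have "v 0 = x" "v n = 1" using t(1,2) xy by (simp_all add: v_def)
    then have "(\<Sum>i<n. dist (\<gamma> (max (v i) y)) (\<gamma> (max (v (Suc i)) y))) \<in> polygonal_lengths \<gamma> y 1"
      by (intro polygonal_lengthsI) (use xy max.mono[OF v order_refl] in \<open>simp_all del: max.bounded_iff\<close>)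
    then have "(\<Sum>i<n. dist (\<gamma> (max (v i) y)) (\<gamma> (max (v (Suc i)) y))) \<le> arclength \<gamma> y 1"
      using xy by (intro le_arclength) auto
    moreover have "(\<Sum>i<n. dist (\<gamma> (min (v i) y)) (\<gamma> (min (v (Suc i)) y))) \<le> (\<Sum>i<n. e')"
    proof (rule sum_mono)
      fix i
      have "min (v j) y \<in> {x..y}" for j using xy by (auto simp: v_def)
      then have "dist (min (v (Suc i)) y) (min (v i) y) \<le> y - x" "min (v j) y \<in> {0..1}" for j
        using xy by (auto simp: dist_real_def abs_le_iff) (smt (verit) atLeastAtMost_iff)+
      then show "dist (\<gamma> (min (v i) y)) (\<gamma> (min (v (Suc i)) y)) \<le> e'"
        using d(2)[of "min (v (Suc i)) y" "min (v i) y"] xy(4)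
        by (simp add: dist_commute less_imp_le)
    qed
    moreover have "arclength \<gamma> 0 1 = arclength \<gamma> 0 x + arclength \<gamma> x y + arclength \<gamma> y 1"
      using arclength_add[of 0 x 1] arclength_add[of x y 1] xy by simp
    ultimately show "arclength \<gamma> x y \<le> e" using t(4) e' by simp
  qed
qed

end

locale rectifiable_Jordan = rectifiable_curve +
  assumes simple: "simple_path \<gamma>" and closed: "pathfinish \<gamma> = pathstart \<gamma>"
begin

abbreviation "len \<equiv> arclength \<gamma> 0"

abbreviation "total_len \<equiv> arclength \<gamma> 0 1"

lemma inj: "x \<in> {0..1} \<Longrightarrow> y \<in> {0..1} \<Longrightarrow> \<gamma> x = \<gamma> y \<Longrightarrow> x = y \<or> x = 0 \<and> y = 1 \<or> x = 1 \<and> y = 0"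
  using simple by (auto simp: simple_path_def loop_free_def)

lemma len_diff: "0 \<le> x \<Longrightarrow> x \<le> y \<Longrightarrow> y \<le> 1 \<Longrightarrow> len y - len x = arclength \<gamma> x y"
  using arclength_add[of 0 x y] by simp

lemma arclength_pos:
  assumes "0 \<le> x" "x < y" "y \<le> 1"
  shows "0 < arclength \<gamma> x y"
proof (cases "\<gamma> x = \<gamma> y")
  case False
  then have "0 < dist (\<gamma> x) (\<gamma> y)" by simp
  then show ?thesis using dist_le_arclength[of x y] assms by linarith
next
  case True
  then have xy: "x = 0" "y = 1" using inj[of x y] assms by auto
  have "\<gamma> 0 \<noteq> \<gamma> (1 / 2)" using inj[of 0 "1 / 2"] by auto
  then have "0 < dist (\<gamma> 0) (\<gamma> (1 / 2))" by simp
  also have "\<dots> \<le> arclength \<gamma> 0 (1 / 2)" by (rule dist_le_arclength) auto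
  also have "\<dots> \<le> arclength \<gamma> 0 1"
    using arclength_add[of 0 "1/2" 1] dist_le_arclength[of "1/2" 1] zero_le_dist[of "\<gamma> (1/2)" "\<gamma> 1"] by linarith
  finally show ?thesis by (simp add: xy)
qed

lemma len_0: "len 0 = 0"
  using arclength_add[of 0 0 0] by simp

lemma len_less: "0 \<le> x \<Longrightarrow> x < y \<Longrightarrow> y \<le> 1 \<Longrightarrow> len x < len y"
  using arclength_pos[of x y] len_diff[of x y] by simp

lemma len_le: "0 \<le> x \<Longrightarrow> x \<le> y \<Longrightarrow> y \<le> 1 \<Longrightarrow> len x \<le> len y"
  using len_less[of x y] by (cases "x = y") auto

lemma len_inj: "inj_on len {0..1}"
  by (rule linorder_inj_onI) (use len_less in force)+

lemma len_continuous: "continuous_on {0..1} len"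
  unfolding continuous_on_iff
proof (intro ballI allI impI)
  fix x e :: real assume x: "x \<in> {0..1}" and e: "e > 0"
  obtain d where d: "d > 0"
    "\<And>x y. 0 \<le> x \<Longrightarrow> x \<le> y \<Longrightarrow> y \<le> 1 \<Longrightarrow> y - x < d \<Longrightarrow> arclength \<gamma> x y \<le> e / 2"
    using short_arclength[of "e / 2"] e by auto
  show "\<exists>d>0. \<forall>x'\<in>{0..1}. dist x' x < d \<longrightarrow> dist (len x') (len x) < e"
  proof (intro exI[of _ d] conjI ballI impI d(1))
    fix y assume y: "y \<in> {0..1}" "dist y x < d"
    show "dist (len y) (len x) < e"
    proof (cases "x \<le> y")
      case True
      then show ?thesis
        using d(2)[of x y] len_diff[of x y] len_le[of x y] x y e by (auto simp: dist_real_def)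
    next
      case False
      then show ?thesis
        using d(2)[of y x] len_diff[of y x] len_le[of y x] x y e by (auto simp: dist_real_def)
    qed
  qed
qed

lemma len_image: "len ` {0..1} = {0..total_len}"
proof
  show "len ` {0..1} \<subseteq> {0..total_len}"
    using len_le[of 0] len_le[of _ 1] by (auto simp: len_0)
  show "{0..total_len} \<subseteq> len ` {0..1}"
  proof
    fix s assume "s \<in> {0..total_len}"
    then obtain x where "0 \<le> x" "x \<le> 1" "len x = s"
      using IVT'[of len 0 s 1] len_continuous by (auto simp: len_0)
    then show "s \<in> len ` {0..1}" by auto
  qed
qed

lemma natural_param_len: "x \<in> {0..1} \<Longrightarrow> natural_param \<gamma> (len x) = \<gamma> x"
  by (simp add: natural_param_def inv_into_f_f[OF len_inj])

lemma parameter: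
  assumes "s \<in> {0..total_len}"
  obtains x where "x \<in> {0..1}" "s = len x" "natural_param \<gamma> s = \<gamma> x"
  using assms natural_param_len unfolding len_image[symmetric] by auto

lemma natural_param_image: "natural_param \<gamma> ` {0..total_len} = path_image \<gamma>"
  unfolding len_image[symmetric] path_image_def image_image
  by (intro image_cong refl natural_param_len)

lemma total_len_pos: "0 < total_len"
  using arclength_pos[of 0 1] by simp

sublocale arclength_curve "natural_param \<gamma>" total_len
proof
  show "0 < total_len" by (rule total_len_pos)
next
  fix s t assume st: "s \<in> {0..total_len}" "t \<in> {0..total_len}"
  obtain x where x: "x \<in> {0..1}" "s = len x" "natural_param \<gamma> s = \<gamma> x" using parameter[OF st(1)] .
  obtain y where y: "y \<in> {0..1}" "t = len y" "natural_param \<gamma> t = \<gamma> y" using parameter[OF st(2)] .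
  show "norm (natural_param \<gamma> s - natural_param \<gamma> t) \<le> \<bar>s - t\<bar>"
  proof (cases "x \<le> y")
    case True
    then show ?thesis
      using dist_le_arclength[of x y] len_diff[of x y] x y by (auto simp: dist_norm)
  next
    case False
    then show ?thesis
      using dist_le_arclength[of y x] len_diff[of y x] x y by (auto simp: dist_norm norm_minus_commute)
  qed
  assume "natural_param \<gamma> s = natural_param \<gamma> t"
  then have "x = y \<or> x = 0 \<and> y = 1 \<or> x = 1 \<and> y = 0" using inj x y by auto
  then show "s = t \<or> s = 0 \<and> t = total_len \<or> s = total_len \<and> t = 0"
    using x y len_0 by auto
next
  fix e :: real assume "e > 0"
  then obtain n t where t: "t 0 = 0" "t n = 1" "\<And>i. i < n \<Longrightarrow> t i \<le> t (Suc i)"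
      "total_len - e \<le> (\<Sum>i<n. dist (\<gamma> (t i)) (\<gamma> (t (Suc i))))"
    by (rule near_arclength[OF order_refl zero_le_one order_refl]) blast
  have t01: "t i \<in> {0..1}" if "i \<le> n" for i
    using polygon_mono[of n t 0 i] polygon_mono[of n t i n] that t(1-3) by auto
  show "\<exists>n t. t 0 = 0 \<and> t n = total_len \<and> (\<forall>i<n. t i \<le> t (Suc i)) \<and>
      total_len - e \<le> (\<Sum>i<n. norm (natural_param \<gamma> (t (Suc i)) - natural_param \<gamma> (t i)))"
  proof (intro exI[of _ n] exI[of _ "\<lambda>i. len (t i)"] conjI allI impI)
    fix i assume "i < n"
    then show "len (t i) \<le> len (t (Suc i))" using t01[of i] t01[of "Suc i"] t(3) by (intro len_le) auto
  next
    have "(\<Sum>i<n. norm (natural_param \<gamma> (len (t (Suc i))) - natural_param \<gamma> (len (t i))))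
        = (\<Sum>i<n. dist (\<gamma> (t i)) (\<gamma> (t (Suc i))))"
      using t01 by (intro sum.cong) (auto simp: natural_param_len dist_norm norm_minus_commute)
    then show "total_len - e \<le> (\<Sum>i<n. norm (natural_param \<gamma> (len (t (Suc i))) - natural_param \<gamma> (len (t i))))"
      using t(4) by simp
  qed (use t len_0 in auto)
qed

text \<open>
  A continuous logarithm along \<open>\<gamma>\<close> composed with the inverse of the length function is one along the
  parametrization by arc length.
\<close>

lemma log_change_total:
  assumes "z \<notin> path_image \<gamma>"
  shows "log_change (natural_param \<gamma>) 0 total_len z = 2 * of_real pi * \<i> * winding_number \<gamma> z"
proof -
  obtain q where q: "path q" "pathfinish q - pathstart q = 2 * of_real pi * \<i> * winding_number \<gamma> z"
     "\<And>t. t \<in> {0..1} \<Longrightarrow> \<gamma> t = z + exp (q t)"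
    using winding_number_as_continuous_log[of \<gamma> z] simple_path_imp_path[OF simple] assms by metis
  define r where "r = inv_into {0..1} len"
  have r_len: "r (len x) = x" if "x \<in> {0..1}" for x
    unfolding r_def using len_inj that by (rule inv_into_f_f)
  have r_cont: "continuous_on {0..total_len} r"
    unfolding len_image[symmetric] r_def
    by (rule continuous_on_inv[OF len_continuous]) (auto simp: inv_into_f_f[OF len_inj])
  have r_range: "r s \<in> {0..1}" if "s \<in> {0..total_len}" for s
    using that r_len unfolding len_image[symmetric] by auto
  have "log_change (natural_param \<gamma>) 0 total_len z = q (r total_len) - q (r 0)"
  proof (rule log_change_eqI[where q = "\<lambda>s. q (r s)"])
    show "continuous_on {0..total_len} (\<lambda>s. q (r s))"
      using q(1) r_range unfolding path_def by (intro continuous_on_compose2[OF _ r_cont]) auto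
    fix s assume s: "s \<in> {0..total_len}"
    then show "natural_param \<gamma> s - z = exp (q (r s))"
      using q(3)[OF r_range[OF s]] by (simp add: natural_param_def r_def)
  qed (use total_len_pos in auto)
  then show ?thesis
    using q(2) r_len[of 1] r_len[of 0] by (simp add: len_0 pathfinish_def pathstart_def)
qed

lemma arclength_Jordan:
  obtains orient where "arclength_Jordan_curve (natural_param \<gamma>) total_len (inside (path_image \<gamma>)) orient"
proof -
  note J = Jordan_inside_outside[OF simple closed]
  obtain orient :: real where orient: "orient = 1 \<or> orient = -1"
    "\<And>z. z \<in> inside (path_image \<gamma>) \<Longrightarrow> winding_number \<gamma> z = of_real orient"
    using simple_closed_path_winding_number_inside[OF simple]
    by (metis of_real_1 of_real_minus)
  have D: "log_change (natural_param \<gamma>) 0 total_len z = \<i> * of_real (2 * pi * orient)"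
    if "z \<in> inside (path_image \<gamma>)" for z
  proof -
    have "z \<notin> path_image \<gamma>" using that by (auto simp: inside_def)
    then show ?thesis using log_change_total orient(2)[OF that] by simp
  qed
  show thesis
  proof (rule that[of orient], unfold_locales)
    show "open (inside (path_image \<gamma>))" using J by blast
    show "frontier (inside (path_image \<gamma>)) = natural_param \<gamma> ` {0..total_len}"
      unfolding natural_param_image using J by blast
    show "orient = 1 \<or> orient = - 1" by (rule orient)
  next
    fix z assume "z \<in> inside (path_image \<gamma>)"
    then show "log_change (natural_param \<gamma>) 0 total_len z = \<i> * of_real (2 * pi * orient)" by (rule D)
  next
    fix z assume "z \<notin> natural_param \<gamma> ` {0..total_len}"
    then have z: "z \<notin> path_image \<gamma>" unfolding natural_param_image .
    show "log_change (natural_param \<gamma>) 0 total_len z \<in> {0, \<i> * of_real (2 * pi * orient)}"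
    proof (cases "z \<in> inside (path_image \<gamma>)")
      case True
      then show ?thesis using D by simp
    next
      case False
      then have "z \<in> outside (path_image \<gamma>)" using z inside_Un_outside[of "path_image \<gamma>"] by blast
      then have "winding_number \<gamma> z = 0"
        using simple closed simple_path_imp_path by (intro winding_number_zero_in_outside) auto
      then show ?thesis using log_change_total[OF z] by simp
    qed
  qed
qed

end

section \<open>Harmonic functions with prescribed directional derivatives\<close>

text \<open>
  The derivatives of \<open>Re F\<close> are \<open>v \<mapsto> Re (g z v)\<close> and \<open>(v, w) \<mapsto> Re (g' z v w)\<close>, the functionals
  \<open>S\<close> and \<open>T\<close> of the proof; the trace of the second one vanishes because \<open>\<i>\<^sup>2 = -1\<close>.
\<close>

lemma harmonic_on_Re_primitive:
  assumes "open D" "g holomorphic_on D" and F: "\<And>z. z \<in> D \<Longrightarrow> (F has_field_derivative g z) (at z)"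
  shows "harmonic_on (\<lambda>z. Re (F z)) D"
proof -
  define R :: "complex \<Rightarrow>\<^sub>L real" where "R = Blinfun Re"
  have R: "blinfun_apply R = Re"
    unfolding R_def by (rule bounded_linear_Blinfun_apply) (rule bounded_linear_Re)
  define S where "S = (\<lambda>a::complex. R o\<^sub>L blinfun_mult_right a)"
  have S: "blinfun_apply (S a) v = Re (a * v)" for a v
    by (simp add: S_def R)
  have S_lin: "bounded_linear S"
    unfolding S_def
    by (rule bounded_linear_compose[OF bounded_bilinear.bounded_linear_right[OF bounded_bilinear_blinfun_compose] bounded_linear_blinfun_mult_right])
  define SS where "SS = Blinfun S"
  have SS: "blinfun_apply SS = S"
    unfolding SS_def by (rule bounded_linear_Blinfun_apply) (rule S_lin)
  define T where "T = (\<lambda>a::complex. SS o\<^sub>L blinfun_mult_right a)"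
  have T: "blinfun_apply (T a) v = S (a * v)" for a v
    by (simp add: T_def SS)
  have T_lin: "bounded_linear T"
    unfolding T_def
    by (rule bounded_linear_compose[OF bounded_bilinear.bounded_linear_right[OF bounded_bilinear_blinfun_compose] bounded_linear_blinfun_mult_right])
  have S_eq: "blinfun_apply (S a) = (\<lambda>v. Re (a * v))" for a by (rule ext) (rule S)
  have T_eq: "blinfun_apply (T a) = (\<lambda>v. S (a * v))" for a by (rule ext) (rule T)
  have g': "(g has_field_derivative deriv g z) (at z)" if "z \<in> D" for z
    using holomorphic_derivI[OF assms(2,1) that] .
  show ?thesis
    unfolding harmonic_on_def
  proof (intro exI[of _ "\<lambda>z. S (g z)"] exI[of _ "\<lambda>z. T (deriv g z)"] conjI ballI)
    fix z assume z: "z \<in> D"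
    have "(F has_derivative (\<lambda>v. g z * v)) (at z)"
      using F[OF z] by (simp add: has_field_derivative_def)
    from bounded_linear.has_derivative[OF bounded_linear_Re this]
    show "((\<lambda>z. Re (F z)) has_derivative blinfun_apply (S (g z))) (at z)"
      by (simp only: S_eq)
    have "(g has_derivative (\<lambda>v. deriv g z * v)) (at z)"
      using g'[OF z] by (simp add: has_field_derivative_def)
    from bounded_linear.has_derivative[OF S_lin this]
    show "((\<lambda>z. S (g z)) has_derivative blinfun_apply (T (deriv g z))) (at z)"
      by (simp only: T_eq)
    show "blinfun_apply (blinfun_apply (T (deriv g z)) 1) 1
        + blinfun_apply (blinfun_apply (T (deriv g z)) \<i>) \<i> = 0"
      by (simp add: T S)
  next
    have "continuous_on D (deriv g)"
      using holomorphic_deriv[OF assms(2,1)] by (rule holomorphic_on_imp_continuous_on)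
    then show "continuous_on D (\<lambda>z. T (deriv g z))"
      by (rule bounded_linear.continuous_on[OF T_lin])
  qed
qed

lemma dir_deriv_Re:
  assumes "(F has_field_derivative d) (at z)"
  shows "dir_deriv v (\<lambda>z. Re (F z)) z = Re (v * d)"
proof -
  have "((\<lambda>t::real. z + of_real t * v) has_vector_derivative v) (at 0)"
    by (auto intro!: derivative_eq_intros simp: has_vector_derivative_def scaleR_conv_of_real)
  moreover have "(F has_field_derivative d) (at (z + of_real 0 * v))"
    using assms by simp
  ultimately have "((F \<circ> (\<lambda>t::real. z + of_real t * v)) has_vector_derivative (v * d)) (at 0)"
    by (rule field_vector_diff_chain_at)
  then have "((\<lambda>t::real. Re (F (z + of_real t * v))) has_vector_derivative Re (v * d)) (at 0)"
    unfolding o_def by (rule bounded_linear.has_vector_derivative[OF bounded_linear_Re])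
  then show ?thesis
    unfolding dir_deriv_def
    by (intro DERIV_imp_deriv) (simp only: has_real_derivative_iff_has_vector_derivative)
qed

theorem theorem3:
  fixes \<gamma> :: "real \<Rightarrow> complex" and D :: "complex set"
    and \<nu> :: "complex \<Rightarrow> complex" and \<phi> :: "complex \<Rightarrow> real"
  assumes "rectifiable_Jordan_curve \<gamma>"
    and "D = inside (path_image \<gamma>)"
    and "\<forall>\<zeta>\<in>frontier D. norm (\<nu> \<zeta>) = 1"
    and "measurable_wrt_natural_param \<gamma> \<nu>"
    and "measurable_wrt_natural_param \<gamma> \<phi>"
  shows "\<exists>u :: complex \<Rightarrow> real. harmonic_on u D \<and>
           ae_wrt_natural_param \<gamma> (\<lambda>\<zeta>.
             \<forall>p. nontangential_path D \<zeta> p \<longrightarrow>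
               ((\<lambda>t. dir_deriv (\<nu> \<zeta>) u (p t)) \<longlongrightarrow> \<phi> \<zeta>) (at_left 1))"
proof -
  interpret rectifiable_Jordan \<gamma>
    using assms(1) by unfold_locales (auto simp: rectifiable_Jordan_curve_def)
  obtain orient where "arclength_Jordan_curve (natural_param \<gamma>) (arclength \<gamma> 0 1) D orient"
    using arclength_Jordan unfolding assms(2) by blast
  then interpret J: arclength_Jordan_curve "natural_param \<gamma>" "arclength \<gamma> 0 1" D orient .
  let ?I = "{0..arclength \<gamma> 0 1}"
  have meas: "(\<lambda>s. \<nu> (natural_param \<gamma> s)) \<in> borel_measurable (lebesgue_on ?I)"
      "(\<lambda>s. \<phi> (natural_param \<gamma> s)) \<in> borel_measurable (lebesgue_on ?I)"
    using assms(4,5) by (simp_all add: measurable_wrt_natural_param_def natural_param_space_def)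
  have unit: "norm (\<nu> (natural_param \<gamma> s)) = 1" if "s \<in> ?I" for s
    using assms(3) that unfolding J.frontier_D by blast
  obtain g where g: "g holomorphic_on D"
    and g_lim: "AE s in lebesgue_on ?I. \<forall>p. nontangential_path D (natural_param \<gamma> s) p \<longrightarrow>
       ((\<lambda>t. Re (\<nu> (natural_param \<gamma> s) * g (p t))) \<longlongrightarrow> \<phi> (natural_param \<gamma> s)) (at_left 1)"
    using J.boundary_values_of_rotated_real_part[OF meas(1) unit meas(2)] by blast
  have "simply_connected D"
    unfolding assms(2) by (rule simply_connected_inside_simple_path[OF simple])
  then obtain F where F: "\<And>z. z \<in> D \<Longrightarrow> (F has_field_derivative g z) (at z)"
    using g simply_connected_eq_global_primitive[OF J.D_open] by blast
  show ?thesis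
  proof (intro exI[of _ "\<lambda>z. Re (F z)"] conjI)
    show "harmonic_on (\<lambda>z. Re (F z)) D"
      by (rule harmonic_on_Re_primitive[OF J.D_open g F])
    show "ae_wrt_natural_param \<gamma> (\<lambda>\<zeta>. \<forall>p. nontangential_path D \<zeta> p \<longrightarrow>
               ((\<lambda>t. dir_deriv (\<nu> \<zeta>) (\<lambda>z. Re (F z)) (p t)) \<longlongrightarrow> \<phi> \<zeta>) (at_left 1))"
      unfolding ae_wrt_natural_param_def natural_param_space_def
      using g_lim
    proof eventually_elim
      case (elim s)
      show ?case
      proof (intro allI impI)
        fix p assume p: "nontangential_path D (natural_param \<gamma> s) p"
        have "\<forall>\<^sub>F t in at_left (1::real). t \<in> {0<..<1}"
          by (rule eventually_at_left_real) simp
        then have "\<forall>\<^sub>F t in at_left 1. Re (\<nu> (natural_param \<gamma> s) * g (p t))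
            = dir_deriv (\<nu> (natural_param \<gamma> s)) (\<lambda>z. Re (F z)) (p t)"
        proof eventually_elim
          case (elim t)
          then have "p t \<in> D" using p by (auto simp: nontangential_path_def)
          then show ?case using dir_deriv_Re[OF F] by simp
        qed
        moreover have "((\<lambda>t. Re (\<nu> (natural_param \<gamma> s) * g (p t))) \<longlongrightarrow> \<phi> (natural_param \<gamma> s)) (at_left 1)"
          using elim p by blast
        ultimately show "((\<lambda>t. dir_deriv (\<nu> (natural_param \<gamma> s)) (\<lambda>z. Re (F z)) (p t))
            \<longlongrightarrow> \<phi> (natural_param \<gamma> s)) (at_left 1)"
          by (rule Lim_transform_eventually[rotated])
      qed
    qed
  qed
qed

end
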